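(* Let $\mathcal T$ be a physical theory. The law $\rightarrow$ is a derivation of the algebra $(\widetilde{\mathcal F}_{\mathcal T},\odot)$. In other words, for any $\bar\Gamma_1\in\widetilde V_{\mathcal T}$ and $(\bar\Gamma_2,\bar\gamma_2),(\bar\Gamma_3,\bar\gamma_3)\in\widetilde{\mathcal F}_{\mathcal T}$, $$\bar\Gamma_1\rightarrow\big((\bar\Gamma_2,\bar\gamma_2)\odot(\bar\Gamma_3,\bar\gamma_3)\big)=\big(\bar\Gamma_1\rightarrow(\bar\Gamma_2,\bar\gamma_2)\big)\odot(\bar\Gamma_3,\bar\gamma_3)+(\bar\Gamma_2,\bar\gamma_2)\odot\big(\bar\Gamma_1\rightarrow(\bar\Gamma_3,\bar\gamma_3)\big).$$
   Context: **Feynman graphs.** A graph $\Gamma$ is given by a finite set $\mathcal V(\Gamma)$ of vertices, a finite set $\mathcal E(\Gamma)$ of half-edges, a map $\partial:\mathcal E(\Gamma)\to\mathcal V(\Gamma)$ and an involution $\sigma_\Gamma:\mathcal E(\Gamma)\to\mathcal E(\Gamma)$. Half-edges are partitioned into types and $\sigma_\Gamma$ respects types. Fixed points of $\sigma_\Gamma$ are the external edges; pairs $\{e,\sigma_\Gamma(e)\}$ with $e\ne\sigma_\Gamma(e)$ are the internal edges; $st(v)=\partial^{-1}(v)$. Graphs are considered up to isomorphism. $\pi_0(\Gamma)$ is the set of connected components. A $1PI$ graph is a connected graph which remains connected when any one internal edge is cut (replaced by two external edges); a graph is locally $1PI$ if all its connected components are $1PI$. The residue $\mathrm{res}\,\Gamma$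 is obtained by shrinking each connected component to a point (retaining its external edges). A covering subgraph $\gamma$ of $\Gamma$ is a graph obtained from $\Gamma$ by cutting some internal edges (same vertices and half-edges). $\Gamma/\gamma$ is obtained by shrinking each connected component of $\gamma$ inside $\Gamma$ to a point. **Theory.** A theory $\mathcal T$ prescribes a set $\mathcal E(\mathcal T)$ of half-edge types and a set $\mathcal V(\mathcal T)$ of vertex types. The types of the half-edges in $st(v)$ need not determine the type of $v$; vertex types sharing the same collection of half-edge types are distinguished by an integer index. **Specified graphs.** A specified graph of $\mathcal T$ is a couple $\bar\Gamma=(\Gamma,\underline i)$ where $\Gamma$ is a locally $1PI$ superficially divergent graph (the residue of each component is a vertex of $\mathcal T$) with half-edges and vertices of the types prescribed by $\mathcal T$, and $\underline i:\pi_0(\Gamma)\to\mathbb N$ is such that $\underline i(\gamma)$ is one of the indices allowed by the possible types of the vertex obtained by contracting the component $\gamma$. A specified graph $\bar\gamma=(\gamma,\underline j)$ is a specified covering subgraph of $\bar\Gamma=(\Gamma,\underline i)$, written $\bar\gamma\subset\bar\Gamma$, if $\gamma$ is a covering subgraph of $\Gamma$ and $\underline j(\gamma_0)=\underline i(\gamma_0)$ for every component $\gamma_0$ of $\gamma$ that is also a component of $\Gamma$. The contracted graph $\bar\Gamma/\bar\gamma$ is $\Gamma/\gamma$ with the new vertices given the types specified by $\underline j$, and with specification $\underline i$. $\widetilde V_{\mathcal T}$ is the vector space (over a field $k$) generated by the connected ($1PI$) specified graphs; $\widetilde{\mathcal F}_{\mathcal T}$ is the vector space spanned by pairs $(\bar\Gamma,\bar\gamma)$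 with $\bar\Gamma$ a connected $1PI$ specified graph, $\bar\gamma\subset\bar\Gamma$ and $\bar\Gamma/\bar\gamma\in\widetilde V_{\mathcal T}$. **Insertion.** For connected specified graphs $\bar\Gamma_1=(\Gamma_1,\underline i)$, $\bar\Gamma_2=(\Gamma_2,\underline j)$ and $v\in\mathcal V(\Gamma_2)$, $\bar\Gamma_1\triangleright_v\bar\Gamma_2=(\Gamma_1\cup_v\Gamma_2,\underline j)$ if $v=\mathrm{res}\,\bar\Gamma_1$ (the type of $v$ is that of the vertex $\mathrm{res}\,\bar\Gamma_1$), and $0$ otherwise. Here $\Gamma_1\cup_v\Gamma_2$ is the sum of all possible graphs obtained by replacing $v$ by $\Gamma_1$ in $\Gamma_2$, i.e. the sum over all type-preserving bijections between the external edges of $\Gamma_1$ and $st(v)$. The same notation $\bar\Gamma_1\triangleright_v\bar\gamma_2$ is used for $\bar\gamma_2$ non-connected (insertion at $v$, all specifications of $\bar\gamma_2$ being kept). **Convention for pairs.** In a pair $(\bar\Gamma,\bar\gamma)$ the components of $\gamma$ consisting of a single vertex without internal edge are suppressed from the notation: $\mathcal V(\gamma)$ denotes the set of vertices lying in components of $\gamma$ having at least one internal edge, and $\mathcal V(\Gamma-\gamma)$ the set of vertices of $\Gamma$ which are not vertices of $\gamma$. **Operations.** $$(\bar\Gamma_1,\bar\gamma_1)\odot(\bar\Gamma_2,\bar\gamma_2)=\sum_{v\in\mathcal V(\Gamma_2-\gamma_2),\ v=\mathrm{res}\,\bar\Gamma_1}(\bar\Gamma_1\triangleright_v\bar\Gamma_2,\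 \bar\gamma_1\bar\gamma_2),$$ where each term of $\bar\Gamma_1\triangleright_v\bar\Gamma_2$ is paired with the disjoint union $\bar\gamma_1\bar\gamma_2$ seen as a subgraph of it; and $$\bar\Gamma_1\rightarrow(\bar\Gamma_2,\bar\gamma_2)=\sum_{v\in\mathcal V(\gamma_2),\ v=\mathrm{res}\,\bar\Gamma_1}(\bar\Gamma_1\triangleright_v\bar\Gamma_2,\ \bar\Gamma_1\triangleright_v\bar\gamma_2),$$ where the insertion is performed simultaneously (with the same bijection) in $\bar\Gamma_2$ and in its subgraph $\bar\gamma_2$, summing over the bijections. Both are extended bilinearly. *)

theory Defs
  imports "HOL-Library.Multiset" "HOL-Library.FuncSet" "HOL-Library.Poly_Mapping"
begin

subsection \<open>Graphs\<close>

text \<open>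
  Only the values of the maps on the carriers \<open>hedges\<close> and \<open>verts\<close> are meaningful.
  A vertex type is a multiset of half-edge types together with an index; the record stores the
  index of a vertex, and the multiset is read off from its star.
\<close>

record ('v, 'e, 'h) fgraph =
  verts :: "'v set"
  hedges :: "'e set"
  bdry :: "'e \<Rightarrow> 'v"
  invol :: "'e \<Rightarrow> 'e"
  htype :: "'e \<Rightarrow> 'h"
  vindex :: "'v \<Rightarrow> nat"

definition wf_graph :: "('v, 'e, 'h) fgraph \<Rightarrow> bool" where
  "wf_graph G \<longleftrightarrow> finite (verts G) \<and> finite (hedges G) \<and>
     (\<forall>e\<in>hedges G. bdry G e \<in> verts G \<and> invol G e \<in> hedges G \<and>
        invol G (invol G e) = e \<and> htype G (invol G e) = htype G e)"

definition external :: "('v, 'e, 'h) fgraph \<Rightarrow> 'e set" where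
  "external G = {e \<in> hedges G. invol G e = e}"

definition internal :: "('v, 'e, 'h) fgraph \<Rightarrow> 'e set" where
  "internal G = {e \<in> hedges G. invol G e \<noteq> e}"

definition star :: "('v, 'e, 'h) fgraph \<Rightarrow> 'v \<Rightarrow> 'e set" where
  "star G v = {e \<in> hedges G. bdry G e = v}"

type_synonym 'h vtype = "'h multiset \<times> nat"

definition vtype :: "('v, 'e, 'h) fgraph \<Rightarrow> 'v \<Rightarrow> 'h vtype" where
  "vtype G v = (image_mset (htype G) (mset_set (star G v)), vindex G v)"

definition joined :: "('v, 'e, 'h) fgraph \<Rightarrow> ('v \<times> 'v) set" where
  "joined G = {(bdry G e, bdry G (invol G e)) | e. e \<in> hedges G}\<^sup>* \<inter> verts G \<times> verts G"

text \<open>Connected components are represented by their vertex sets.\<close>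

definition pi0 :: "('v, 'e, 'h) fgraph \<Rightarrow> 'v set set" where
  "pi0 G = verts G // joined G"

definition component :: "('v, 'e, 'h) fgraph \<Rightarrow> 'v set \<Rightarrow> ('v, 'e, 'h) fgraph" where
  "component G C = G\<lparr>verts := C, hedges := {e \<in> hedges G. bdry G e \<in> C}\<rparr>"

definition connected_graph :: "('v, 'e, 'h) fgraph \<Rightarrow> bool" where
  "connected_graph G \<longleftrightarrow> card (pi0 G) = 1"

definition cut :: "('v, 'e, 'h) fgraph \<Rightarrow> 'e \<Rightarrow> ('v, 'e, 'h) fgraph" where
  "cut G e = G\<lparr>invol := (invol G)(e := e, invol G e := invol G e)\<rparr>"

definition one_PI :: "('v, 'e, 'h) fgraph \<Rightarrow> bool" where
  "one_PI G \<longleftrightarrow> connected_graph G \<and> (\<forall>e\<in>internal G. connected_graph (cut G e))"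

definition locally_one_PI :: "('v, 'e, 'h) fgraph \<Rightarrow> bool" where
  "locally_one_PI G \<longleftrightarrow> (\<forall>C\<in>pi0 G. one_PI (component G C))"

definition covering_subgraph :: "('v, 'e, 'h) fgraph \<Rightarrow> ('v, 'e, 'h) fgraph \<Rightarrow> bool" where
  "covering_subgraph g G \<longleftrightarrow> wf_graph g \<and> verts g = verts G \<and> hedges g = hedges G \<and>
     (\<forall>v\<in>verts G. vindex g v = vindex G v) \<and>
     (\<forall>e\<in>hedges G. bdry g e = bdry G e \<and> htype g e = htype G e \<and>
        (invol g e = e \<or> invol g e = invol G e))"

text \<open>
  The contraction of \<open>G\<close> along its covering subgraph \<open>g\<close>: the vertices are the components of \<open>g\<close>,
  indexed by \<open>j\<close>, and the half-edges are those not belonging to an internal edge of \<open>g\<close>.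
\<close>

definition contract ::
  "('v, 'e, 'h) fgraph \<Rightarrow> ('v, 'e, 'h) fgraph \<Rightarrow> ('v set \<Rightarrow> nat) \<Rightarrow> ('v set, 'e, 'h) fgraph" where
  "contract G g j =
     \<lparr>verts = pi0 g, hedges = external g, bdry = (\<lambda>e. joined g `` {bdry g e}),
      invol = invol G, htype = htype G, vindex = j\<rparr>"

definition residue :: "('v, 'e, 'h) fgraph \<Rightarrow> ('v set \<Rightarrow> nat) \<Rightarrow> ('v set, 'e, 'h) fgraph" where
  "residue G i = contract G G i"


subsection \<open>Theories and specified graphs\<close>

record 'h qft =
  htypes :: "'h set"
  vtypes :: "'h vtype set"

definition physical_theory :: "'h qft \<Rightarrow> bool" where
  "physical_theory T \<longleftrightarrow> (\<forall>(M, n)\<in>vtypes T. set_mset M \<subseteq> htypes T)"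

type_synonym ('v, 'e, 'h) sgraph = "('v, 'e, 'h) fgraph \<times> ('v set \<Rightarrow> nat)"

definition superficially_divergent :: "'h qft \<Rightarrow> ('v, 'e, 'h) fgraph \<Rightarrow> bool" where
  "superficially_divergent T G \<longleftrightarrow>
     (\<forall>C\<in>pi0 G. \<exists>n. vtype (residue G (\<lambda>_. n)) C \<in> vtypes T)"

fun specified_graph :: "'h qft \<Rightarrow> ('v, 'e, 'h) sgraph \<Rightarrow> bool" where
  "specified_graph T (G, i) \<longleftrightarrow> wf_graph G \<and>
     (\<forall>e\<in>hedges G. htype G e \<in> htypes T) \<and> (\<forall>v\<in>verts G. vtype G v \<in> vtypes T) \<and>
     locally_one_PI G \<and> superficially_divergent T G \<and>
     (\<forall>C\<in>pi0 G. vtype (residue G i) C \<in> vtypes T)"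

definition connected_specified_graph :: "'h qft \<Rightarrow> ('v, 'e, 'h) sgraph \<Rightarrow> bool" where
  "connected_specified_graph T G \<longleftrightarrow> specified_graph T G \<and> connected_graph (fst G)"

text \<open>
  A component \<open>C\<close> of a covering subgraph \<open>g\<close> is also a component of \<open>G\<close> iff none of the internal
  edges of \<open>G\<close> at \<open>C\<close> is cut in \<open>g\<close>; equality of the vertex sets alone is not enough.
\<close>

fun specified_covering_subgraph ::
  "'h qft \<Rightarrow> ('v, 'e, 'h) sgraph \<Rightarrow> ('v, 'e, 'h) sgraph \<Rightarrow> bool" where
  "specified_covering_subgraph T (g, j) (G, i) \<longleftrightarrow>
     covering_subgraph g G \<and> specified_graph T (g, j) \<and>
     (\<forall>C \<in> pi0 g \<inter> pi0 G.
        (\<forall>e\<in>hedges G. bdry G e \<in> C \<longrightarrow> invol g e = invol G e) \<longrightarrow> j C = i C)"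

text \<open>
  The contracted graph keeps the specification \<open>i\<close>: a component \<open>D\<close> of the contracted graph is a set
  of components of \<open>g\<close>, whose union is the corresponding component of \<open>G\<close>.
\<close>

fun contract_specified ::
  "('v, 'e, 'h) sgraph \<Rightarrow> ('v, 'e, 'h) sgraph \<Rightarrow> ('v set, 'e, 'h) sgraph" where
  "contract_specified (G, i) (g, j) = (contract G g j, \<lambda>D. i (\<Union> D))"

text \<open>The vertex obtained by contracting a connected specified graph to a point.\<close>

fun res_type :: "('v, 'e, 'h) sgraph \<Rightarrow> 'h vtype" where
  "res_type (G, i) = vtype (residue G i) (verts G)"


subsection \<open>Pairs\<close>

type_synonym ('v, 'e, 'h) gpair = "('v, 'e, 'h) sgraph \<times> ('v, 'e, 'h) sgraph"

text \<open>
  The set of vertices lying in components having at least one internal edge: these are the vertices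
  of a subgraph once its trivial components (single vertices without internal edge) are suppressed.
\<close>

definition core :: "('v, 'e, 'h) fgraph \<Rightarrow> 'v set" where
  "core g = {v \<in> verts g. \<exists>e\<in>internal g. (v, bdry g e) \<in> joined g}"

text \<open>
  Trivial components of the subgraph being suppressed, they carry no specification of their own:
  here they are given the index of their unique vertex, which is therefore unchanged by contraction.
\<close>

fun specified_pair :: "'h qft \<Rightarrow> ('v, 'e, 'h) gpair \<Rightarrow> bool" where
  "specified_pair T ((G, i), (g, j)) \<longleftrightarrow>
     connected_specified_graph T (G, i) \<and>
     specified_covering_subgraph T (g, j) (G, i) \<and>
     (\<forall>v \<in> verts G - core g. j {v} = vindex G v) \<and>
     connected_specified_graph T (contract_specified (G, i) (g, j))"


subsection \<open>Isomorphism classes\<close>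

definition graph_iso ::
  "('v \<Rightarrow> 'w) \<Rightarrow> ('e \<Rightarrow> 'd) \<Rightarrow> ('v, 'e, 'h) fgraph \<Rightarrow> ('w, 'd, 'h) fgraph \<Rightarrow> bool" where
  "graph_iso f k G H \<longleftrightarrow>
     bij_betw f (verts G) (verts H) \<and> bij_betw k (hedges G) (hedges H) \<and>
     (\<forall>v\<in>verts G. vindex H (f v) = vindex G v) \<and>
     (\<forall>e\<in>hedges G. bdry H (k e) = f (bdry G e) \<and> invol H (k e) = k (invol G e) \<and>
        htype H (k e) = htype G e)"

fun sgraph_iso ::
  "('v \<Rightarrow> 'w) \<Rightarrow> ('e \<Rightarrow> 'd) \<Rightarrow> ('v, 'e, 'h) sgraph \<Rightarrow> ('w, 'd, 'h) sgraph \<Rightarrow> bool" where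
  "sgraph_iso f k (G, i) (H, j) \<longleftrightarrow> graph_iso f k G H \<and> (\<forall>C\<in>pi0 G. j (f ` C) = i C)"

definition gpair_iso ::
  "('v \<Rightarrow> 'w) \<Rightarrow> ('e \<Rightarrow> 'd) \<Rightarrow> ('v, 'e, 'h) gpair \<Rightarrow> ('w, 'd, 'h) gpair \<Rightarrow> bool" where
  "gpair_iso f k P Q \<longleftrightarrow> sgraph_iso f k (fst P) (fst Q) \<and> sgraph_iso f k (snd P) (snd Q)"

text \<open>
  Every finite graph is isomorphic to one whose vertices and half-edges are natural numbers, so an
  isomorphism class is represented by the set of its members over the natural numbers.
\<close>

type_synonym 'h sgraph_class = "(nat, nat, 'h) sgraph set"
type_synonym 'h gpair_class = "(nat, nat, 'h) gpair set"

definition sgraph_class :: "('v, 'e, 'h) sgraph \<Rightarrow> 'h sgraph_class" where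
  "sgraph_class G = {H. \<exists>f k. sgraph_iso f k G H}"

definition gpair_class :: "('v, 'e, 'h) gpair \<Rightarrow> 'h gpair_class" where
  "gpair_class P = {Q. \<exists>f k. gpair_iso f k P Q}"

definition rep :: "'a set \<Rightarrow> 'a" where
  "rep X = (SOME x. x \<in> X)"


subsection \<open>The vector spaces\<close>

text \<open>Finitely supported functions on isomorphism classes, supported on the given generators.\<close>

definition V_space :: "'h qft \<Rightarrow> ('h sgraph_class \<Rightarrow>\<^sub>0 'k::field) set" where
  "V_space T = {x. Poly_Mapping.keys x \<subseteq>
     sgraph_class ` {G :: (nat, nat, 'h) sgraph. connected_specified_graph T G}}"

definition F_space :: "'h qft \<Rightarrow> ('h gpair_class \<Rightarrow>\<^sub>0 'k::field) set" where
  "F_space T = {x. Poly_Mapping.keys x \<subseteq>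
     gpair_class ` {P :: (nat, nat, 'h) gpair. specified_pair T P}}"

definition bilinear_extension ::
  "('a \<Rightarrow> 'b \<Rightarrow> ('c \<Rightarrow>\<^sub>0 'k)) \<Rightarrow> ('a set \<Rightarrow>\<^sub>0 'k) \<Rightarrow> ('b set \<Rightarrow>\<^sub>0 'k) \<Rightarrow> ('c \<Rightarrow>\<^sub>0 'k::field)" where
  "bilinear_extension m x y =
     (\<Sum>X \<in> Poly_Mapping.keys x. \<Sum>Y \<in> Poly_Mapping.keys y.
        Poly_Mapping.map ((*) (Poly_Mapping.lookup x X * Poly_Mapping.lookup y Y)) (m (rep X) (rep Y)))"


subsection \<open>Insertion\<close>

text \<open>Type-preserving bijections, made extensional so that each is counted once.\<close>

definition gluings ::
  "('v, 'e, 'h) fgraph \<Rightarrow> 'w \<Rightarrow> ('w, 'd, 'h) fgraph \<Rightarrow> ('e \<Rightarrow> 'd) set" where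
  "gluings G v H = {b \<in> external G \<rightarrow>\<^sub>E star H v.
     bij_betw b (external G) (star H v) \<and> (\<forall>e\<in>external G. htype H (b e) = htype G e)}"

text \<open>
  Replace the vertex \<open>v\<close> of \<open>H\<close> by \<open>G\<close>. Each external edge \<open>e\<close> of \<open>G\<close> is identified with the
  half-edge \<open>b e\<close> of \<open>H\<close>, which keeps its role in the involution of \<open>H\<close> and gets the end point of
  \<open>e\<close> in \<open>G\<close>.
\<close>

definition insert_graph ::
  "('v, 'e, 'h) fgraph \<Rightarrow> 'w \<Rightarrow> ('w, 'd, 'h) fgraph \<Rightarrow> ('e \<Rightarrow> 'd) \<Rightarrow> ('v + 'w, 'e + 'd, 'h) fgraph"
where
  "insert_graph G v H b =
     \<lparr>verts = Inl ` verts G \<union> Inr ` (verts H - {v}),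
      hedges = Inl ` internal G \<union> Inr ` hedges H,
      bdry = case_sum (\<lambda>e. Inl (bdry G e))
               (\<lambda>d. if bdry H d = v then Inl (bdry G (inv_into (external G) b d))
                    else Inr (bdry H d)),
      invol = map_sum (invol G) (invol H),
      htype = case_sum (htype G) (htype H),
      vindex = case_sum (vindex G) (vindex H)\<rparr>"

text \<open>
  The specification of the ambient graph is kept: the component of the new graph containing the
  inserted graph inherits the value of the component of \<open>H\<close> containing \<open>v\<close>.
\<close>

fun insert_specified ::
  "('v, 'e, 'h) sgraph \<Rightarrow> 'w \<Rightarrow> ('w, 'd, 'h) sgraph \<Rightarrow> ('e \<Rightarrow> 'd) \<Rightarrow> ('v + 'w, 'e + 'd, 'h) sgraph"
where
  "insert_specified (G, i) v (H, j) b =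
     (insert_graph G v H b, \<lambda>C. j (case_sum (\<lambda>_. v) (\<lambda>w. w) ` C))"

text \<open>
  The disjoint union of subgraphs \<open>g\<close> of \<open>G\<close> and \<open>h\<close> of \<open>H\<close> (without its suppressed component
  \<open>{v}\<close>), as a covering subgraph of the graph obtained by inserting \<open>G\<close> at \<open>v\<close>. Its components lie
  on one side of the sum and are specified accordingly.
\<close>

fun union_specified ::
  "('v, 'e, 'h) gpair \<Rightarrow> 'w \<Rightarrow> ('w, 'd, 'h) gpair \<Rightarrow> ('e \<Rightarrow> 'd) \<Rightarrow> ('v + 'w, 'e + 'd, 'h) sgraph"
where
  "union_specified ((G, i), (g, i')) v ((H, j), (h, j')) b =
     ((insert_graph G v H b)\<lparr>invol := map_sum (invol g) (invol h)\<rparr>,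
      \<lambda>C. if C \<subseteq> range Inl then i' (Inl -` C) else j' (Inr -` C))"


subsection \<open>The two operations\<close>

definition odot_generators ::
  "('v, 'e, 'h) gpair \<Rightarrow> ('w, 'd, 'h) gpair \<Rightarrow> ('h gpair_class \<Rightarrow>\<^sub>0 'k::field)" where
  "odot_generators P Q =
     (\<Sum>v \<in> {v \<in> verts (fst (fst Q)) - core (fst (snd Q)). vtype (fst (fst Q)) v = res_type (fst P)}.
        \<Sum>b \<in> gluings (fst (fst P)) v (fst (fst Q)).
          Poly_Mapping.single
            (gpair_class (insert_specified (fst P) v (fst Q) b, union_specified P v Q b)) 1)"

definition ins_generators ::
  "('v, 'e, 'h) sgraph \<Rightarrow> ('w, 'd, 'h) gpair \<Rightarrow> ('h gpair_class \<Rightarrow>\<^sub>0 'k::field)" where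
  "ins_generators G Q =
     (\<Sum>v \<in> {v \<in> core (fst (snd Q)). vtype (fst (fst Q)) v = res_type G}.
        \<Sum>b \<in> gluings (fst G) v (fst (fst Q)).
          Poly_Mapping.single
            (gpair_class (insert_specified G v (fst Q) b, insert_specified G v (snd Q) b)) 1)"

definition odot :: "('h gpair_class \<Rightarrow>\<^sub>0 'k) \<Rightarrow> ('h gpair_class \<Rightarrow>\<^sub>0 'k) \<Rightarrow> ('h gpair_class \<Rightarrow>\<^sub>0 'k::field)"
    (infixl \<open>\<odot>\<close> 70) where
  "odot = bilinear_extension odot_generators"

definition ins :: "('h sgraph_class \<Rightarrow>\<^sub>0 'k) \<Rightarrow> ('h gpair_class \<Rightarrow>\<^sub>0 'k) \<Rightarrow> ('h gpair_class \<Rightarrow>\<^sub>0 'k::field)"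
    (infixr \<open>\<leadsto>\<close> 75) where
  "ins = bilinear_extension ins_generators"

end

theory Submission
  imports Defs
begin

text \<open>
  On a basis vector, \<open>\<Gamma> \<leadsto> (P \<odot> Q)\<close> is a sum over a vertex \<open>v\<close> outside the subgraph of \<open>Q\<close>, a gluing
  of \<open>P\<close> at \<open>v\<close>, a vertex \<open>x\<close> of a nontrivial component of the disjoint union of the two subgraphs,
  and a gluing of \<open>\<Gamma>\<close> at \<open>x\<close>. As \<open>v\<close> is a trivial component of the subgraph of \<open>Q\<close>, the vertex \<open>x\<close>
  belongs either to the subgraph of \<open>P\<close> or to the one of \<open>Q\<close> (\<open>core_union\<close>), and its star corresponds
  to the star of a vertex of \<open>P\<close> or \<open>Q\<close>. Hence the gluings of \<open>\<Gamma>\<close> at \<open>x\<close> are its gluings into \<open>P\<close>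
  or \<open>Q\<close>, and the two insertions can be exchanged. In the first case \<open>\<Gamma>\<close> is inserted into \<open>P\<close> before
  the result is inserted at \<open>v\<close>; this does not change the external edges of \<open>P\<close> nor its residue, so
  that exactly the terms of \<open>(\<Gamma> \<leadsto> P) \<odot> Q\<close> appear. In the second case \<open>\<Gamma>\<close> is inserted into \<open>Q\<close> away
  from \<open>v\<close>, which changes neither the type of \<open>v\<close> nor the set of vertices outside the subgraph, and
  the terms are those of \<open>P \<odot> (\<Gamma> \<leadsto> Q)\<close>. This is \<open>ins_odot_generators\<close>; the isomorphisms behind the
  exchange are \<open>gpair_iso_sum_assoc\<close> and \<open>gpair_iso_sum_swap\<close>.

  The operations are computed on chosen representatives of isomorphism classes. The iteration of two
  of them therefore makes sense only because they depend on the classes alone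
  (\<open>odot_generators_iso\<close>, \<open>ins_generators_iso\<close>).

  Both operations stay within the span of the specified pairs (\<open>specified_pair_odot\<close>,
  \<open>specified_pair_ins\<close>) for the following reason. Collapsing an inserted connected graph to its
  vertex reflects connectivity (\<open>joined_proj\<close>), so components correspond to components, external
  edges and residues are unchanged, and no bridge is created. Contracting the subgraph after an
  insertion \<open>\<leadsto>\<close> gives the same graph as before (\<open>contract_insert_iso\<close>), and contracting the disjoint
  union that comes with \<open>\<odot>\<close> gives the insertion of one contracted graph into the other
  (\<open>contract_union_iso\<close>), to which the first part applies again.
\<close>


section \<open>Connectivity\<close>

lemma wf_graphD:
  assumes "wf_graph G"
  shows "finite (verts G)" "finite (hedges G)"
    and "e \<in> hedges G \<Longrightarrow> bdry G e \<in> verts G"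
    and "e \<in> hedges G \<Longrightarrow> invol G e \<in> hedges G"
    and "e \<in> hedges G \<Longrightarrow> invol G (invol G e) = e"
    and "e \<in> hedges G \<Longrightarrow> htype G (invol G e) = htype G e"
  using assms by (auto simp: wf_graph_def)

lemma joined_in_verts: "(x, y) \<in> joined G \<Longrightarrow> x \<in> verts G \<and> y \<in> verts G"
  by (auto simp: joined_def)

lemma joined_refl: "x \<in> verts G \<Longrightarrow> (x, x) \<in> joined G"
  by (auto simp: joined_def)

lemma joined_trans: "(x, y) \<in> joined G \<Longrightarrow> (y, z) \<in> joined G \<Longrightarrow> (x, z) \<in> joined G"
  by (auto simp: joined_def)

lemma joined_sym:
  assumes "wf_graph G" "(x, y) \<in> joined G" shows "(y, x) \<in> joined G"
proof -
  let ?A = "{(bdry G e, bdry G (invol G e)) | e. e \<in> hedges G}"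
  have "sym ?A"
  proof (rule symI)
    fix a b assume "(a, b) \<in> ?A"
    then obtain e where "e \<in> hedges G" "a = bdry G e" "b = bdry G (invol G e)" by blast
    then have "b = bdry G (invol G e) \<and> a = bdry G (invol G (invol G e)) \<and> invol G e \<in> hedges G"
      using wf_graphD[OF assms(1)] by simp
    then show "(b, a) \<in> ?A" by blast
  qed
  then have "sym (?A\<^sup>*)" by (rule sym_rtrancl)
  then show ?thesis using assms(2) by (auto simp: joined_def dest: symD)
qed

lemma joined_edge:
  "wf_graph G \<Longrightarrow> e \<in> hedges G \<Longrightarrow> (bdry G e, bdry G (invol G e)) \<in> joined G"
  by (auto simp: joined_def wf_graph_def)

lemma joined_induct [consumes 1, case_names base step]:
  assumes "(x, y) \<in> joined G" "P x"
    and "\<And>e. e \<in> hedges G \<Longrightarrow> P (bdry G e) \<Longrightarrow> P (bdry G (invol G e))"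
  shows "P y"
proof -
  have "(x, y) \<in> {(bdry G e, bdry G (invol G e)) | e. e \<in> hedges G}\<^sup>*"
    using assms(1) by (auto simp: joined_def)
  then show ?thesis
    by (induction rule: rtrancl_induct) (use assms in auto)
qed

lemma equiv_joined: "wf_graph G \<Longrightarrow> equiv (verts G) (joined G)"
  by (intro equivI refl_onI symI transI)
     (auto intro: joined_refl joined_sym joined_trans dest: joined_in_verts)

lemma joined_map:
  assumes "(x, y) \<in> joined G" and "f x \<in> verts K"
    and "\<And>e. e \<in> hedges G \<Longrightarrow> (f (bdry G e), f (bdry G (invol G e))) \<in> joined K"
  shows "(f x, f y) \<in> joined K"
  using assms(1)
proof (induction rule: joined_induct)
  case base then show ?case using assms(2) by (rule joined_refl)
next
  case (step e) then show ?case using assms(3) by (blast intro: joined_trans)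
qed

lemma joined_isolated:
  assumes "x \<in> verts G" "\<And>e. e \<in> hedges G \<Longrightarrow> bdry G e = x \<Longrightarrow> invol G e = e"
  shows "joined G `` {x} = {x}"
proof -
  have "y = x" if "(x, y) \<in> joined G" for y
    using that by (rule joined_induct[where P = "\<lambda>y. y = x"]) (use assms(2) in simp_all)
  then show ?thesis using joined_refl[OF assms(1)] by auto
qed

text \<open>
  A map with connected fibres along which edges lift loses no information about connectivity:
  a path downstairs is lifted edge by edge, and consecutive lifts are linked inside a fibre.
\<close>

lemma joined_iff_projection:
  assumes K: "wf_graph K"
    and pi: "\<And>x. x \<in> verts K \<Longrightarrow> p x \<in> verts H"
    and down: "\<And>e. e \<in> hedges K \<Longrightarrow> (p (bdry K e), p (bdry K (invol K e))) \<in> joined H"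
    and lift: "\<And>d. d \<in> hedges H \<Longrightarrow>
      \<exists>x y. (x, y) \<in> joined K \<and> p x = bdry H d \<and> p y = bdry H (invol H d)"
    and fibre: "\<And>x y. x \<in> verts K \<Longrightarrow> y \<in> verts K \<Longrightarrow> p x = p y \<Longrightarrow> (x, y) \<in> joined K"
    and x: "x \<in> verts K" and y: "y \<in> verts K"
  shows "(x, y) \<in> joined K \<longleftrightarrow> (p x, p y) \<in> joined H"
proof
  assume "(x, y) \<in> joined K"
  then show "(p x, p y) \<in> joined H"
    using joined_map[where f = p, OF _ pi[OF x] down] by blast
next
  assume "(p x, p y) \<in> joined H"
  then have "\<exists>z\<in>verts K. p z = p y \<and> (x, z) \<in> joined K"
  proof (rule joined_induct[where P = "\<lambda>u. \<exists>z\<in>verts K. p z = u \<and> (x, z) \<in> joined K"])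
    show "\<exists>z\<in>verts K. p z = p x \<and> (x, z) \<in> joined K"
      using x joined_refl[OF x] by (intro bexI[of _ x]) auto
  next
    fix d assume step: "d \<in> hedges H" "\<exists>z\<in>verts K. p z = bdry H d \<and> (x, z) \<in> joined K"
    then obtain z where z: "z \<in> verts K" "p z = bdry H d" "(x, z) \<in> joined K" by blast
    obtain s t where st: "(s, t) \<in> joined K" "p s = bdry H d" "p t = bdry H (invol H d)"
      using lift[OF step(1)] by blast
    have "(z, s) \<in> joined K" using fibre[of z s] z st joined_in_verts by metis
    then have "(x, t) \<in> joined K" using z st by (blast intro: joined_trans)
    then show "\<exists>z\<in>verts K. p z = bdry H (invol H d) \<and> (x, z) \<in> joined K"
      using st(3) joined_in_verts by metis
  qed
  then show "(x, y) \<in> joined K" using fibre y joined_trans by metis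
qed

lemma pi0I: "x \<in> verts G \<Longrightarrow> joined G `` {x} \<in> pi0 G"
  by (auto simp: pi0_def quotient_def)

lemma pi0E:
  assumes "C \<in> pi0 G" obtains x where "x \<in> verts G" "C = joined G `` {x}"
  using assms by (auto simp: pi0_def quotient_def)

lemma pi0_class: "wf_graph G \<Longrightarrow> C \<in> pi0 G \<Longrightarrow> x \<in> C \<Longrightarrow> C = joined G `` {x}"
  by (metis Image_singleton_iff equiv_class_eq equiv_joined pi0E)

lemma pi0_subset: "C \<in> pi0 G \<Longrightarrow> C \<subseteq> verts G"
  by (auto elim!: pi0E dest: joined_in_verts)

lemma pi0_nonempty: "C \<in> pi0 G \<Longrightarrow> C \<noteq> {}"
  by (auto elim!: pi0E intro: joined_refl)

lemma Union_pi0: "\<Union> (pi0 G) = verts G"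
proof
  show "\<Union> (pi0 G) \<subseteq> verts G" using pi0_subset[of _ G] by blast
  show "verts G \<subseteq> \<Union> (pi0 G)"
  proof
    fix x assume x: "x \<in> verts G"
    then have "x \<in> joined G `` {x}" using joined_refl[OF x] by blast
    then show "x \<in> \<Union> (pi0 G)" using pi0I[OF x] by blast
  qed
qed

lemma pi0_iff:
  "wf_graph G \<Longrightarrow> C \<in> pi0 G \<longleftrightarrow> C \<subseteq> verts G \<and> C \<noteq> {} \<and> (\<forall>x\<in>C. \<forall>y. y \<in> C \<longleftrightarrow> (x, y) \<in> joined G)"
  (is "_ \<Longrightarrow> _ \<longleftrightarrow> ?R")
proof
  assume wf: "wf_graph G"
  show ?R if C: "C \<in> pi0 G"
  proof (intro conjI ballI allI)
    show "C \<subseteq> verts G" "C \<noteq> {}" using C by (rule pi0_subset, rule pi0_nonempty)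
    fix x y assume "x \<in> C"
    then show "y \<in> C \<longleftrightarrow> (x, y) \<in> joined G" using pi0_class[OF wf C, of x] by auto
  qed
  assume R: ?R
  then obtain x where "x \<in> C" by blast
  with R have "C = joined G `` {x}" "x \<in> verts G" by blast+
  then show "C \<in> pi0 G" using pi0I by metis
qed

lemma pi0_image_projection:
  assumes "wf_graph K" "wf_graph H"
    and onto: "p ` verts K = verts H"
    and iff: "\<And>x y. x \<in> verts K \<Longrightarrow> y \<in> verts K \<Longrightarrow> (x, y) \<in> joined K \<longleftrightarrow> (p x, p y) \<in> joined H"
    and C: "C \<in> pi0 K"
  shows "p ` C \<in> pi0 H" and "C = {x \<in> verts K. p x \<in> p ` C}"
proof -
  obtain x where x: "x \<in> verts K" "C = joined K `` {x}" using C by (rule pi0E)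
  have eq: "p ` C = joined H `` {p x}"
  proof
    show "p ` C \<subseteq> joined H `` {p x}" using x iff joined_in_verts[of _ _ K] by blast
    show "joined H `` {p x} \<subseteq> p ` C"
    proof
      fix y assume y: "y \<in> joined H `` {p x}"
      then have "y \<in> verts H" using joined_in_verts[of _ _ H] by blast
      then obtain z where z: "z \<in> verts K" "y = p z" using onto by blast
      then have "(x, z) \<in> joined K" using x y iff by blast
      then show "y \<in> p ` C" using z x by blast
    qed
  qed
  then show "p ` C \<in> pi0 H" using pi0I[of "p x" H] x onto by (metis image_eqI)
  show "C = {x \<in> verts K. p x \<in> p ` C}"
    unfolding eq using x iff joined_in_verts[of _ _ K] by blast
qed

lemma pi0_projection_onto:
  assumes K: "wf_graph K" and H: "wf_graph H"
    and onto: "p ` verts K = verts H"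
    and iff: "\<And>x y. x \<in> verts K \<Longrightarrow> y \<in> verts K \<Longrightarrow> (x, y) \<in> joined K \<longleftrightarrow> (p x, p y) \<in> joined H"
  shows "pi0 H = image p ` pi0 K"
proof
  show "image p ` pi0 K \<subseteq> pi0 H"
    using pi0_image_projection(1)[OF K H onto iff] by (intro image_subsetI) simp
  show "pi0 H \<subseteq> image p ` pi0 K"
  proof
    fix D assume D: "D \<in> pi0 H"
    have "D \<inter> p ` verts K \<noteq> {}" using pi0_nonempty[OF D] pi0_subset[OF D] onto by blast
    then obtain x where x: "x \<in> verts K" "p x \<in> D" by blast
    let ?C = "joined K `` {x}"
    have C: "?C \<in> pi0 K" using x by (intro pi0I)
    have "p ` ?C \<in> pi0 H" by (rule pi0_image_projection(1)[OF K H onto iff C]) simp_all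
    moreover have "p x \<in> p ` ?C" using joined_refl[OF x(1)] by simp
    ultimately have "p ` ?C = joined H `` {p x}" by (rule pi0_class[OF H])
    moreover have "D = joined H `` {p x}" by (rule pi0_class[OF H D x(2)])
    ultimately show "D \<in> image p ` pi0 K" using C by (intro image_eqI[of D _ ?C]) simp_all
  qed
qed

lemma connected_graph_iff:
  assumes "wf_graph G"
  shows "connected_graph G \<longleftrightarrow> verts G \<noteq> {} \<and> (\<forall>x\<in>verts G. \<forall>y\<in>verts G. (x, y) \<in> joined G)"
    (is "_ \<longleftrightarrow> ?R")
proof
  assume "connected_graph G"
  then obtain C where C: "pi0 G = {C}"
    unfolding connected_graph_def by (metis card_1_singletonE)
  then have "C = verts G" using Union_pi0[of G] by simp
  then show ?R using C pi0_iff[OF assms, of C] by auto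
next
  assume R: ?R
  have "C = verts G" if "C \<in> pi0 G" for C
  proof -
    have C: "C \<subseteq> verts G" "C \<noteq> {}" "\<And>x y. x \<in> C \<Longrightarrow> y \<in> C \<longleftrightarrow> (x, y) \<in> joined G"
      using that pi0_iff[OF assms, of C] by simp_all
    then obtain x where "x \<in> C" by blast
    then show ?thesis using C R by (meson subset_antisym subset_iff)
  qed
  moreover have "pi0 G \<noteq> {}" using R by (simp add: pi0_def)
  ultimately have "pi0 G = {verts G}" by (metis (no_types) is_singletonI' is_singleton_def singletonI)
  then show "connected_graph G" by (simp add: connected_graph_def)
qed

lemma pi0_connected:
  assumes "connected_graph G" shows "pi0 G = {verts G}"
proof -
  obtain C where C: "pi0 G = {C}"
    using assms unfolding connected_graph_def by (metis card_1_singletonE)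
  then show ?thesis using Union_pi0[of G] by simp
qed


section \<open>Locally 1PI graphs have no bridges\<close>

text \<open>
  Being locally 1PI is a condition on the cuts of each component; it is more convenient in the
  equivalent form that the two ends of an internal edge stay joined once this edge is cut.
\<close>

definition bridgeless :: "('v, 'e, 'h) fgraph \<Rightarrow> bool" where
  "bridgeless G \<longleftrightarrow> (\<forall>e\<in>internal G. (bdry G e, bdry G (invol G e)) \<in> joined (cut G e))"

lemma cut_simps [simp]:
  "verts (cut G e) = verts G" "hedges (cut G e) = hedges G" "bdry (cut G e) = bdry G"
  "htype (cut G e) = htype G" "vindex (cut G e) = vindex G"
  "invol (cut G e) = (invol G)(e := e, invol G e := invol G e)"
  by (simp_all add: cut_def)

lemma wf_cut:
  assumes "wf_graph G" "e \<in> hedges G" shows "wf_graph (cut G e)"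
  using wf_graphD[OF assms(1)] assms(2) unfolding wf_graph_def
  by (auto split: if_splits) metis+

lemma joined_cut_subset:
  assumes "wf_graph G" "(x, y) \<in> joined (cut G e)" shows "(x, y) \<in> joined G"
proof -
  have "x \<in> verts G" using assms(2) joined_in_verts[of x y "cut G e"] by simp
  moreover have "(bdry G d, bdry G (invol (cut G e) d)) \<in> joined G" if "d \<in> hedges G" for d
    using that joined_edge[OF assms(1)] joined_refl[of "bdry G d" G] wf_graphD(3)[OF assms(1)]
    by (auto simp: cut_def)
  ultimately show ?thesis
    using joined_map[OF assms(2), where f = "\<lambda>x. x" and K = G] by simp
qed

text \<open>
  A path through the cut edge is repaired by the detour that joins the two ends of this edge.
\<close>

lemma joined_cut_bridgeless:
  assumes "wf_graph G" "bridgeless G" "e \<in> internal G"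
  shows "joined (cut G e) = joined G"
proof -
  have e: "e \<in> hedges G" using assms(3) by (auto simp: internal_def)
  note wfc = wf_cut[OF assms(1) e]
  have b: "(bdry G e, bdry G (invol G e)) \<in> joined (cut G e)"
    using assms by (auto simp: bridgeless_def)
  have "(x, y) \<in> joined (cut G e)" if "(x, y) \<in> joined G" for x y
    using that
  proof (induction rule: joined_induct)
    case base then show ?case using that joined_in_verts joined_refl[of x "cut G e"] by fastforce
  next
    case (step d)
    consider "d = e" | "d = invol G e" | "d \<noteq> e" "d \<noteq> invol G e" by blast
    then have "(bdry G d, bdry G (invol G d)) \<in> joined (cut G e)"
    proof cases
      case 1 then show ?thesis using b by simp
    next
      case 2 then show ?thesis using joined_sym[OF wfc b] wf_graphD(5)[OF assms(1) e] by simp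
    next
      case 3 then show ?thesis using joined_edge[OF wfc, of d] step by simp
    qed
    with step(2) show ?case by (rule joined_trans)
  qed
  then show ?thesis using joined_cut_subset[OF assms(1)] by auto
qed

lemma component_simps [simp]:
  "verts (component G C) = C" "hedges (component G C) = {e \<in> hedges G. bdry G e \<in> C}"
  "bdry (component G C) = bdry G" "invol (component G C) = invol G"
  "htype (component G C) = htype G" "vindex (component G C) = vindex G"
  by (simp_all add: component_def)

lemma cut_component: "cut (component G C) e = component (cut G e) C"
  by (simp add: cut_def component_def)

text \<open>
  Closed sets of vertices, rather than components, are considered because a component of \<open>G\<close> is also
  viewed inside a cut of \<open>G\<close>, where it may fall apart.
\<close>

lemma joined_component:
  assumes "wf_graph G" "C \<subseteq> verts G"
    and closed: "\<And>e. e \<in> hedges G \<Longrightarrow> bdry G e \<in> C \<Longrightarrow> bdry G (invol G e) \<in> C"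
  shows "wf_graph (component G C)" and "joined (component G C) = joined G \<inter> C \<times> C"
proof -
  show wf: "wf_graph (component G C)"
    using wf_graphD[OF assms(1)] assms(2) closed unfolding wf_graph_def
    by (auto intro: finite_subset)
  have 1: "(x, y) \<in> joined G" if "(x, y) \<in> joined (component G C)" for x y
  proof -
    have "(id x, id y) \<in> joined G"
      by (rule joined_map[OF that, where f = id])
         (use assms(1,2) joined_edge joined_in_verts[OF that] in auto)
    then show ?thesis by simp
  qed
  have 2: "(x, y) \<in> joined (component G C)" if "(x, y) \<in> joined G" "x \<in> C" for x y
    using that(1)
  proof (induction rule: joined_induct)
    case base then show ?case using that joined_refl[of x "component G C"] by simp
  next
    case (step d)
    then have "bdry G d \<in> C" using joined_in_verts by fastforce
    then show ?case using step joined_trans joined_edge[OF wf, of d] by fastforce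
  qed
  have 3: "x \<in> C \<and> y \<in> C" if "(x, y) \<in> joined (component G C)" for x y
    using joined_in_verts[OF that] by simp
  show "joined (component G C) = joined G \<inter> C \<times> C"
    by (intro subset_antisym subrelI) (use 1 2 3 in simp_all)
qed

lemma pi0_closed:
  assumes "wf_graph G" "C \<in> pi0 G" "e \<in> hedges G" "bdry G e \<in> C"
  shows "bdry G (invol G e) \<in> C"
  using pi0_class[OF assms(1,2,4)] joined_edge[OF assms(1,3)] by simp

lemma locally_one_PI_iff_bridgeless:
  assumes wf: "wf_graph G"
  shows "locally_one_PI G \<longleftrightarrow> bridgeless G"
proof -
  have conn: "connected_graph (component (cut G e) C) \<longleftrightarrow> (\<forall>x\<in>C. \<forall>y\<in>C. (x, y) \<in> joined (cut G e))"
    if C: "C \<in> pi0 G" and e: "e \<in> hedges G" for C e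
  proof -
    have "C \<subseteq> verts (cut G e)" using pi0_subset[OF C] by simp
    moreover have "bdry (cut G e) (invol (cut G e) d) \<in> C"
      if "d \<in> hedges (cut G e)" "bdry (cut G e) d \<in> C" for d
      using that pi0_closed[OF wf C] by auto
    ultimately have "wf_graph (component (cut G e) C)"
      "joined (component (cut G e) C) = joined (cut G e) \<inter> C \<times> C"
      using joined_component[OF wf_cut[OF wf e]] by blast+
    then show ?thesis using pi0_nonempty[OF C] by (auto simp: connected_graph_iff)
  qed
  have conn0: "connected_graph (component G C)" if C: "C \<in> pi0 G" for C
    using joined_component[OF wf pi0_subset[OF C] pi0_closed[OF wf C]] pi0_nonempty[OF C]
      pi0_iff[OF wf] C by (simp add: connected_graph_iff) blast
  show ?thesis
  proof
    assume L: "locally_one_PI G"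
    show "bridgeless G"
      unfolding bridgeless_def
    proof
      fix e assume e: "e \<in> internal G"
      then have eh: "e \<in> hedges G" by (simp add: internal_def)
      let ?C = "joined G `` {bdry G e}"
      have C: "?C \<in> pi0 G" and eC: "bdry G e \<in> ?C"
        using pi0I[OF wf_graphD(3)[OF wf eh]] joined_refl[OF wf_graphD(3)[OF wf eh]] by simp_all
      have "e \<in> internal (component G ?C)" using e eC by (simp add: internal_def)
      then have "connected_graph (component (cut G e) ?C)"
        using L C unfolding locally_one_PI_def one_PI_def cut_component by blast
      then show "(bdry G e, bdry G (invol G e)) \<in> joined (cut G e)"
        using conn[OF C eh] eC pi0_closed[OF wf C eh eC] by blast
    qed
  next
    assume B: "bridgeless G"
    show "locally_one_PI G"
      unfolding locally_one_PI_def one_PI_def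
    proof (intro ballI conjI)
      fix C assume C: "C \<in> pi0 G"
      show "connected_graph (component G C)" using C by (rule conn0)
      fix e assume "e \<in> internal (component G C)"
      then have e: "e \<in> internal G" "e \<in> hedges G" by (auto simp: internal_def)
      show "connected_graph (cut (component G C) e)"
        unfolding cut_component conn[OF C e(2)] joined_cut_bridgeless[OF wf B e(1)]
        using C pi0_iff[OF wf] by blast
    qed
  qed
qed

text \<open>The type of the vertex to which the component \<open>C\<close> is contracted.\<close>

definition leg_type :: "('v, 'e, 'h) fgraph \<Rightarrow> ('v set \<Rightarrow> nat) \<Rightarrow> 'v set \<Rightarrow> 'h vtype" where
  "leg_type G i C = (image_mset (htype G) (mset_set {e \<in> external G. bdry G e \<in> C}), i C)"

lemma vtype_residue:
  assumes "wf_graph G" "C \<in> pi0 G"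
  shows "vtype (residue G i) C = leg_type G i C"
proof -
  have "joined G `` {bdry G e} = C \<longleftrightarrow> bdry G e \<in> C" if "e \<in> external G" for e
  proof -
    have "bdry G e \<in> verts G" using that wf_graphD[OF assms(1)] by (auto simp: external_def)
    then have "bdry G e \<in> joined G `` {bdry G e}" using joined_refl by fastforce
    then show ?thesis using pi0_class[OF assms, of "bdry G e"] by auto
  qed
  then have "{e \<in> external G. joined G `` {bdry G e} = C} = {e \<in> external G. bdry G e \<in> C}"
    by (intro Collect_cong conj_cong) auto
  then show ?thesis
    by (simp add: vtype_def leg_type_def residue_def contract_def star_def)
qed

text \<open>
  Superficial divergence is implied by the condition on the specification, which provides an index
  for the residue of each component.
\<close>

lemma specified_graph_iff:
  "specified_graph T (G, i) \<longleftrightarrow> wf_graph G \<and> (\<forall>e\<in>hedges G. htype G e \<in> htypes T) \<and>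
     (\<forall>v\<in>verts G. vtype G v \<in> vtypes T) \<and> bridgeless G \<and> (\<forall>C\<in>pi0 G. leg_type G i C \<in> vtypes T)"
proof -
  have "superficially_divergent T G" if "wf_graph G" "\<forall>C\<in>pi0 G. leg_type G i C \<in> vtypes T"
    unfolding superficially_divergent_def
  proof
    fix C assume C: "C \<in> pi0 G"
    have "leg_type G (\<lambda>_. i C) C = leg_type G i C" by (simp add: leg_type_def)
    then show "\<exists>n. vtype (residue G (\<lambda>_. n)) C \<in> vtypes T"
      using that C vtype_residue[OF that(1) C, of "\<lambda>_. i C"] by (intro exI[of _ "i C"]) simp
  qed
  then show ?thesis
    using locally_one_PI_iff_bridgeless[of G] vtype_residue[of G _ i] by auto
qed

lemma res_type_connected:
  assumes "wf_graph G" "connected_graph G"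
  shows "res_type (G, i) = leg_type G i (verts G)"
    and "leg_type G i (verts G) = (image_mset (htype G) (mset_set (external G)), i (verts G))"
proof -
  show "res_type (G, i) = leg_type G i (verts G)"
    using vtype_residue[OF assms(1)] pi0_connected[OF assms(2)] by simp
  have "{e \<in> external G. bdry G e \<in> verts G} = external G"
    using wf_graphD(3)[OF assms(1)] by (auto simp: external_def)
  then show "leg_type G i (verts G) = (image_mset (htype G) (mset_set (external G)), i (verts G))"
    by (simp add: leg_type_def)
qed


section \<open>Isomorphisms\<close>

text \<open>
  All comparisons of vertex types below come from a type-preserving bijection of half-edges.
\<close>

lemma image_mset_reindex:
  assumes "bij_betw k A B" "\<And>e. e \<in> A \<Longrightarrow> t' (k e) = t e"
  shows "image_mset t' (mset_set B) = image_mset t (mset_set A)"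
proof -
  have "mset_set B = image_mset k (mset_set A)"
    using assms(1) by (simp add: bij_betw_def image_mset_mset_set)
  then have "image_mset t' (mset_set B) = image_mset (\<lambda>e. t' (k e)) (mset_set A)"
    by (simp add: multiset.map_comp comp_def)
  also have "\<dots> = image_mset t (mset_set A)"
  proof (rule image_mset_cong)
    fix e assume "e \<in># mset_set A"
    then have "e \<in> A" by (cases "finite A") auto
    then show "t' (k e) = t e" by (rule assms(2))
  qed
  finally show ?thesis .
qed

locale graph_isomorphism =
  fixes f :: "'v \<Rightarrow> 'w" and k :: "'e \<Rightarrow> 'd"
    and G :: "('v, 'e, 'h) fgraph" and H :: "('w, 'd, 'h) fgraph"
  assumes wf: "wf_graph G" and iso: "graph_iso f k G H"
begin

lemma bij: "bij_betw f (verts G) (verts H)" "bij_betw k (hedges G) (hedges H)"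
  using iso by (simp_all add: graph_iso_def)

lemma inj: "inj_on f (verts G)" "inj_on k (hedges G)"
  using bij by (simp_all add: bij_betw_def)

lemma images: "f ` verts G = verts H" "k ` hedges G = hedges H"
  using bij by (simp_all add: bij_betw_def)

lemma maps:
  "x \<in> verts G \<Longrightarrow> f x \<in> verts H" "e \<in> hedges G \<Longrightarrow> k e \<in> hedges H"
  using images by auto

lemma vindex_iso: "x \<in> verts G \<Longrightarrow> vindex H (f x) = vindex G x"
  using iso by (simp add: graph_iso_def)

lemma hedge_iso:
  assumes "e \<in> hedges G"
  shows "bdry H (k e) = f (bdry G e)" "invol H (k e) = k (invol G e)" "htype H (k e) = htype G e"
  using iso assms by (simp_all add: graph_iso_def)

lemma wf_iso: "wf_graph H"
  unfolding wf_graph_def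
proof (intro conjI ballI)
  show "finite (verts H)" "finite (hedges H)"
    using images wf_graphD(1,2)[OF wf] by (metis finite_imageI)+
  fix d assume "d \<in> hedges H"
  then obtain e where e: "e \<in> hedges G" "d = k e" using images(2) by blast
  show "bdry H d \<in> verts H" "invol H d \<in> hedges H" "invol H (invol H d) = d"
    "htype H (invol H d) = htype H d"
    using e hedge_iso[OF e(1)] wf_graphD(3-6)[OF wf e(1)] maps
      hedge_iso[OF wf_graphD(4)[OF wf e(1)]] by simp_all
qed

lemma sym: "graph_iso (inv_into (verts G) f) (inv_into (hedges G) k) H G"
  unfolding graph_iso_def
proof (intro conjI ballI)
  show "bij_betw (inv_into (verts G) f) (verts H) (verts G)"
    "bij_betw (inv_into (hedges G) k) (hedges H) (hedges G)"
    using bij by (simp_all add: bij_betw_inv_into)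
next
  fix y assume "y \<in> verts H"
  then obtain x where "x \<in> verts G" "y = f x" using images(1) by blast
  then show "vindex G (inv_into (verts G) f y) = vindex H y"
    using inj(1) vindex_iso by simp
next
  fix d assume "d \<in> hedges H"
  then obtain e where e: "e \<in> hedges G" "d = k e" using images(2) by blast
  then show "bdry G (inv_into (hedges G) k d) = inv_into (verts G) f (bdry H d)"
    "invol G (inv_into (hedges G) k d) = inv_into (hedges G) k (invol H d)"
    "htype G (inv_into (hedges G) k d) = htype H d"
    using inj hedge_iso[OF e(1)] wf_graphD(3,4)[OF wf e(1)] by simp_all
qed

lemma joined_image:
  assumes "(x, y) \<in> joined G" shows "(f x, f y) \<in> joined H"
proof (rule joined_map[where f = f, OF assms])
  show "f x \<in> verts H" using joined_in_verts[OF assms] maps(1) by simp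
  fix e assume e: "e \<in> hedges G"
  show "(f (bdry G e), f (bdry G (invol G e))) \<in> joined H"
    using joined_edge[OF wf_iso maps(2)[OF e]] hedge_iso[OF e]
      hedge_iso[OF wf_graphD(4)[OF wf e]] by simp
qed

lemma joined_iff:
  assumes "x \<in> verts G" "y \<in> verts G"
  shows "(x, y) \<in> joined G \<longleftrightarrow> (f x, f y) \<in> joined H"
proof -
  interpret inverse: graph_isomorphism "inv_into (verts G) f" "inv_into (hedges G) k" H G
    by unfold_locales (rule wf_iso, rule sym)
  show ?thesis
    using joined_image[of x y] inverse.joined_image[of "f x" "f y"] assms inj(1) by auto
qed

lemma pi0_iso: "pi0 H = image f ` pi0 G"
  by (rule pi0_projection_onto[OF wf wf_iso images(1) joined_iff])

lemma class_iso:
  assumes "x \<in> verts G" shows "joined H `` {f x} = f ` (joined G `` {x})"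
proof (rule pi0_class[OF wf_iso, symmetric])
  show "f ` (joined G `` {x}) \<in> pi0 H" using pi0I[OF assms] pi0_iso by simp
  show "f x \<in> f ` (joined G `` {x})" using joined_refl[OF assms] by simp
qed

lemma inj_image: "inj_on (image f) (pi0 G)"
  by (rule inj_onI) (simp add: inj_on_image_eq_iff[OF inj(1) pi0_subset pi0_subset])

lemma connected_iso: "connected_graph H \<longleftrightarrow> connected_graph G"
  unfolding connected_graph_def pi0_iso by (simp add: card_image[OF inj_image])

lemma fixed_iff:
  assumes "e \<in> hedges G" shows "invol H (k e) = k e \<longleftrightarrow> invol G e = e"
  using hedge_iso(2)[OF assms] inj_on_eq_iff[OF inj(2) wf_graphD(4)[OF wf assms] assms] by simp

lemma external_iso: "external H = k ` external G"
  unfolding external_def images(2)[symmetric] Compr_image_eq by (simp add: fixed_iff cong: conj_cong)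

lemma internal_iso: "internal H = k ` internal G"
  unfolding internal_def images(2)[symmetric] Compr_image_eq by (simp add: fixed_iff cong: conj_cong)

lemma legs_iso:
  assumes "C \<subseteq> verts G" "A \<subseteq> hedges G"
  shows "bij_betw k {e \<in> A. bdry G e \<in> C} {d \<in> k ` A. bdry H d \<in> f ` C}"
proof -
  have "bdry H (k e) \<in> f ` C \<longleftrightarrow> bdry G e \<in> C" if "e \<in> A" for e
  proof -
    have "e \<in> hedges G" using that assms(2) by blast
    then show ?thesis
      using hedge_iso(1) inj_on_image_mem_iff[OF inj(1) _ assms(1)] wf_graphD(3)[OF wf] by simp
  qed
  then have "{d \<in> k ` A. bdry H d \<in> f ` C} = k ` {e \<in> A. bdry G e \<in> C}"
    by (simp add: Compr_image_eq cong: conj_cong)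
  moreover have "inj_on k {e \<in> A. bdry G e \<in> C}"
    by (rule inj_on_subset[OF inj(2)]) (use assms(2) in auto)
  ultimately show ?thesis by (simp add: bij_betw_def)
qed

lemma star_iso: "x \<in> verts G \<Longrightarrow> bij_betw k (star G x) (star H (f x))"
  using legs_iso[of "{x}" "hedges G"] images(2) by (simp add: star_def)

lemma vtype_iso: "x \<in> verts G \<Longrightarrow> vtype H (f x) = vtype G x"
  using image_mset_reindex[OF star_iso, of x "htype H" "htype G"] vindex_iso hedge_iso(3)
  by (simp add: vtype_def star_def)

lemma leg_type_iso:
  assumes "C \<subseteq> verts G" "j (f ` C) = i C"
  shows "leg_type H j (f ` C) = leg_type G i C"
proof -
  have "external G \<subseteq> hedges G" by (auto simp: external_def)
  then have "bij_betw k {e \<in> external G. bdry G e \<in> C} {d \<in> external H. bdry H d \<in> f ` C}"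
    using legs_iso[OF assms(1), of "external G"] external_iso by simp
  then have "image_mset (htype H) (mset_set {d \<in> external H. bdry H d \<in> f ` C})
      = image_mset (htype G) (mset_set {e \<in> external G. bdry G e \<in> C})"
    by (rule image_mset_reindex) (use hedge_iso(3) in \<open>auto simp: external_def\<close>)
  then show ?thesis unfolding leg_type_def using assms(2) by simp
qed

lemma cut_iso:
  assumes "e \<in> hedges G" shows "graph_iso f k (cut G e) (cut H (k e))"
proof -
  have "(k d = k e \<longleftrightarrow> d = e) \<and> (k d = k (invol G e) \<longleftrightarrow> d = invol G e)" if "d \<in> hedges G" for d
    using that inj_on_eq_iff[OF inj(2)] wf_graphD(4)[OF wf assms] assms by blast
  then show ?thesis
    using iso hedge_iso(2)[OF assms] unfolding graph_iso_def by auto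
qed

lemma bridgeless_iso:
  assumes "bridgeless G" shows "bridgeless H"
  unfolding bridgeless_def
proof
  fix d assume "d \<in> internal H"
  then obtain e where e: "e \<in> internal G" "d = k e" using internal_iso by blast
  then have eh: "e \<in> hedges G" by (simp add: internal_def)
  interpret c: graph_isomorphism f k "cut G e" "cut H (k e)"
    by unfold_locales (simp_all add: wf_cut[OF wf eh] cut_iso[OF eh])
  have "(bdry G e, bdry G (invol G e)) \<in> joined (cut G e)"
    using assms e(1) by (simp add: bridgeless_def)
  from c.joined_image[OF this]
  show "(bdry H d, bdry H (invol H d)) \<in> joined (cut H d)"
    using hedge_iso[OF eh] hedge_iso[OF wf_graphD(4)[OF wf eh]] e(2) by simp
qed

lemma core_iso: "core H = f ` core G"
proof -
  have "f x \<in> core H \<longleftrightarrow> x \<in> core G" if x: "x \<in> verts G" for x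
  proof -
    have "(f x, bdry H (k e)) \<in> joined H \<longleftrightarrow> (x, bdry G e) \<in> joined G" if "e \<in> internal G" for e
    proof -
      have "e \<in> hedges G" using that by (simp add: internal_def)
      then show ?thesis using joined_iff[OF x] hedge_iso(1) wf_graphD(3)[OF wf] by simp
    qed
    then show ?thesis using x maps(1) unfolding core_def internal_iso by auto
  qed
  then have "{y \<in> f ` verts G. y \<in> core H} = f ` {x \<in> verts G. x \<in> core G}"
    by (simp add: Compr_image_eq cong: conj_cong)
  moreover have "{y \<in> f ` verts G. y \<in> core H} = core H" "{x \<in> verts G. x \<in> core G} = core G"
    unfolding images(1) by (auto simp: core_def)
  ultimately show ?thesis by simp
qed

end

lemma graph_iso_trans:
  assumes "wf_graph G" "graph_iso f k G H" "graph_iso f' k' H K"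
  shows "graph_iso (f' \<circ> f) (k' \<circ> k) G K"
proof -
  interpret a: graph_isomorphism f k G H using assms by unfold_locales
  interpret b: graph_isomorphism f' k' H K using assms a.wf_iso by unfold_locales
  show ?thesis
    unfolding graph_iso_def
    using bij_betw_trans[OF a.bij(1) b.bij(1)] bij_betw_trans[OF a.bij(2) b.bij(2)]
    by (simp add: a.maps a.vindex_iso b.vindex_iso a.hedge_iso b.hedge_iso)
qed

lemma sgraph_iso_sym:
  assumes "wf_graph G" "sgraph_iso f k (G, i) (H, j)"
  shows "sgraph_iso (inv_into (verts G) f) (inv_into (hedges G) k) (H, j) (G, i)"
proof -
  interpret graph_isomorphism f k G H using assms by unfold_locales simp_all
  have "i (inv_into (verts G) f ` D) = j D" if D: "D \<in> pi0 H" for D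
  proof -
    obtain C where C: "C \<in> pi0 G" "D = f ` C" using D pi0_iso by blast
    then have "inv_into (verts G) f ` D = C"
      using inj(1) pi0_subset[OF C(1)] by (simp add: inv_into_image_cancel)
    then show ?thesis using C assms(2) by simp
  qed
  then show ?thesis using sym by simp
qed

lemma sgraph_iso_trans:
  assumes "wf_graph G" "sgraph_iso f k (G, i) (H, j)" "sgraph_iso f' k' (H, j) (K, l)"
  shows "sgraph_iso (f' \<circ> f) (k' \<circ> k) (G, i) (K, l)"
proof -
  interpret a: graph_isomorphism f k G H using assms by unfold_locales simp_all
  have "l ((f' \<circ> f) ` C) = i C" if "C \<in> pi0 G" for C
  proof -
    have "f ` C \<in> pi0 H" using that a.pi0_iso by simp
    then have "l (f' ` (f ` C)) = j (f ` C)" using assms(3) by simp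
    then show ?thesis using that assms(2) by (simp add: image_comp)
  qed
  then show ?thesis using graph_iso_trans[OF assms(1), of f k H f' k' K] assms(2,3) by simp
qed

lemma specified_graph_iso:
  assumes "specified_graph T (G, i)" "sgraph_iso f k (G, i) (H, j)"
  shows "specified_graph T (H, j)"
proof -
  interpret graph_isomorphism f k G H using assms by unfold_locales simp_all
  have j: "j (f ` C) = i C" if "C \<in> pi0 G" for C using that assms(2) by simp
  note s = assms(1)[unfolded specified_graph_iff]
  show ?thesis
    unfolding specified_graph_iff
  proof (intro conjI ballI)
    show "wf_graph H" by (rule wf_iso)
    show "bridgeless H" using bridgeless_iso s by blast
  next
    fix d assume "d \<in> hedges H"
    then obtain e where "e \<in> hedges G" "d = k e" using images(2) by blast
    then show "htype H d \<in> htypes T" using s hedge_iso(3) by simp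
  next
    fix y assume "y \<in> verts H"
    then obtain x where "x \<in> verts G" "y = f x" using images(1) by blast
    then show "vtype H y \<in> vtypes T" using s vtype_iso by simp
  next
    fix D assume "D \<in> pi0 H"
    then obtain C where "C \<in> pi0 G" "D = f ` C" using pi0_iso by blast
    then show "leg_type H j D \<in> vtypes T"
      using s leg_type_iso[of C j i] j pi0_subset[of C G] by simp
  qed
qed

lemma connected_specified_graph_iso:
  assumes "connected_specified_graph T (G, i)" "sgraph_iso f k (G, i) (H, j)"
  shows "connected_specified_graph T (H, j)"
proof -
  have s: "specified_graph T (G, i)" "connected_graph G"
    using assms(1) by (simp_all add: connected_specified_graph_def)
  interpret graph_isomorphism f k G H
    using s(1) assms(2) by unfold_locales simp_all
  show ?thesis
    using specified_graph_iso[OF s(1) assms(2)] connected_iso s(2)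
    by (simp add: connected_specified_graph_def)
qed

lemma covering_subgraphD:
  assumes "covering_subgraph g G"
  shows "wf_graph g" "verts g = verts G" "hedges g = hedges G"
    and "v \<in> verts G \<Longrightarrow> vindex g v = vindex G v"
    and "e \<in> hedges G \<Longrightarrow> bdry g e = bdry G e" "e \<in> hedges G \<Longrightarrow> htype g e = htype G e"
    and "e \<in> hedges G \<Longrightarrow> invol g e = e \<or> invol g e = invol G e"
  using assms by (simp_all add: covering_subgraph_def)

lemma not_core_isolated:
  assumes "covering_subgraph h H" "v \<in> verts H - core h" "d \<in> hedges H" "bdry H d = v"
  shows "invol h d = d"
proof (rule ccontr)
  note c = covering_subgraphD[OF assms(1)]
  assume "invol h d \<noteq> d"
  then have "d \<in> internal h" using assms(3) c(3) by (simp add: internal_def)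
  moreover have "(v, bdry h d) \<in> joined h"
    using joined_refl[of v h] assms c(2,5) by simp
  ultimately have "v \<in> core h" using assms(2) c(2) unfolding core_def by blast
  then show False using assms(2) by simp
qed

lemma covering_subgraph_iso:
  assumes "wf_graph G" "covering_subgraph g G" "graph_iso f k G H" "graph_iso f k g h"
  shows "covering_subgraph h H"
proof -
  note c = covering_subgraphD[OF assms(2)]
  interpret a: graph_isomorphism f k G H using assms by unfold_locales simp_all
  interpret b: graph_isomorphism f k g h using assms c(1) by unfold_locales simp_all
  show ?thesis
    unfolding covering_subgraph_def
  proof (intro conjI ballI)
    show "wf_graph h" by (rule b.wf_iso)
    show "verts h = verts H" "hedges h = hedges H"
      using a.images b.images c(2,3) by simp_all
  next
    fix y assume "y \<in> verts H"
    then obtain x where "x \<in> verts G" "y = f x" using a.images(1) by blast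
    then show "vindex h y = vindex H y" using a.vindex_iso b.vindex_iso c(2,4) by simp
  next
    fix d assume "d \<in> hedges H"
    then obtain e where e: "e \<in> hedges G" "d = k e" using a.images(2) by blast
    then have "e \<in> hedges g" using c(3) by simp
    note eq = a.hedge_iso[OF e(1)] b.hedge_iso[OF this] c(5-7)[OF e(1)]
    show "bdry h d = bdry H d" "htype h d = htype H d" using e(2) eq by simp_all
    show "invol h d = d \<or> invol h d = invol H d" using e(2) eq(2,5,9) by auto
  qed
qed

lemma contract_iso:
  assumes g: "wf_graph g" and same: "hedges g = hedges G"
    and G: "graph_iso f k G H" and gh: "sgraph_iso f k (g, j) (h, j')"
  shows "graph_iso (image f) k (contract G g j) (contract H h j')"
proof -
  interpret b: graph_isomorphism f k g h using g gh by unfold_locales simp_all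
  have ext: "external g \<subseteq> hedges G" using same by (auto simp: external_def)
  have "bij_betw (image f) (pi0 g) (pi0 h)"
    using b.inj_image b.pi0_iso by (simp add: bij_betw_def)
  moreover have "bij_betw k (external g) (external h)"
    using b.external_iso inj_on_subset[OF b.inj(2), of "external g"] ext same
    by (simp add: bij_betw_def)
  moreover have "joined h `` {bdry h (k e)} = f ` (joined g `` {bdry g e})" if "e \<in> external g" for e
  proof -
    have "e \<in> hedges g" using that by (simp add: external_def)
    then show ?thesis using b.class_iso b.hedge_iso(1) wf_graphD(3)[OF g] by simp
  qed
  moreover have "invol H (k e) = k (invol G e)" "htype H (k e) = htype G e"
    if "e \<in> external g" for e
    using that ext G by (auto simp: graph_iso_def)
  ultimately show ?thesis
    using gh unfolding graph_iso_def contract_def by simp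
qed

text \<open>
  In all the pairs considered here the ambient graph and the contracted graph are connected, so the
  specification of a contracted graph is a single number.
\<close>

lemma contract_specified_iso:
  assumes "connected_graph (contract G g j)"
    and "graph_iso p k (contract G g j) (contract H h j')"
    and wf: "wf_graph (contract G g j)"
    and vg: "verts g = verts G" and vh: "verts h = verts H"
    and i: "i' (verts H) = i (verts G)"
  shows "sgraph_iso p k (contract_specified (G, i) (g, j)) (contract_specified (H, i') (h, j'))"
proof -
  interpret graph_isomorphism p k "contract G g j" "contract H h j'"
    using assms by unfold_locales
  have "pi0 (contract G g j) = {pi0 g}" "p ` pi0 g = pi0 h"
    using pi0_connected[OF assms(1)] images(1) by (simp_all add: contract_def)
  then show ?thesis
    using iso i Union_pi0[of g] Union_pi0[of h] vg vh by simp
qed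


section \<open>Isomorphism classes of pairs\<close>

fun covered_pair :: "('v, 'e, 'h) gpair \<Rightarrow> bool" where
  "covered_pair ((G, i), (g, j)) \<longleftrightarrow> wf_graph G \<and> covering_subgraph g G"

lemma specified_pair_covered: "specified_pair T P \<Longrightarrow> covered_pair P"
  by (cases P rule: covered_pair.cases) (simp add: connected_specified_graph_def)

lemma gpair_iso_sym:
  assumes "covered_pair P" "gpair_iso f k P Q"
  shows "\<exists>f' k'. gpair_iso f' k' Q P"
proof -
  obtain G i g j where P: "P = ((G, i), (g, j))" by (metis surj_pair)
  obtain H i' h j' where Q: "Q = ((H, i'), (h, j'))" by (metis surj_pair)
  have c: "wf_graph G" "covering_subgraph g G" using assms(1) P by simp_all
  have s: "sgraph_iso f k (G, i) (H, i')" "sgraph_iso f k (g, j) (h, j')"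
    using assms(2) P Q by (simp_all add: gpair_iso_def)
  have "sgraph_iso (inv_into (verts G) f) (inv_into (hedges G) k) (H, i') (G, i)"
    "sgraph_iso (inv_into (verts G) f) (inv_into (hedges G) k) (h, j') (g, j)"
    using sgraph_iso_sym[OF c(1) s(1)] sgraph_iso_sym[OF covering_subgraphD(1)[OF c(2)] s(2)]
      covering_subgraphD(2,3)[OF c(2)] by simp_all
  then show ?thesis unfolding P Q gpair_iso_def by auto
qed

lemma gpair_iso_trans:
  assumes "covered_pair P" "gpair_iso f k P Q" "gpair_iso f' k' Q R"
  shows "gpair_iso (f' \<circ> f) (k' \<circ> k) P R"
proof -
  obtain G i g j where P: "P = ((G, i), (g, j))" by (metis surj_pair)
  have "wf_graph G" "wf_graph g"
    using assms(1) P covering_subgraphD(1)[of g G] by simp_all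
  note trans = this[THEN sgraph_iso_trans]
  obtain H i' h j' K l m n where Q: "Q = ((H, i'), (h, j'))" and R: "R = ((K, l), (m, n))"
    by (metis surj_pair)
  show ?thesis
    using assms(2,3) trans(1)[of f k i H i' f' k' K l] trans(2)[of f k j h j' f' k' m n]
    unfolding P Q R gpair_iso_def by simp
qed

lemma covered_pair_iso:
  assumes "covered_pair P" "gpair_iso f k P Q" shows "covered_pair Q"
proof -
  obtain G i g j where P: "P = ((G, i), (g, j))" by (metis surj_pair)
  obtain H i' h j' where Q: "Q = ((H, i'), (h, j'))" by (metis surj_pair)
  have c: "wf_graph G" "covering_subgraph g G" using assms(1) P by simp_all
  have s: "graph_iso f k G H" "graph_iso f k g h"
    using assms(2) P Q by (simp_all add: gpair_iso_def)
  show ?thesis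
    using graph_isomorphism.wf_iso[OF graph_isomorphism.intro, OF c(1) s(1)]
      covering_subgraph_iso[OF c s] Q by simp
qed

lemma gpair_class_eq:
  assumes "covered_pair P" "gpair_iso f k P Q"
  shows "gpair_class P = gpair_class Q"
proof -
  have Q: "covered_pair Q" using assms by (rule covered_pair_iso)
  obtain f' k' where sym: "gpair_iso f' k' Q P" using gpair_iso_sym[OF assms] by blast
  show ?thesis
    unfolding gpair_class_def
  proof (intro Collect_cong iffI)
    fix R :: "(nat, nat, _) gpair"
    show "\<exists>f k. gpair_iso f k Q R" if "\<exists>f k. gpair_iso f k P R"
      using that gpair_iso_trans[OF Q sym] by blast
    show "\<exists>f k. gpair_iso f k P R" if "\<exists>f k. gpair_iso f k Q R"
      using that gpair_iso_trans[OF assms] by blast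
  qed
qed

lemma specified_pair_iso:
  assumes "specified_pair T P" "gpair_iso f k P Q" shows "specified_pair T Q"
proof -
  obtain G i g j where P: "P = ((G, i), (g, j))" by (metis surj_pair)
  obtain H i' h j' where Q: "Q = ((H, i'), (h, j'))" by (metis surj_pair)
  have G: "connected_specified_graph T (G, i)"
    and g: "covering_subgraph g G" "specified_graph T (g, j)"
    and ij: "\<And>C. C \<in> pi0 g \<Longrightarrow> C \<in> pi0 G \<Longrightarrow>
      \<forall>e\<in>hedges G. bdry G e \<in> C \<longrightarrow> invol g e = invol G e \<Longrightarrow> j C = i C"
    and triv: "\<And>v. v \<in> verts G - core g \<Longrightarrow> j {v} = vindex G v"
    and con: "connected_specified_graph T (contract_specified (G, i) (g, j))"
    using assms(1) P by auto
  have s: "sgraph_iso f k (G, i) (H, i')" "sgraph_iso f k (g, j) (h, j')"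
    using assms(2) P Q by (simp_all add: gpair_iso_def)
  note c = covering_subgraphD[OF g(1)]
  have wfG: "wf_graph G" "connected_graph G" using G by (simp_all add: connected_specified_graph_def)
  interpret a: graph_isomorphism f k G H using wfG s by unfold_locales simp_all
  interpret b: graph_isomorphism f k g h using s c(1) by unfold_locales simp_all
  have cov: "covering_subgraph h H"
    using covering_subgraph_iso[OF wfG(1) g(1) a.iso b.iso] .
  have "specified_covering_subgraph T (h, j') (H, i')"
    unfolding specified_covering_subgraph.simps
  proof (intro conjI ballI impI)
    show "covering_subgraph h H" by (rule cov)
    show "specified_graph T (h, j')" by (rule specified_graph_iso[OF g(2) s(2)])
    fix D assume "D \<in> pi0 h \<inter> pi0 H" and D2: "\<forall>d\<in>hedges H. bdry H d \<in> D \<longrightarrow> invol h d = invol H d"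
    then have D: "D \<in> pi0 h" "D \<in> pi0 H" by simp_all
    obtain C where C: "C \<in> pi0 g" "D = f ` C" using D(1) b.pi0_iso by blast
    obtain C' where C': "C' \<in> pi0 G" "D = f ` C'" using D(2) a.pi0_iso by blast
    have "C = C'"
      using C C' a.inj(1) pi0_subset[OF C(1)] pi0_subset[OF C'(1)] c(2)
      by (simp add: inj_on_image_eq_iff)
    have "invol g e = invol G e" if e: "e \<in> hedges G" "bdry G e \<in> C" for e
    proof -
      have e': "e \<in> hedges g" using e c(3) by simp
      have "invol h (k e) = invol H (k e)"
        using D2 a.maps(2)[OF e(1)] a.hedge_iso(1)[OF e(1)] e(2) C(2) by simp
      then have "k (invol g e) = k (invol G e)"
        using a.hedge_iso(2)[OF e(1)] b.hedge_iso(2)[OF e'] by simp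
      then show ?thesis
        using inj_onD[OF a.inj(2)] wf_graphD(4)[OF wfG(1) e(1)] wf_graphD(4)[OF c(1) e'] c(3) by simp
    qed
    then have "j C = i C" using ij C(1) C'(1) \<open>C = C'\<close> by simp
    then show "j' D = i' D" using s C C' \<open>C = C'\<close> by simp
  qed
  moreover have "j' {y} = vindex H y" if y: "y \<in> verts H - core h" for y
  proof -
    obtain x where x: "x \<in> verts G" "y = f x" using y a.images(1) by blast
    then have xc: "x \<notin> core g" using y b.core_iso by blast
    have x1: "{x} \<in> pi0 g"
    proof -
      have "joined g `` {x} = {x}"
      proof (rule joined_isolated)
        fix e assume "e \<in> hedges g" "bdry g e = x"
        then show "invol g e = e"
          using not_core_isolated[OF g(1), of x e] x(1) xc c(3,5) by simp
      qed (use x(1) c(2) in simp)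
      then show ?thesis using pi0I[of x g] x(1) c(2) by simp
    qed
    have "j' (f ` {x}) = j {x}" using x1 s(2) by (simp del: image_insert)
    then show ?thesis using triv[of x] x xc a.vindex_iso by simp
  qed
  moreover have "connected_specified_graph T (contract_specified (H, i') (h, j'))"
  proof -
    have ct: "connected_graph (contract G g j)" "wf_graph (contract G g j)"
      using con by (simp_all add: connected_specified_graph_def)
    have ii: "i' (verts H) = i (verts G)"
      using s(1) pi0_connected[OF wfG(2)] a.images(1) by simp
    note sgraph = contract_specified_iso[where i = i and i' = i', OF ct(1) contract_iso[OF c(1,3) a.iso s(2)] ct(2) c(2)
      covering_subgraphD(2)[OF cov] ii]
    show ?thesis
      using connected_specified_graph_iso[OF con[unfolded contract_specified.simps]
        sgraph[unfolded contract_specified.simps]] by simp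
  qed
  ultimately show ?thesis
    using connected_specified_graph_iso[OF G s(1)] Q by simp
qed

text \<open>
  A class consists of pairs over the natural numbers, so the class of a pair over other types has a
  representative only because its vertices and half-edges, being finitely many, can be numbered.
\<close>

lemma covered_pair_nat_copy:
  assumes "covered_pair P" shows "\<exists>Q :: (nat, nat, 'h) gpair. \<exists>f k. gpair_iso f k P Q"
proof -
  obtain G i g j where P: "P = ((G, i), (g, j))" by (metis surj_pair)
  have G: "wf_graph G" "covering_subgraph g G" using assms P by simp_all
  note c = covering_subgraphD[OF G(2)]
  obtain f :: "_ \<Rightarrow> nat" where f: "inj_on f (verts G)"
    using finite_imp_inj_to_nat_seg[OF wf_graphD(1)[OF G(1)]] by blast
  obtain k :: "_ \<Rightarrow> nat" where k: "inj_on k (hedges G)"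
    using finite_imp_inj_to_nat_seg[OF wf_graphD(2)[OF G(1)]] by blast
  let ?f = "inv_into (verts G) f" and ?k = "inv_into (hedges G) k"
  define copy where "copy A = \<lparr>verts = f ` verts A, hedges = k ` hedges A,
     bdry = f \<circ> bdry A \<circ> ?k, invol = k \<circ> invol A \<circ> ?k, htype = htype A \<circ> ?k,
     vindex = vindex A \<circ> ?f\<rparr>" for A :: "(_, _, 'h) fgraph"
  have "sgraph_iso f k (A, l) (copy A, \<lambda>C. l (?f ` C))"
    if A: "wf_graph A" "verts A = verts G" "hedges A = hedges G" for A l
  proof -
    have "?f ` f ` C = C" if "C \<in> pi0 A" for C
      using inv_into_image_cancel[OF f, of C] pi0_subset[OF that] A(2) by simp
    then show ?thesis
      using A f k by (simp add: copy_def graph_iso_def bij_betw_def)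
  qed
  from this[OF G(1)] this[OF c(1-3)]
  have "gpair_iso f k P ((copy G, \<lambda>C. i (?f ` C)), (copy g, \<lambda>C. j (?f ` C)))"
    unfolding P gpair_iso_def by simp
  then show ?thesis by blast
qed

lemma rep_gpair_class:
  assumes "covered_pair P" obtains f k where "gpair_iso f k P (rep (gpair_class P))"
proof -
  have "gpair_class P \<noteq> {}"
    using covered_pair_nat_copy[OF assms] by (simp add: gpair_class_def)
  then have "rep (gpair_class P) \<in> gpair_class P"
    unfolding rep_def by (metis ex_in_conv someI)
  then show ?thesis using that by (auto simp: gpair_class_def)
qed


section \<open>Insertion of a graph at a vertex\<close>

lemma insert_graph_simps [simp]:
  "verts (insert_graph G v H b) = Inl ` verts G \<union> Inr ` (verts H - {v})"
  "hedges (insert_graph G v H b) = Inl ` internal G \<union> Inr ` hedges H"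
  "bdry (insert_graph G v H b) (Inl e) = Inl (bdry G e)"
  "bdry (insert_graph G v H b) (Inr d) =
     (if bdry H d = v then Inl (bdry G (inv_into (external G) b d)) else Inr (bdry H d))"
  "invol (insert_graph G v H b) = map_sum (invol G) (invol H)"
  "htype (insert_graph G v H b) = case_sum (htype G) (htype H)"
  "vindex (insert_graph G v H b) = case_sum (vindex G) (vindex H)"
  by (simp_all add: insert_graph_def)

lemma gluings_cong:
  assumes "external G = external G'" "star H v = star H' v'"
    and "\<And>e. e \<in> external G \<Longrightarrow> htype G e = htype G' e"
    and "\<And>d. d \<in> star H v \<Longrightarrow> htype H d = htype H' d"
  shows "gluings G v H = gluings G' v' H'"
proof -
  have "htype H (b e) = htype G e \<longleftrightarrow> htype H' (b e) = htype G' e"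
    if "b \<in> external G \<rightarrow>\<^sub>E star H v" "e \<in> external G" for b e
    using that assms(3,4) PiE_mem[OF that] by simp
  then show ?thesis
    unfolding gluings_def assms(1,2)[symmetric] by (intro Collect_cong conj_cong ball_cong) simp_all
qed

lemma map_sum_upd:
  "map_sum (p(e := e')) q = (map_sum p q)(Inl e := Inl e')"
  "map_sum p (q(d := d')) = (map_sum p q)(Inr d := Inr d')"
  by (rule ext, rename_tac x, case_tac x; simp)+

lemma joined_Inl:
  assumes L: "wf_graph L" and g: "wf_graph g"
    and V: "\<And>x. x \<in> verts g \<Longrightarrow> Inl x \<in> verts L"
    and E: "\<And>e. e \<in> internal g \<Longrightarrow> Inl e \<in> hedges L \<and> bdry L (Inl e) = Inl (bdry g e) \<and>
              bdry L (invol L (Inl e)) = Inl (bdry g (invol g e))"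
    and xy: "(x, y) \<in> joined g"
  shows "(Inl x, Inl y) \<in> joined L"
proof (rule joined_map[where f = Inl, OF xy])
  show "Inl x \<in> verts L" using V joined_in_verts[OF xy] by simp
  fix e assume e: "e \<in> hedges g"
  show "(Inl (bdry g e), Inl (bdry g (invol g e))) \<in> joined L"
  proof (cases "invol g e = e")
    case True then show ?thesis using joined_refl V wf_graphD(3)[OF g e] by fastforce
  next
    case False
    then have "e \<in> internal g" using e by (simp add: internal_def)
    from E[OF this] show ?thesis using joined_edge[OF L, of "Inl e"] by simp
  qed
qed

text \<open>
  The half-edge of the new graph that corresponds to a half-edge \<open>e\<close> of the inserted graph: external
  edges survive only through the half-edges to which they are glued.
\<close>

definition glued :: "('v, 'e, 'h) fgraph \<Rightarrow> ('e \<Rightarrow> 'd) \<Rightarrow> 'e \<Rightarrow> 'e + 'd" where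
  "glued G b e = (if invol G e = e then Inr (b e) else Inl e)"

locale insertion =
  fixes G :: "('v, 'e, 'h) fgraph" and v :: 'w and H :: "('w, 'd, 'h) fgraph" and b :: "'e \<Rightarrow> 'd"
  assumes G: "wf_graph G" and H: "wf_graph H" and v: "v \<in> verts H" and b: "b \<in> gluings G v H"
begin

abbreviation K where "K \<equiv> insert_graph G v H b"

abbreviation proj :: "'v + 'w \<Rightarrow> 'w" where "proj \<equiv> case_sum (\<lambda>_. v) (\<lambda>w. w)"

lemma b_bij: "bij_betw b (external G) (star H v)"
  and b_htype: "e \<in> external G \<Longrightarrow> htype H (b e) = htype G e"
  using b by (simp_all add: gluings_def)

lemma b_maps:
  assumes "e \<in> external G"
  shows "b e \<in> hedges H" "bdry H (b e) = v" "inv_into (external G) b (b e) = e"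
  using bij_betw_apply[OF b_bij assms] bij_betw_inv_into_left[OF b_bij assms]
  by (simp_all add: star_def)

lemma b_inv:
  assumes "d \<in> hedges H" "bdry H d = v"
  shows "inv_into (external G) b d \<in> external G" "b (inv_into (external G) b d) = d"
proof -
  have d: "d \<in> star H v" using assms by (simp add: star_def)
  show "inv_into (external G) b d \<in> external G"
    using bij_betw_apply[OF bij_betw_inv_into[OF b_bij] d] .
  show "b (inv_into (external G) b d) = d"
    using bij_betw_inv_into_right[OF b_bij d] .
qed

lemma b_inv_bdry:
  assumes "d \<in> hedges H" "bdry H d = v"
  shows "bdry G (inv_into (external G) b d) \<in> verts G"
  using b_inv(1)[OF assms] wf_graphD(3)[OF G] by (simp add: external_def)

lemma proj_verts: "x \<in> verts K \<Longrightarrow> proj x \<in> verts H"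
  using v by auto

lemma proj_bdry [simp]: "proj (bdry K (Inr d)) = bdry H d"
  by simp

lemma wf_insert: "wf_graph K"
  unfolding wf_graph_def
proof (intro conjI ballI)
  have "finite (internal G)" using wf_graphD(2)[OF G] by (simp add: internal_def)
  then show "finite (verts K)" "finite (hedges K)"
    using wf_graphD(1)[OF G] wf_graphD(1,2)[OF H] by simp_all
  fix x assume "x \<in> hedges K"
  then consider e where "x = Inl e" "e \<in> internal G" | d where "x = Inr d" "d \<in> hedges H"
    by auto
  then have "bdry K x \<in> verts K \<and> invol K x \<in> hedges K \<and> invol K (invol K x) = x \<and>
    htype K (invol K x) = htype K x"
  proof cases
    case 1
    then have e: "e \<in> hedges G" "invol G e \<noteq> e" by (simp_all add: internal_def)
    then have "invol G e \<in> internal G"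
      using wf_graphD(4,5)[OF G e(1)] by (simp add: internal_def)
    then show ?thesis
      using 1 wf_graphD(3-6)[OF G e(1)] by simp
  next
    case 2
    then show ?thesis
      using wf_graphD(3-6)[OF H 2(2)] b_inv_bdry[OF 2(2)] by simp
  qed
  then show "bdry K x \<in> verts K" "invol K x \<in> hedges K" "invol K (invol K x) = x"
    "htype K (invol K x) = htype K x" by simp_all
qed

lemma external_insert: "external K = Inr ` external H"
  by (auto simp: external_def internal_def)

lemma internal_insert: "internal K = Inl ` internal G \<union> Inr ` internal H"
  by (auto simp: internal_def)

text \<open>
  With \<open>A = hedges G\<close> and a single vertex \<open>C\<close> this compares stars, with the external edges of a
  subgraph as \<open>A\<close> and one of its components as \<open>C\<close> it compares the types of residues.
\<close>

lemma glued_bij: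
  assumes A: "A \<subseteq> hedges G" "external G \<subseteq> A" and C: "C \<subseteq> verts G"
  shows "bij_betw (glued G b) {e \<in> A. bdry G e \<in> C}
           {x \<in> Inl ` (internal G \<inter> A) \<union> Inr ` hedges H. bdry K x \<in> Inl ` C}"
    (is "bij_betw _ ?A ?B")
proof -
  have ext: "e \<in> external G \<longleftrightarrow> e \<in> A \<and> invol G e = e" for e
    using A by (auto simp: external_def)
  have "inj_on (glued G b) ?A"
  proof (rule inj_onI)
    fix e e' assume "e \<in> ?A" "e' \<in> ?A" "glued G b e = glued G b e'"
    then show "e = e'"
      using inj_onD[OF bij_betw_imp_inj_on[OF b_bij], of e e'] ext[of e] ext[of e']
      by (auto simp: glued_def split: if_splits)
  qed
  moreover have "glued G b e \<in> ?B" if "e \<in> ?A" for e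
    using that A(1) b_maps[of e] ext[of e] by (auto simp: glued_def internal_def)
  moreover have "x \<in> glued G b ` ?A" if x: "x \<in> ?B" for x
  proof (cases x)
    case (Inl e)
    then have "e \<in> ?A" "glued G b e = x" using x by (auto simp: internal_def glued_def)
    then show ?thesis by blast
  next
    case (Inr d)
    then have d: "d \<in> hedges H" "bdry H d = v" "bdry G (inv_into (external G) b d) \<in> C"
      using x by (auto split: if_splits)
    let ?e = "inv_into (external G) b d"
    have "?e \<in> ?A" "glued G b ?e = x"
      using b_inv[OF d(1,2)] d(3) ext[of ?e] Inr by (auto simp: glued_def)
    then show ?thesis by blast
  qed
  ultimately show ?thesis unfolding bij_betw_def by auto
qed

lemma glued_htype: "e \<in> hedges G \<Longrightarrow> htype K (glued G b e) = htype G e"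
  using b_htype[of e] by (simp add: glued_def external_def)

lemma glued_star: "u \<in> verts G \<Longrightarrow> bij_betw (glued G b) (star G u) (star K (Inl u))"
proof -
  assume u: "u \<in> verts G"
  have "internal G \<inter> hedges G = internal G" "external G \<subseteq> hedges G"
    by (auto simp: internal_def external_def)
  then show ?thesis using glued_bij[of "hedges G" "{u}"] u by (simp add: star_def)
qed

lemma vtype_insert_Inl:
  assumes "u \<in> verts G" shows "vtype K (Inl u) = vtype G u"
proof -
  have "image_mset (htype K) (mset_set (star K (Inl u))) = image_mset (htype G) (mset_set (star G u))"
    by (rule image_mset_reindex[OF glued_star[OF assms]]) (rule glued_htype, simp add: star_def)
  then show ?thesis by (simp add: vtype_def)
qed

lemma star_insert_Inr:
  assumes "w \<noteq> v" shows "star K (Inr w) = Inr ` star H w"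
  using assms by (auto simp: star_def split: if_splits)

lemma vtype_insert_Inr:
  assumes "w \<noteq> v" shows "vtype K (Inr w) = vtype H w"
proof -
  have "image_mset (htype K) (mset_set (star K (Inr w))) = image_mset (htype H) (mset_set (star H w))"
    by (rule image_mset_reindex[where k = Inr]) (simp_all add: star_insert_Inr[OF assms] bij_betw_def)
  then show ?thesis by (simp add: vtype_def)
qed

lemma insertion_cut:
  assumes "d \<in> hedges H" shows "insertion G v (cut H d) b"
proof
  have "gluings G v (cut H d) = gluings G v H"
    by (rule gluings_cong) (simp_all add: star_def)
  then show "b \<in> gluings G v (cut H d)" using b by simp
qed (use G v wf_cut[OF H assms] in simp_all)

end

lemma insertion_cong:
  assumes "insertion G v H b" "wf_graph h" "verts h = verts H" "hedges h = hedges H"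
    and "\<And>d. d \<in> hedges H \<Longrightarrow> bdry h d = bdry H d \<and> htype h d = htype H d"
  shows "insertion G v h b"
proof
  have "star h v = star H v" using assms(4,5) unfolding star_def by (intro Collect_cong conj_cong) simp_all
  then have "gluings G v h = gluings G v H"
    using assms(4,5) by (intro gluings_cong) (simp_all add: star_def)
  then show "b \<in> gluings G v h" using assms(1) by (simp add: insertion_def)
qed (use assms in \<open>simp_all add: insertion_def\<close>)

text \<open>
  Since the inserted graph is connected, collapsing it back to the point \<open>v\<close> has connected fibres and
  thus preserves and reflects connectivity.
\<close>

locale connected_insertion = insertion +
  assumes conn: "connected_graph G"
begin

lemma joined_proj:
  assumes "x \<in> verts K" "y \<in> verts K"
  shows "(x, y) \<in> joined K \<longleftrightarrow> (proj x, proj y) \<in> joined H"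
proof (rule joined_iff_projection[OF wf_insert])
  show "x \<in> verts K" "y \<in> verts K" by (fact assms)+
  show "proj z \<in> verts H" if "z \<in> verts K" for z using that by (rule proj_verts)
  show "(proj (bdry K z), proj (bdry K (invol K z))) \<in> joined H" if "z \<in> hedges K" for z
    using that v joined_refl[OF v] joined_edge[OF H] by auto
  show "\<exists>s t. (s, t) \<in> joined K \<and> proj s = bdry H d \<and> proj t = bdry H (invol H d)"
    if d: "d \<in> hedges H" for d
  proof (intro exI conjI)
    show "(bdry K (Inr d), bdry K (invol K (Inr d))) \<in> joined K"
      by (rule joined_edge[OF wf_insert]) (use d in simp)
  qed simp_all
  show "(s, t) \<in> joined K" if st: "s \<in> verts K" "t \<in> verts K" "proj s = proj t" for s t
  proof -
    have emb: "(Inl a, Inl a') \<in> joined K" if "a \<in> verts G" "a' \<in> verts G" for a a'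
    proof (rule joined_Inl[OF wf_insert G])
      show "(a, a') \<in> joined G" using that conn connected_graph_iff[OF G] by blast
    qed (simp_all)
    show ?thesis using st emb joined_refl[OF st(1)] by auto
  qed
qed

lemma proj_onto: "proj ` verts K = verts H"
proof
  show "proj ` verts K \<subseteq> verts H" using proj_verts by (rule image_subsetI)
  obtain u where u: "u \<in> verts G" using conn connected_graph_iff[OF G] by blast
  show "verts H \<subseteq> proj ` verts K"
  proof
    fix w assume w: "w \<in> verts H"
    have "w = proj (if w = v then Inl u else Inr w)" by simp
    moreover have "(if w = v then Inl u else Inr w) \<in> verts K" using u w by simp
    ultimately show "w \<in> proj ` verts K" by (rule image_eqI)
  qed
qed

lemma pi0_insert: "pi0 H = image proj ` pi0 K"
  by (rule pi0_projection_onto[OF wf_insert H proj_onto joined_proj])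

lemma pi0_insert_proj:
  assumes "C \<in> pi0 K"
  shows "proj ` C \<in> pi0 H" "C = {x \<in> verts K. proj x \<in> proj ` C}"
  using pi0_image_projection[OF wf_insert H proj_onto joined_proj assms] by simp_all

lemma connected_insert:
  assumes "connected_graph H" shows "connected_graph K"
proof -
  have "verts K \<noteq> {}" using proj_onto v by blast
  moreover have "(x, y) \<in> joined K" if "x \<in> verts K" "y \<in> verts K" for x y
    using that assms proj_verts connected_graph_iff[OF H] joined_proj by blast
  ultimately show ?thesis using connected_graph_iff[OF wf_insert] by blast
qed

text \<open>
  An edge of the inserted graph is bypassed inside this graph. Cutting an edge of \<open>H\<close> commutes with
  the insertion, so that a detour in \<open>H\<close> can be lifted.
\<close>

lemma bridgeless_insert:
  assumes "bridgeless G" "bridgeless H" shows "bridgeless K"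
  unfolding bridgeless_def
proof
  fix x assume x: "x \<in> internal K"
  then have xh: "x \<in> hedges K" by (simp add: internal_def)
  from x consider e where "x = Inl e" "e \<in> internal G" | d where "x = Inr d" "d \<in> internal H"
    unfolding internal_insert by blast
  then show "(bdry K x, bdry K (invol K x)) \<in> joined (cut K x)"
  proof cases
    case 1
    then have e: "e \<in> hedges G" by (simp add: internal_def)
    have "(Inl (bdry G e), Inl (bdry G (invol G e))) \<in> joined (cut K x)"
    proof (rule joined_Inl[OF wf_cut[OF wf_insert xh] wf_cut[OF G e]])
      show "(bdry G e, bdry G (invol G e)) \<in> joined (cut G e)"
        using assms(1) 1 by (simp add: bridgeless_def)
      fix e' assume "e' \<in> internal (cut G e)"
      then show "Inl e' \<in> hedges (cut K x) \<and> bdry (cut K x) (Inl e') = Inl (bdry (cut G e) e') \<and>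
        bdry (cut K x) (invol (cut K x) (Inl e')) = Inl (bdry (cut G e) (invol (cut G e) e'))"
        using 1 by (auto simp: internal_def split: if_splits)
    qed simp
    then show ?thesis using 1 by simp
  next
    case 2
    then have d: "d \<in> hedges H" by (simp add: internal_def)
    interpret c: insertion G v "cut H d" b by (rule insertion_cut[OF d])
    interpret c: connected_insertion G v "cut H d" b by unfold_locales (rule conn)
    have eq: "cut K x = insert_graph G v (cut H d) b"
      unfolding 2(1) by (simp add: cut_def insert_graph_def map_sum_upd cong: if_cong)
    have "bdry K x \<in> verts (cut K x)" "bdry K (invol K x) \<in> verts (cut K x)"
      unfolding cut_simps using wf_graphD(3,4)[OF wf_insert] xh by blast+
    then have "(bdry K x, bdry K (invol K x)) \<in> joined (cut K x) \<longleftrightarrow>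
        (proj (bdry K x), proj (bdry K (invol K x))) \<in> joined (cut H d)"
      unfolding eq by (rule c.joined_proj)
    moreover have "proj (bdry K x) = bdry H d" "proj (bdry K (invol K x)) = bdry H (invol H d)"
      unfolding 2(1) using proj_bdry[of d] proj_bdry[of "invol H d"] by simp_all
    moreover have "(bdry H d, bdry H (invol H d)) \<in> joined (cut H d)"
      using assms(2) 2(2) by (simp add: bridgeless_def)
    ultimately show ?thesis by simp
  qed
qed

lemma leg_type_insert:
  assumes "C \<in> pi0 K"
  shows "leg_type K (\<lambda>C. j (proj ` C)) C = leg_type H j (proj ` C)"
proof -
  have "bdry K (Inr d) \<in> C \<longleftrightarrow> bdry H d \<in> proj ` C" if "d \<in> hedges H" for d
  proof -
    have "bdry K (Inr d) \<in> verts K" using wf_graphD(3)[OF wf_insert, of "Inr d"] that by simp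
    then have "bdry K (Inr d) \<in> C \<longleftrightarrow> proj (bdry K (Inr d)) \<in> proj ` C"
      using pi0_insert_proj(2)[OF assms] by blast
    then show ?thesis unfolding proj_bdry .
  qed
  then have "{x \<in> external K. bdry K x \<in> C} = Inr ` {d \<in> external H. bdry H d \<in> proj ` C}"
    unfolding external_insert Compr_image_eq
    by (intro image_cong Collect_cong conj_cong) (simp_all add: external_def)
  then have "image_mset (htype K) (mset_set {x \<in> external K. bdry K x \<in> C})
      = image_mset (htype H) (mset_set {d \<in> external H. bdry H d \<in> proj ` C})"
    by (intro image_mset_reindex[where k = Inr]) (simp_all add: bij_betw_def)
  then show ?thesis by (simp add: leg_type_def)
qed

lemma specified_insert:
  assumes s: "specified_graph T (G, i)" "specified_graph T (H, j)"
  shows "specified_graph T (K, \<lambda>C. j (proj ` C))"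
  unfolding specified_graph_iff
proof (intro conjI ballI)
  note sG = s(1)[unfolded specified_graph_iff] and sH = s(2)[unfolded specified_graph_iff]
  show "wf_graph K" by (rule wf_insert)
  show "bridgeless K" using bridgeless_insert sG sH by simp
  show "htype K x \<in> htypes T" if "x \<in> hedges K" for x
    using that sG sH by (auto simp: internal_def)
  show "vtype K x \<in> vtypes T" if "x \<in> verts K" for x
  proof (cases x)
    case (Inl u) then show ?thesis using that sG vtype_insert_Inl[of u] by auto
  next
    case (Inr w)
    then have "w \<in> verts H" "w \<noteq> v" using that by auto
    then show ?thesis using Inr sH vtype_insert_Inr[of w] by simp
  qed
  show "leg_type K (\<lambda>C. j (proj ` C)) C \<in> vtypes T" if "C \<in> pi0 K" for C
    using that sH leg_type_insert[OF that, of j] pi0_insert_proj(1)[OF that] by simp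
qed

text \<open>
  The external edges of the ambient graph, as well as its specification, survive the insertion.
\<close>

lemma res_type_insert:
  assumes "connected_graph H"
  shows "res_type (K, \<lambda>C. j (proj ` C)) = res_type (H, j)"
proof -
  have c: "connected_graph K" by (rule connected_insert[OF assms])
  have "verts K \<in> pi0 K" unfolding pi0_connected[OF c] by (rule singletonI)
  then show ?thesis
    using res_type_connected(1)[OF wf_insert c] res_type_connected(1)[OF H assms]
      leg_type_insert[of "verts K" j] proj_onto by simp
qed

text \<open>
  All internal edges of the inserted graph project to \<open>v\<close>. They do not create a new nontrivial
  component because the component of \<open>v\<close> already is one.
\<close>

lemma core_insert:
  assumes vc: "v \<in> core H" and x: "x \<in> verts K"
  shows "x \<in> core K \<longleftrightarrow> proj x \<in> core H"
proof
  assume "x \<in> core K"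
  then obtain z where z: "z \<in> internal K" "(x, bdry K z) \<in> joined K" by (auto simp: core_def)
  have zp: "(proj x, proj (bdry K z)) \<in> joined H"
    using z(2) joined_proj joined_in_verts[OF z(2)] by simp
  from z(1) consider e where "z = Inl e" "e \<in> internal G" | d where "z = Inr d" "d \<in> internal H"
    unfolding internal_insert by blast
  then show "proj x \<in> core H"
  proof cases
    case 1
    obtain d where d: "d \<in> internal H" "(v, bdry H d) \<in> joined H" using vc by (auto simp: core_def)
    have "(proj x, v) \<in> joined H" using zp 1 by simp
    then have "(proj x, bdry H d) \<in> joined H" using d(2) by (rule joined_trans)
    then show ?thesis using d(1) proj_verts[OF x] unfolding core_def by blast
  next
    case 2
    then have "(proj x, bdry H d) \<in> joined H" using zp by (simp only: proj_bdry)
    then show ?thesis using 2 proj_verts[OF x] unfolding core_def by blast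
  qed
next
  assume "proj x \<in> core H"
  then obtain d where d: "d \<in> internal H" "(proj x, bdry H d) \<in> joined H" by (auto simp: core_def)
  then have "Inr d \<in> hedges K" by (simp add: internal_def)
  then have "bdry K (Inr d) \<in> verts K" by (rule wf_graphD(3)[OF wf_insert])
  moreover have "(proj x, proj (bdry K (Inr d))) \<in> joined H" using d(2) by (simp only: proj_bdry)
  ultimately have "(x, bdry K (Inr d)) \<in> joined K" using joined_proj[OF x] by blast
  then show "x \<in> core K" using x d(1) unfolding core_def internal_insert by blast
qed

end


section \<open>Disjoint unions of subgraphs\<close>

definition union_graph ::
  "('v, 'e, 'h) fgraph \<Rightarrow> 'w \<Rightarrow> ('w, 'd, 'h) fgraph \<Rightarrow> ('e \<Rightarrow> 'd) \<Rightarrow>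
   ('v, 'e, 'h) fgraph \<Rightarrow> ('w, 'd, 'h) fgraph \<Rightarrow> ('v + 'w, 'e + 'd, 'h) fgraph"
where
  "union_graph G v H b g h = (insert_graph G v H b)\<lparr>invol := map_sum (invol g) (invol h)\<rparr>"

lemma union_graph_simps [simp]:
  "verts (union_graph G v H b g h) = verts (insert_graph G v H b)"
  "hedges (union_graph G v H b g h) = hedges (insert_graph G v H b)"
  "bdry (union_graph G v H b g h) = bdry (insert_graph G v H b)"
  "invol (union_graph G v H b g h) = map_sum (invol g) (invol h)"
  "htype (union_graph G v H b g h) = htype (insert_graph G v H b)"
  "vindex (union_graph G v H b g h) = vindex (insert_graph G v H b)"
  by (simp_all add: union_graph_def)

lemma cut_union_graph:
  "cut (union_graph G v H b g h) (Inl e) = union_graph G v H b (cut g e) h"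
  "cut (union_graph G v H b g h) (Inr d) = union_graph G v H b g (cut h d)"
  by (simp_all add: union_graph_def cut_def map_sum_upd)

lemma covering_subgraph_cut:
  assumes "covering_subgraph g G" "e \<in> hedges G" shows "covering_subgraph (cut g e) G"
  using assms wf_cut[of g e] unfolding covering_subgraph_def by simp

lemma external_covering:
  assumes "wf_graph G" "covering_subgraph g G"
  shows "external G \<subseteq> external g" "external g \<subseteq> hedges G" "internal g \<subseteq> internal G"
  using covering_subgraphD[OF assms(2)] by (force simp: external_def internal_def)+

lemma vtype_covering:
  assumes "covering_subgraph g G" "u \<in> verts G" shows "vtype g u = vtype G u"
proof -
  note c = covering_subgraphD[OF assms(1)]
  have "star g u = star G u" using c(3,5) unfolding star_def by (intro Collect_cong conj_cong) simp_all
  moreover have "image_mset (htype g) (mset_set (star G u)) = image_mset (htype G) (mset_set (star G u))"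
    by (rule image_mset_reindex[where k = id]) (use c(6) in \<open>simp_all add: star_def\<close>)
  ultimately show ?thesis using c(4)[OF assms(2)] by (simp add: vtype_def)
qed

text \<open>
  The vertex \<open>v\<close> forms a trivial component of \<open>h\<close>, so no internal edge of the union runs between the
  two sides: none of the half-edges to which the inserted graph is glued lies on an internal edge.
\<close>

locale pair_union = insertion G v H b
  for G :: "('v, 'e, 'h) fgraph" and v :: 'w and H :: "('w, 'd, 'h) fgraph" and b :: "'e \<Rightarrow> 'd" +
  fixes g :: "('v, 'e, 'h) fgraph" and h :: "('w, 'd, 'h) fgraph"
  assumes g: "covering_subgraph g G" and h: "covering_subgraph h H"
    and isolated: "\<And>d. d \<in> hedges H \<Longrightarrow> bdry H d = v \<Longrightarrow> invol h d = d"
begin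

abbreviation U where "U \<equiv> union_graph G v H b g h"

lemmas gD = covering_subgraphD[OF g] and hD = covering_subgraphD[OF h]

lemma isolated_bdry:
  assumes "d \<in> hedges H" "bdry H d \<noteq> v" shows "bdry H (invol h d) \<noteq> v"
proof
  assume "bdry H (invol h d) = v"
  moreover have "invol h d \<in> hedges H" "invol h (invol h d) = d"
    using wf_graphD(4,5)[OF hD(1)] hD(3) assms(1) by simp_all
  ultimately have "invol h d = d" using isolated[of "invol h d"] by simp
  then show False using \<open>bdry H (invol h d) = v\<close> assms(2) by simp
qed

lemma covering_union: "covering_subgraph U K"
proof -
  have inv: "invol U x \<in> hedges U \<and> invol U (invol U x) = x \<and> htype U (invol U x) = htype U x \<and>
      (invol U x = x \<or> invol U x = invol K x)" if x: "x \<in> hedges K" for x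
  proof (cases x)
    case (Inl e)
    then have e: "e \<in> internal G" "e \<in> hedges G" using x by (auto simp: internal_def)
    have "invol G e \<in> internal G"
      using e wf_graphD(4,5)[OF G] by (auto simp: internal_def)
    then have "invol g e \<in> internal G" using gD(7)[OF e(2)] e(1) by auto
    moreover have "invol g (invol g e) = e" using wf_graphD(5)[OF gD(1)] gD(3) e(2) by simp
    moreover have "htype G (invol g e) = htype G e"
      using gD(7)[OF e(2)] wf_graphD(6)[OF G e(2)] by auto
    ultimately show ?thesis using Inl gD(7)[OF e(2)] by auto
  next
    case (Inr d)
    then have d: "d \<in> hedges H" using x by auto
    have "invol h d \<in> hedges H" "invol h (invol h d) = d"
      using wf_graphD(4,5)[OF hD(1)] hD(3) d by simp_all
    moreover have "htype H (invol h d) = htype H d"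
      using hD(7)[OF d] wf_graphD(6)[OF H d] by auto
    ultimately show ?thesis using Inr hD(7)[OF d] by auto
  qed
  have "wf_graph U"
    using wf_insert inv unfolding wf_graph_def by (simp only: union_graph_simps) blast
  then show ?thesis
    unfolding covering_subgraph_def using inv by (simp only: union_graph_simps) blast
qed

lemmas wf_union = covering_subgraphD(1)[OF covering_union]

lemma joined_union_Inl: "joined U `` {Inl x} = Inl ` (joined g `` {x})"
proof (intro set_eqI iffI)
  fix z :: "'v + 'w" assume "z \<in> joined U `` {Inl x}"
  then have z: "(Inl x, z) \<in> joined U" by simp
  then have x: "x \<in> verts g" using joined_in_verts[OF z] gD(2) by auto
  from z show "z \<in> Inl ` (joined g `` {x})"
  proof (rule joined_induct[where P = "\<lambda>z. z \<in> Inl ` (joined g `` {x})"])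
    show "Inl x \<in> Inl ` (joined g `` {x})" using joined_refl[OF x] by simp
    fix y assume y: "y \<in> hedges U" "bdry U y \<in> Inl ` (joined g `` {x})"
    show "bdry U (invol U y) \<in> Inl ` (joined g `` {x})"
    proof (cases y)
      case (Inl e)
      then have e: "e \<in> hedges G" using y(1) by (auto simp: internal_def)
      have "invol g e \<in> hedges G" using wf_graphD(4)[OF gD(1)] gD(3) e by simp
      then have "(bdry G e, bdry G (invol g e)) \<in> joined g"
        using joined_edge[OF gD(1), of e] gD(3,5) e by simp
      moreover have "(x, bdry G e) \<in> joined g" using y(2) Inl by auto
      ultimately have "(x, bdry G (invol g e)) \<in> joined g" using joined_trans by metis
      then show ?thesis using Inl by simp
    next
      case (Inr d)
      then have "d \<in> hedges H" "bdry H d = v" using y by (auto split: if_splits)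
      then have "invol U y = y" using isolated Inr by simp
      then show ?thesis using y(2) by simp
    qed
  qed
next
  fix z :: "'v + 'w" assume "z \<in> Inl ` (joined g `` {x})"
  then obtain y where y: "z = Inl y" "(x, y) \<in> joined g" by auto
  have "(Inl x, Inl y) \<in> joined U"
  proof (rule joined_Inl[OF wf_union gD(1) _ _ y(2)])
    show "Inl a \<in> verts U" if "a \<in> verts g" for a using that gD(2) by simp
    show "Inl e \<in> hedges U \<and> bdry U (Inl e) = Inl (bdry g e) \<and>
        bdry U (invol U (Inl e)) = Inl (bdry g (invol g e))" if "e \<in> internal g" for e
    proof -
      have "e \<in> internal G" "e \<in> hedges g"
        using that external_covering(3)[OF G g] by (auto simp: internal_def)
      then show ?thesis using gD(3,5) wf_graphD(4)[OF gD(1), of e] by simp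
    qed
  qed
  then show "z \<in> joined U `` {Inl x}" using y(1) by simp
qed

lemma joined_union_Inr:
  assumes "x \<noteq> v" shows "joined U `` {Inr x} = Inr ` (joined h `` {x})"
proof (intro set_eqI iffI)
  fix z :: "'v + 'w" assume "z \<in> joined U `` {Inr x}"
  then have z: "(Inr x, z) \<in> joined U" by simp
  then have x: "x \<in> verts h" using joined_in_verts[OF z] hD(2) by auto
  from z show "z \<in> Inr ` (joined h `` {x})"
  proof (rule joined_induct[where P = "\<lambda>z. z \<in> Inr ` (joined h `` {x})"])
    show "Inr x \<in> Inr ` (joined h `` {x})" using joined_refl[OF x] by simp
    fix y assume y: "y \<in> hedges U" "bdry U y \<in> Inr ` (joined h `` {x})"
    then obtain d where d: "y = Inr d" "d \<in> hedges H" "bdry H d \<noteq> v" "(x, bdry H d) \<in> joined h"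
      by (auto split: if_splits)
    have "invol h d \<in> hedges H" using wf_graphD(4)[OF hD(1)] hD(3) d(2) by simp
    then have "(bdry H d, bdry H (invol h d)) \<in> joined h"
      using joined_edge[OF hD(1), of d] hD(3,5) d(2) by simp
    with d(4) have "(x, bdry H (invol h d)) \<in> joined h" by (rule joined_trans)
    then show "bdry U (invol U y) \<in> Inr ` (joined h `` {x})"
      using d(1) isolated_bdry[OF d(2,3)] by simp
  qed
next
  fix z :: "'v + 'w" assume "z \<in> Inr ` (joined h `` {x})"
  then obtain y where y: "z = Inr y" "(x, y) \<in> joined h" by auto
  have x: "Inr x \<in> verts U" using joined_in_verts[OF y(2)] hD(2) assms by simp
  from y(2) have "y \<noteq> v \<and> (Inr x, Inr y) \<in> joined U"
  proof (rule joined_induct[where P = "\<lambda>y. y \<noteq> v \<and> (Inr x, Inr y) \<in> joined U"])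
    show "x \<noteq> v \<and> (Inr x, Inr x) \<in> joined U" using joined_refl[OF x] assms by simp
    fix d assume d: "d \<in> hedges h" "bdry h d \<noteq> v \<and> (Inr x, Inr (bdry h d)) \<in> joined U"
    then have dH: "d \<in> hedges H" "bdry H d \<noteq> v" "(Inr x, Inr (bdry H d)) \<in> joined U"
      using hD(3,5) by simp_all
    have d': "invol h d \<in> hedges H" "bdry H (invol h d) \<noteq> v"
      using wf_graphD(4)[OF hD(1)] hD(3) isolated_bdry dH by simp_all
    have "(Inr (bdry H d), Inr (bdry H (invol h d))) \<in> joined U"
      using joined_edge[OF wf_union, of "Inr d"] dH d' by simp
    with dH(3) have "(Inr x, Inr (bdry H (invol h d))) \<in> joined U" by (rule joined_trans)
    then show "bdry h (invol h d) \<noteq> v \<and> (Inr x, Inr (bdry h (invol h d))) \<in> joined U"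
      using d' hD(5) by simp
  qed
  then show "z \<in> joined U `` {Inr x}" using y(1) by simp
qed

lemma trivial_class: "joined h `` {v} = {v}"
  by (rule joined_isolated) (use v hD(2,3,5) isolated in auto)

lemma pi0_h:
  shows "{v} \<in> pi0 h" and "C \<in> pi0 h \<Longrightarrow> C \<noteq> {v} \<Longrightarrow> v \<notin> C"
proof -
  show "{v} \<in> pi0 h" using pi0I[of v h] trivial_class v hD(2) by simp
  show "v \<notin> C" if "C \<in> pi0 h" "C \<noteq> {v}"
    using pi0_class[OF hD(1) that(1), of v] trivial_class that(2) by auto
qed

lemma pi0_union: "pi0 U = image Inl ` pi0 g \<union> image Inr ` (pi0 h - {{v}})"
proof (intro subset_antisym subsetI)
  fix C assume "C \<in> pi0 U"
  then obtain x where x: "x \<in> verts U" "C = joined U `` {x}" by (rule pi0E)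
  show "C \<in> image Inl ` pi0 g \<union> image Inr ` (pi0 h - {{v}})"
  proof (cases x)
    case (Inl u)
    then have "joined g `` {u} \<in> pi0 g" using x(1) gD(2) by (intro pi0I) auto
    then show ?thesis using x(2) joined_union_Inl Inl by simp
  next
    case (Inr w)
    then have w: "w \<in> verts h" "w \<noteq> v" using x(1) hD(2) by auto
    have "joined h `` {w} \<in> pi0 h" using w(1) by (rule pi0I)
    moreover have "joined h `` {w} \<noteq> {v}" using joined_refl[OF w(1)] w(2) by auto
    ultimately show ?thesis using x(2) joined_union_Inr[OF w(2)] Inr by simp
  qed
next
  fix C assume "C \<in> image Inl ` pi0 g \<union> image Inr ` (pi0 h - {{v}})"
  then consider D where "D \<in> pi0 g" "C = Inl ` D" | D where "D \<in> pi0 h" "D \<noteq> {v}" "C = Inr ` D"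
    by auto
  then show "C \<in> pi0 U"
  proof cases
    case 1
    from 1(1) obtain u where "u \<in> verts g" "D = joined g `` {u}" by (rule pi0E)
    then show ?thesis using 1(2) joined_union_Inl[of u] pi0I[of "Inl u" U] gD(2) by simp
  next
    case 2
    from 2(1) obtain w where w: "w \<in> verts h" "D = joined h `` {w}" by (rule pi0E)
    then have "w \<noteq> v" using 2(2) trivial_class by auto
    then show ?thesis using 2(3) w joined_union_Inr[of w] pi0I[of "Inr w" U] hD(2) by simp
  qed
qed

lemma internal_union: "internal U = Inl ` internal g \<union> Inr ` internal h"
  using external_covering(3)[OF G g] gD(3) hD(3) by (auto simp: internal_def)

lemma external_union: "external U = Inl ` (internal G \<inter> external g) \<union> Inr ` external h"
  using gD(3) hD(3) by (auto simp: external_def internal_def)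

lemma bridgeless_union:
  assumes "bridgeless g" "bridgeless h" shows "bridgeless U"
  unfolding bridgeless_def
proof
  fix x assume "x \<in> internal U"
  then consider e where "x = Inl e" "e \<in> internal g" | d where "x = Inr d" "d \<in> internal h"
    unfolding internal_union by blast
  then show "(bdry U x, bdry U (invol U x)) \<in> joined (cut U x)"
  proof cases
    case 1
    then have e: "e \<in> hedges G" "invol g e \<in> hedges G"
      using wf_graphD(4)[OF gD(1)] gD(3) by (simp_all add: internal_def)
    interpret c: pair_union G v H b "cut g e" h
      by unfold_locales (use covering_subgraph_cut[OF g e(1)] h isolated in auto)
    have "(bdry G e, bdry G (invol g e)) \<in> joined (cut g e)"
      using bspec[OF assms(1)[unfolded bridgeless_def] 1(2)] gD(5)[OF e(1)] gD(5)[OF e(2)] by simp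
    then have "Inl (bdry G (invol g e)) \<in> joined (cut U x) `` {Inl (bdry G e)}"
      unfolding 1(1) cut_union_graph c.joined_union_Inl by simp
    then show ?thesis using 1(1) by simp
  next
    case 2
    then have d: "d \<in> hedges H" "invol h d \<in> hedges H" "invol h d \<noteq> d"
      using wf_graphD(4)[OF hD(1)] hD(3) by (simp_all add: internal_def)
    have dv: "bdry H d \<noteq> v" using isolated d by metis
    interpret c: pair_union G v H b g "cut h d"
      by unfold_locales (use covering_subgraph_cut[OF h d(1)] g isolated in auto)
    have "(bdry H d, bdry H (invol h d)) \<in> joined (cut h d)"
      using bspec[OF assms(2)[unfolded bridgeless_def] 2(2)] hD(5)[OF d(1)] hD(5)[OF d(2)] by simp
    then have "Inr (bdry H (invol h d)) \<in> joined (cut U x) `` {Inr (bdry H d)}"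
      unfolding 2(1) cut_union_graph c.joined_union_Inr[OF dv] by simp
    then show ?thesis using 2(1) dv isolated_bdry[OF d(1) dv] by simp
  qed
qed

text \<open>
  The legs of a component of \<open>g\<close> are of two kinds in the union: half-edges of internal edges of \<open>G\<close>
  that are cut in \<open>g\<close>, and external edges of \<open>G\<close>, now represented by the half-edges at \<open>v\<close>.
\<close>

lemma leg_type_union_Inl:
  assumes C: "C \<subseteq> verts G" and l: "l (Inl ` C) = i C"
  shows "leg_type U l (Inl ` C) = leg_type g i C"
proof -
  have "{x \<in> external U. bdry K x \<in> Inl ` C}
      = {x \<in> Inl ` (internal G \<inter> external g) \<union> Inr ` hedges H. bdry K x \<in> Inl ` C}"
    unfolding external_union using isolated hD(3) by (auto simp: external_def split: if_splits)
  moreover have "{e \<in> external g. bdry g e \<in> C} = {e \<in> external g. bdry G e \<in> C}"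
    using gD(3,5) by (auto simp: external_def)
  moreover have "bij_betw (glued G b) {e \<in> external g. bdry G e \<in> C}
      {x \<in> Inl ` (internal G \<inter> external g) \<union> Inr ` hedges H. bdry K x \<in> Inl ` C}"
    using external_covering[OF G g] C by (intro glued_bij)
  ultimately have bij: "bij_betw (glued G b) {e \<in> external g. bdry g e \<in> C}
      {x \<in> external U. bdry U x \<in> Inl ` C}" by simp
  have "image_mset (htype U) (mset_set {x \<in> external U. bdry U x \<in> Inl ` C})
      = image_mset (htype g) (mset_set {e \<in> external g. bdry g e \<in> C})"
  proof (rule image_mset_reindex[OF bij])
    fix e assume "e \<in> {e \<in> external g. bdry g e \<in> C}"
    then have "e \<in> hedges G" using gD(3) by (simp add: external_def)
    then show "htype U (glued G b e) = htype g e"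
      using glued_htype gD(6) by simp
  qed
  then show ?thesis using l by (simp add: leg_type_def)
qed

lemma leg_type_union_Inr:
  assumes C: "v \<notin> C" and l: "l (Inr ` C) = j C"
  shows "leg_type U l (Inr ` C) = leg_type h j C"
proof -
  have "bdry K (Inr d) \<in> Inr ` C \<longleftrightarrow> bdry h d \<in> C" if "d \<in> external h" for d
    using that C hD(3,5) by (auto simp: external_def)
  then have "{x \<in> external U. bdry U x \<in> Inr ` C} = Inr ` {d \<in> external h. bdry h d \<in> C}"
    unfolding external_union by (auto simp del: insert_graph_simps(4))
  then have "bij_betw Inr {d \<in> external h. bdry h d \<in> C} {x \<in> external U. bdry U x \<in> Inr ` C}"
    by (simp add: bij_betw_def)
  then have "image_mset (htype U) (mset_set {x \<in> external U. bdry U x \<in> Inr ` C})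
      = image_mset (htype h) (mset_set {d \<in> external h. bdry h d \<in> C})"
    by (rule image_mset_reindex) (use hD(3,6) in \<open>simp add: external_def\<close>)
  then show ?thesis using l by (simp add: leg_type_def)
qed

lemma core_union: "core U = Inl ` core g \<union> Inr ` core h"
proof -
  have Inl: "Inl u \<in> core U \<longleftrightarrow> u \<in> core g" if u: "u \<in> verts g" for u
  proof -
    have mem: "(Inl u, z) \<in> joined U \<longleftrightarrow> z \<in> Inl ` (joined g `` {u})" for z
      unfolding joined_union_Inl[symmetric] by simp
    have 1: "(Inl u, bdry U (Inl e)) \<in> joined U \<longleftrightarrow> (u, bdry g e) \<in> joined g"
      if "e \<in> internal g" for e
      unfolding mem using that gD(3,5) by (auto simp: internal_def)
    have 2: "(Inl u, bdry U (Inr d)) \<notin> joined U" if d: "d \<in> internal h" for d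
    proof -
      have "bdry H d \<noteq> v" using d isolated hD(3) by (auto simp: internal_def)
      then show ?thesis unfolding mem by auto
    qed
    have "Inl u \<in> verts U" using u gD(2) by simp
    then have "Inl u \<in> core U \<longleftrightarrow>
        (\<exists>e\<in>internal g. (Inl u, bdry U (Inl e)) \<in> joined U) \<or>
        (\<exists>d\<in>internal h. (Inl u, bdry U (Inr d)) \<in> joined U)"
      unfolding core_def internal_union by blast
    also have "\<dots> \<longleftrightarrow> u \<in> core g" using 1 2 u by (simp add: core_def)
    finally show ?thesis .
  qed
  have Inr: "Inr w \<in> core U \<longleftrightarrow> w \<in> core h" if w: "w \<in> verts h" "w \<noteq> v" for w
  proof -
    have mem: "(Inr w, z) \<in> joined U \<longleftrightarrow> z \<in> Inr ` (joined h `` {w})" for z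
      unfolding joined_union_Inr[OF w(2), symmetric] by simp
    have 1: "(Inr w, bdry U (Inr d)) \<in> joined U \<longleftrightarrow> (w, bdry h d) \<in> joined h"
      if d: "d \<in> internal h" for d
    proof -
      have "bdry H d \<noteq> v" "bdry h d = bdry H d"
        using d isolated hD(3,5) by (auto simp: internal_def)
      then show ?thesis unfolding mem by auto
    qed
    have 2: "(Inr w, bdry U (Inl e)) \<notin> joined U" for e unfolding mem by auto
    have "Inr w \<in> verts U" using w hD(2) by simp
    then have "Inr w \<in> core U \<longleftrightarrow>
        (\<exists>e\<in>internal g. (Inr w, bdry U (Inl e)) \<in> joined U) \<or>
        (\<exists>d\<in>internal h. (Inr w, bdry U (Inr d)) \<in> joined U)"
      unfolding core_def internal_union by blast
    also have "\<dots> \<longleftrightarrow> w \<in> core h" using 1 2 w by (simp add: core_def)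
    finally show ?thesis .
  qed
  have v': "v \<notin> core h"
  proof
    assume "v \<in> core h"
    then obtain d where d: "d \<in> internal h" "(v, bdry h d) \<in> joined h" by (auto simp: core_def)
    then have "bdry h d = v" using trivial_class by blast
    then show False using d(1) isolated[of d] hD(3,5) by (auto simp: internal_def)
  qed
  have "x \<in> core U \<longleftrightarrow> x \<in> Inl ` core g \<union> Inr ` core h" for x
  proof (cases x)
    case (Inl u)
    then have "x \<in> core U \<longleftrightarrow> u \<in> core g"
      using \<open>\<And>u. u \<in> verts g \<Longrightarrow> Inl u \<in> core U \<longleftrightarrow> u \<in> core g\<close>[of u] gD(2) by (auto simp: core_def)
    then show ?thesis using Inl by auto
  next
    case (Inr w)
    then have "x \<in> core U \<longleftrightarrow> w \<in> core h"
      using \<open>\<And>w. w \<in> verts h \<Longrightarrow> w \<noteq> v \<Longrightarrow> Inr w \<in> core U \<longleftrightarrow> w \<in> core h\<close>[of w] hD(2) v'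
      by (auto simp: core_def)
    then show ?thesis using Inr by auto
  qed
  then show ?thesis by blast
qed

lemma specified_union:
  assumes gs: "specified_graph T (g, i)" and hs: "specified_graph T (h, j)"
    and l1: "\<And>C. C \<in> pi0 g \<Longrightarrow> l (Inl ` C) = i C"
    and l2: "\<And>C. C \<in> pi0 h \<Longrightarrow> C \<noteq> {v} \<Longrightarrow> l (Inr ` C) = j C"
  shows "specified_graph T (U, l)"
  unfolding specified_graph_iff
proof (intro conjI ballI)
  note sg = gs[unfolded specified_graph_iff] and sh = hs[unfolded specified_graph_iff]
  show "wf_graph U" by (rule wf_union)
  show "bridgeless U" using bridgeless_union sg sh by simp
  show "htype U x \<in> htypes T" if "x \<in> hedges U" for x
    using that sg sh gD(3,6) hD(3,6) by (auto simp: internal_def)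
  show "vtype U x \<in> vtypes T" if "x \<in> verts U" for x
  proof -
    have same: "vtype U x = vtype K x" by (simp add: vtype_def star_def)
    note vg = vtype_covering[OF g] and vh = vtype_covering[OF h]
    show ?thesis
    proof (cases x)
      case (Inl u)
      then have "u \<in> verts G" using that by auto
      then show ?thesis using same Inl vtype_insert_Inl vg sg gD(2) by simp
    next
      case (Inr w)
      then have "w \<in> verts H" "w \<noteq> v" using that by auto
      then show ?thesis using same Inr vtype_insert_Inr vh sh hD(2) by simp
    qed
  qed
  show "leg_type U l C \<in> vtypes T" if C: "C \<in> pi0 U" for C
  proof -
    consider D where "D \<in> pi0 g" "C = Inl ` D" | D where "D \<in> pi0 h" "D \<noteq> {v}" "C = Inr ` D"
      using C unfolding pi0_union by auto
    then show ?thesis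
    proof cases
      case 1
      then show ?thesis
        using leg_type_union_Inl[of D l i] l1 sg pi0_subset[OF 1(1)] gD(2) by simp
    next
      case 2
      then show ?thesis
        using leg_type_union_Inr[of D l j] l2 sh pi0_h(2) by simp
    qed
  qed
qed

end


section \<open>The operations preserve pairs\<close>

lemma covering_insertion:
  assumes "connected_insertion G v H b" "covering_subgraph h H"
  shows "connected_insertion G v h b"
proof -
  interpret connected_insertion G v H b by (rule assms(1))
  note c = covering_subgraphD[OF assms(2)]
  interpret s: insertion G v h b
    by (rule insertion_cong[OF insertion_axioms c(1-3)]) (use c(5,6) in simp)
  show ?thesis by unfold_locales (rule conn)
qed

lemma specified_pairD:
  assumes "specified_pair T ((G, i), (g, j))"
  shows "wf_graph G" "connected_graph G" "specified_graph T (G, i)"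
    and "covering_subgraph g G" "specified_graph T (g, j)"
    and "\<And>C. C \<in> pi0 g \<Longrightarrow> C \<in> pi0 G \<Longrightarrow>
      (\<And>e. e \<in> hedges G \<Longrightarrow> bdry G e \<in> C \<Longrightarrow> invol g e = invol G e) \<Longrightarrow> j C = i C"
    and "\<And>v. v \<in> verts G - core g \<Longrightarrow> j {v} = vindex G v"
    and "wf_graph (contract G g j)" "connected_graph (contract G g j)"
    and "specified_graph T (contract G g j, \<lambda>D. i (\<Union> D))"
  using assms by (auto simp: connected_specified_graph_def)

lemma contract_simps [simp]:
  "verts (contract G g j) = pi0 g" "hedges (contract G g j) = external g"
  "bdry (contract G g j) e = joined g `` {bdry g e}" "invol (contract G g j) = invol G"
  "htype (contract G g j) = htype G" "vindex (contract G g j) = j"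
  by (simp_all add: contract_def)

text \<open>
  Inserting a connected graph inside a nontrivial component of the subgraph only enlarges that
  component, so the contracted graph does not change.
\<close>

lemma contract_insert_iso:
  assumes K: "connected_insertion G v H b" and h: "covering_subgraph h H"
  defines "proj \<equiv> case_sum (\<lambda>_. v) (\<lambda>w. w)"
  shows "graph_iso (\<lambda>D. {x \<in> verts (insert_graph G v H b). proj x \<in> D}) Inr
    (contract H h j) (contract (insert_graph G v H b) (insert_graph G v h b) (\<lambda>C. j (proj ` C)))"
proof -
  interpret a: connected_insertion G v H b by (rule K)
  interpret s: connected_insertion G v h b by (rule covering_insertion[OF K h])
  note c = covering_subgraphD[OF h]
  let ?p = "\<lambda>D. {x \<in> verts a.K. proj x \<in> D}"
  have verts_eq: "verts s.K = verts a.K" using c(2) by simp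
  have p_proj: "?p (proj ` C) = C" if "C \<in> pi0 s.K" for C
    unfolding proj_def verts_eq[symmetric] by (rule s.pi0_insert_proj(2)[OF that, symmetric])
  have lift: "\<exists>C\<in>pi0 s.K. D = proj ` C" if "D \<in> pi0 h" for D
    using that unfolding s.pi0_insert proj_def by (rule imageE) (rule bexI)
  have proj_p: "proj ` ?p D = D" if D: "D \<in> pi0 h" for D
  proof -
    obtain C where C: "C \<in> pi0 s.K" "D = proj ` C"
      using lift[OF D] by (rule bexE)
    then show ?thesis using p_proj[OF C(1)] by simp
  qed
  have p_pi0: "?p D \<in> pi0 s.K" if D: "D \<in> pi0 h" for D
  proof -
    obtain C where C: "C \<in> pi0 s.K" "D = proj ` C"
      using lift[OF D] by (rule bexE)
    then show ?thesis using p_proj[OF C(1)] by simp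
  qed
  have "bij_betw ?p (pi0 h) (pi0 s.K)"
  proof (rule bij_betwI[where g = "image proj"])
    show "?p \<in> pi0 h \<rightarrow> pi0 s.K" using p_pi0 by (rule funcsetI)
    show "image proj \<in> pi0 s.K \<rightarrow> pi0 h"
      using s.pi0_insert_proj(1) unfolding proj_def by (rule funcsetI)
    show "proj ` ?p D = D" if "D \<in> pi0 h" for D using that by (rule proj_p)
    show "?p (proj ` C) = C" if "C \<in> pi0 s.K" for C using that by (rule p_proj)
  qed
  moreover have "bij_betw Inr (external h) (external s.K)"
    unfolding s.external_insert by (simp add: bij_betw_def)
  moreover have "joined s.K `` {bdry s.K (Inr d)} = ?p (joined h `` {bdry h d})"
    if "d \<in> external h" for d
  proof (rule pi0_class[OF s.wf_insert, symmetric])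
    have d: "d \<in> hedges h" using that by (simp add: external_def)
    then have D: "joined h `` {bdry h d} \<in> pi0 h"
      by (intro pi0I wf_graphD(3)[OF c(1)])
    then show "?p (joined h `` {bdry h d}) \<in> pi0 s.K" by (rule p_pi0)
    have "bdry s.K (Inr d) \<in> verts s.K" using d by (intro wf_graphD(3)[OF s.wf_insert]) simp
    moreover have "proj (bdry s.K (Inr d)) = bdry h d" unfolding proj_def by (rule s.proj_bdry)
    moreover have "bdry h d \<in> joined h `` {bdry h d}"
      using joined_refl[OF wf_graphD(3)[OF c(1) d]] by simp
    ultimately show "bdry s.K (Inr d) \<in> ?p (joined h `` {bdry h d})" unfolding verts_eq by simp
  qed
  ultimately show ?thesis
    unfolding graph_iso_def contract_def using proj_p by simp
qed

text \<open>
  The conditions on components shared by the subgraph and the ambient graph are pulled back along the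
  projection that collapses the inserted graph to \<open>v\<close>.
\<close>

lemma specified_pair_ins:
  assumes \<Gamma>: "connected_specified_graph T (G, i)" and P: "specified_pair T ((H, j), (h, j'))"
    and v: "v \<in> core h" and b: "b \<in> gluings G v H"
  shows "specified_pair T (insert_specified (G, i) v (H, j) b, insert_specified (G, i) v (h, j') b)"
proof -
  note p = specified_pairD[OF P]
  have sG: "specified_graph T (G, i)" "wf_graph G" "connected_graph G"
    using \<Gamma> by (simp_all add: connected_specified_graph_def)
  note c = covering_subgraphD[OF p(4)]
  have vH: "v \<in> verts H" using v c(2) by (auto simp: core_def)
  interpret a: connected_insertion G v H b
    using sG p(1) vH b by unfold_locales simp_all
  interpret s: connected_insertion G v h b
    by (rule covering_insertion[OF a.connected_insertion_axioms p(4)])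
  let ?j = "\<lambda>C. j (a.proj ` C)" and ?j' = "\<lambda>C. j' (a.proj ` C)"
  have ambient: "connected_specified_graph T (a.K, ?j)"
    using a.specified_insert[OF sG(1) p(3)] a.connected_insert[OF p(2)]
    by (simp add: connected_specified_graph_def)
  have verts_eq: "verts s.K = verts a.K" using c(2) by simp
  have "covering_subgraph s.K a.K"
    unfolding covering_subgraph_def
  proof (intro conjI ballI)
    show "wf_graph s.K" by (rule s.wf_insert)
    show "verts s.K = verts a.K" "hedges s.K = hedges a.K" using c(2,3) by simp_all
    show "vindex s.K x = vindex a.K x" if "x \<in> verts a.K" for x using that c(4) by auto
    fix x assume x: "x \<in> hedges a.K"
    have "d \<in> hedges H" if "x = Inr d" for d using x that by auto
    then show "bdry s.K x = bdry a.K x" "htype s.K x = htype a.K x"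
      using c(5,6) by (cases x; simp)+
    show "invol s.K x = x \<or> invol s.K x = invol a.K x"
    proof (cases x)
      case (Inr d)
      then have "d \<in> hedges H" using x by auto
      then show ?thesis using c(7)[of d] Inr by auto
    qed simp
  qed
  moreover have "specified_graph T (s.K, ?j')" by (rule s.specified_insert[OF sG(1) p(5)])
  moreover have "?j' C = ?j C"
    if C: "C \<in> pi0 s.K" "C \<in> pi0 a.K"
      and uncut: "\<forall>x\<in>hedges a.K. bdry a.K x \<in> C \<longrightarrow> invol s.K x = invol a.K x" for C
  proof (rule p(6))
    show "a.proj ` C \<in> pi0 h" "a.proj ` C \<in> pi0 H"
      using s.pi0_insert_proj(1)[OF C(1)] a.pi0_insert_proj(1)[OF C(2)] .
    fix d assume d: "d \<in> hedges H" "bdry H d \<in> a.proj ` C"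
    have "bdry a.K (Inr d) \<in> verts a.K" using d(1) by (intro wf_graphD(3)[OF a.wf_insert]) simp
    moreover have "a.proj (bdry a.K (Inr d)) \<in> a.proj ` C" unfolding a.proj_bdry by (rule d(2))
    ultimately have "bdry a.K (Inr d) \<in> C" using a.pi0_insert_proj(2)[OF C(2)] by blast
    moreover have "Inr d \<in> hedges a.K" using d(1) by simp
    ultimately have "invol s.K (Inr d) = invol a.K (Inr d)" using uncut by blast
    then show "invol h d = invol H d" by simp
  qed
  ultimately have sub: "specified_covering_subgraph T (s.K, ?j') (a.K, ?j)"
    unfolding specified_covering_subgraph.simps by blast
  have trivial: "?j' {x} = vindex a.K x" if x: "x \<in> verts a.K - core s.K" for x
  proof -
    have "x \<in> verts s.K" "x \<notin> core s.K" unfolding verts_eq using x by blast+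
    then have pc: "a.proj x \<notin> core h" using s.core_insert[OF v] by blast
    then obtain w where w: "x = Inr w" using v by (cases x) auto
    then show ?thesis using pc x p(7)[of w] by auto
  qed
  have "sgraph_iso (\<lambda>D. {x \<in> verts a.K. a.proj x \<in> D}) Inr
      (contract_specified (H, j) (h, j')) (contract_specified (a.K, ?j) (s.K, ?j'))"
    by (rule contract_specified_iso[OF p(9)
          contract_insert_iso[OF a.connected_insertion_axioms p(4)] p(8) c(2) verts_eq])
       (simp only: a.proj_onto)
  then have "connected_specified_graph T (contract_specified (a.K, ?j) (s.K, ?j'))"
    unfolding contract_specified.simps
    by (rule connected_specified_graph_iso[rotated])
       (use p(9,10) in \<open>simp add: connected_specified_graph_def\<close>)
  then show ?thesis
    using ambient sub trivial by simp
qed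

text \<open>
  Contracting a disjoint union of subgraphs amounts to inserting the contraction of the one graph
  into the contraction of the other, at the trivial component \<open>{v}\<close>.
\<close>

lemma contract_union_iso:
  fixes G g :: "('v, 'e, 'h) fgraph" and H h :: "('w, 'd, 'h) fgraph"
  assumes "pair_union G v H b g h"
    and l1: "\<And>C. C \<in> pi0 g \<Longrightarrow> l (Inl ` C) = i C"
    and l2: "\<And>C. C \<in> pi0 h \<Longrightarrow> C \<noteq> {v} \<Longrightarrow> l (Inr ` C) = j C"
  shows "external (contract G g i) = external G"
    and "star (contract H h j) {v} = star H v"
    and "graph_iso (case_sum (image Inl) (image Inr)) id
      (insert_graph (contract G g i) {v} (contract H h j) b)
      (contract (insert_graph G v H b) (union_graph G v H b g h) l)"
proof -
  interpret pair_union G v H b g h by (rule assms(1))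
  show ext: "external (contract G g i) = external G"
    using external_covering[OF G g] gD(3) by (auto simp: contract_def external_def)
  have class_v: "joined h `` {bdry h d} = {v} \<longleftrightarrow> bdry H d = v" if d: "d \<in> external h" for d
  proof -
    have "d \<in> hedges H" using d hD(3) by (simp add: external_def)
    then have "bdry h d = bdry H d" "bdry h d \<in> joined h `` {bdry h d}"
      using hD joined_refl[OF wf_graphD(3)[OF hD(1), of d]] by simp_all
    then show ?thesis using trivial_class by auto
  qed
  show "star (contract H h j) {v} = star H v"
    using class_v isolated hD(3) by (auto simp: contract_def star_def external_def)
  have int: "internal (contract G g i) = internal G \<inter> external g"
    using gD(3) by (auto simp: contract_def internal_def external_def)
  let ?p = "case_sum (image Inl) (image Inr) :: 'v set + 'w set \<Rightarrow> ('v + 'w) set"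
  let ?X = "Inl ` pi0 g \<union> Inr ` (pi0 h - {{v}}) :: ('v set + 'w set) set"
  have "?p ` ?X = pi0 U"
    unfolding pi0_union image_Un image_image by simp
  moreover have "inj_on ?p ?X"
  proof (rule inj_onI)
    fix x y assume xy: "x \<in> ?X" "y \<in> ?X" "?p x = ?p y"
    show "x = y"
    proof (cases x; cases y)
      fix C D assume "x = Inl C" "y = Inl D"
      then show ?thesis using xy by (simp add: inj_image_eq_iff)
    next
      fix C D assume "x = Inr C" "y = Inr D"
      then show ?thesis using xy by (simp add: inj_image_eq_iff)
    next
      fix C D assume *: "x = Inl C" "y = Inr D"
      then have "C \<noteq> {}" using xy(1) pi0_nonempty[of C g] by auto
      then show ?thesis using xy(3) * by auto
    next
      fix C D assume *: "x = Inr C" "y = Inl D"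
      then have "D \<noteq> {}" using xy(2) pi0_nonempty[of D g] by auto
      then show ?thesis using xy(3) * by auto
    qed
  qed
  ultimately have bij: "bij_betw ?p ?X (pi0 U)" by (simp add: bij_betw_def)
  have hedges: "Inl ` internal (contract G g i) \<union> Inr ` external h = external U"
    unfolding int external_union by simp
  have index: "l (?p x) = case_sum i j x" if "x \<in> ?X" for x
    using that by (elim UnE imageE) (simp_all add: l1 l2)
  have bdry_Inl: "joined U `` {bdry U (Inl e)} = Inl ` (joined g `` {bdry g e})"
    if "e \<in> internal G \<inter> external g" for e
    using that gD(3,5) joined_union_Inl by (simp add: external_def)
  have bdry_Inr: "joined U `` {bdry U (Inr d)} =
      (if joined h `` {bdry h d} = {v}
       then Inl ` (joined g `` {bdry g (inv_into (external G) b d)})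
       else Inr ` (joined h `` {bdry h d}))"
    if d: "d \<in> external h" for d
  proof -
    have dH: "d \<in> hedges H" using d hD(3) by (simp add: external_def)
    show ?thesis
    proof (cases "bdry H d = v")
      case True
      have "inv_into (external G) b d \<in> hedges G"
        using b_inv(1)[OF dH True] by (simp add: external_def)
      then show ?thesis using True class_v[OF d] joined_union_Inl gD(5) by simp
    next
      case False
      then show ?thesis using class_v[OF d] joined_union_Inr[OF False] hD(5)[OF dH] by simp
    qed
  qed
  show "graph_iso ?p id
      (insert_graph (contract G g i) {v} (contract H h j) b) (contract K U l)"
    unfolding graph_iso_def
  proof (intro conjI ballI)
    fix x assume "x \<in> hedges (insert_graph (contract G g i) {v} (contract H h j) b)"
    then consider e where "x = Inl e" "e \<in> internal G \<inter> external g" | d where "x = Inr d" "d \<in> external h"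
      unfolding insert_graph_simps int contract_simps by blast
    then show "bdry (contract K U l) (id x) =
        ?p (bdry (insert_graph (contract G g i) {v} (contract H h j) b) x)"
    proof cases
      case 1 then show ?thesis using bdry_Inl[OF 1(2)] by simp
    next
      case 2 then show ?thesis using bdry_Inr[OF 2(2)] ext by simp
    qed
  qed (use bij hedges index in simp_all)
qed

text \<open>
  If \<open>H\<close> is the single vertex \<open>v\<close> without internal edges, the new ambient graph is a copy of \<open>G\<close> whose
  specification comes from \<open>H\<close>. The type condition at \<open>v\<close> makes it agree with that of \<open>G\<close>, hence with
  that of \<open>g\<close> in case \<open>g\<close> is all of \<open>G\<close>.
\<close>

lemma specified_pair_odot:
  fixes G g :: "('v, 'e, 'h) fgraph" and H h :: "('w, 'd, 'h) fgraph"
  assumes P: "specified_pair T ((G, i), (g, i'))" and Q: "specified_pair T ((H, j), (h, j'))"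
    and v: "v \<in> verts H - core h" and type: "vtype H v = res_type (G, i)"
    and b: "b \<in> gluings G v H"
  shows "specified_pair T (insert_specified (G, i) v (H, j) b,
    union_specified ((G, i), (g, i')) v ((H, j), (h, j')) b)"
proof -
  note p = specified_pairD[OF P] and q = specified_pairD[OF Q]
  note c = covering_subgraphD[OF q(4)] and d = covering_subgraphD[OF p(4)]
  interpret a: connected_insertion G v H b
    using p(1,2) q(1) v b by unfold_locales simp_all
  interpret u: pair_union G v H b g h
    by unfold_locales (use p(4) q(4) not_core_isolated[OF q(4) v] in auto)
  define l where "l C = (if C \<subseteq> range Inl then i' (Inl -` C) else j' (Inr -` C))" for C :: "('v + 'w) set"
  let ?j = "\<lambda>C. j (a.proj ` C)"
  have l1: "l (Inl ` C) = i' C" for C by (auto simp: l_def inj_vimage_image_eq)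
  have l2: "l (Inr ` C) = j' C" if "C \<noteq> {}" for C
    using that by (auto simp: l_def inj_vimage_image_eq)
  have l2': "l (Inr ` C) = j' C" if "C \<in> pi0 h" for C
    using l2 pi0_nonempty[OF that] by simp
  have ambient: "connected_specified_graph T (a.K, ?j)"
    using a.specified_insert[OF p(3) q(3)] a.connected_insert[OF q(2)]
    by (simp add: connected_specified_graph_def)
  have su: "specified_graph T (u.U, l)"
    by (rule u.specified_union[OF p(5) q(5) l1 l2'])
  have index: "i (verts G) = vindex H v"
    using type res_type_connected[OF p(1,2), of i] by (simp add: vtype_def)
  (* The ambient graph is connected and has vertices of G, so a component shared with the union
     and having no cut edge forces H to be the single vertex v without internal edges, and g = G.
     Then all four specifications are equal to the index of v. *)
  have "l C = ?j C"
    if C: "C \<in> pi0 u.U" "C \<in> pi0 a.K"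
      and uncut: "\<forall>x\<in>hedges a.K. bdry a.K x \<in> C \<longrightarrow> invol u.U x = invol a.K x" for C
  proof -
    have CK: "C = verts a.K" using C(2) pi0_connected[OF a.connected_insert[OF q(2)]] by simp
    have uncut': "invol u.U x = invol a.K x" if "x \<in> hedges a.K" for x
      using uncut that wf_graphD(3)[OF a.wf_insert that] unfolding CK by blast
    obtain z where z: "z \<in> verts G" using p(2) connected_graph_iff[OF p(1)] by blast
    have "C \<notin> image Inr ` (pi0 h - {{v}})" using CK z by auto
    then obtain D where D: "D \<in> pi0 g" "C = Inl ` D" using C(1) unfolding u.pi0_union by auto
    have DG: "D = verts G"
    proof -
      have "Inl ` verts G \<subseteq> Inl ` D" using D(2) CK by auto
      then show ?thesis using pi0_subset[OF D(1)] d(2) by auto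
    qed
    have Hv: "verts H = {v}"
    proof -
      have "w = v" if w: "w \<in> verts H" for w
      proof (rule ccontr)
        assume "w \<noteq> v"
        then have "Inr w \<in> C" using CK w by simp
        then show False using D(2) by auto
      qed
      then show ?thesis using v by auto
    qed
    have "i' D = i D"
    proof (rule p(6)[OF D(1)])
      show "D \<in> pi0 G" using DG pi0_connected[OF p(2)] by simp
      fix e assume e: "e \<in> hedges G" "bdry G e \<in> D"
      show "invol g e = invol G e"
      proof (cases "invol G e = e")
        case True then show ?thesis using d(7)[OF e(1)] by auto
      next
        case False
        then have "Inl e \<in> hedges a.K" using e by (simp add: internal_def)
        then show ?thesis using uncut'[of "Inl e"] by simp
      qed
    qed
    moreover have "j' {v} = j {v}"
    proof (rule q(6)[OF u.pi0_h(1)])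
      show "{v} \<in> pi0 H" using Hv pi0_connected[OF q(2)] by simp
      fix e assume "e \<in> hedges H" "bdry H e \<in> {v}"
      then show "invol h e = invol H e" using uncut'[of "Inr e"] by simp
    qed
    moreover have "a.proj ` C = {v}" unfolding CK a.proj_onto by (rule Hv)
    ultimately show ?thesis using D(2) l1 DG index q(7)[OF v] by simp
  qed
  then have sub: "specified_covering_subgraph T (u.U, l) (a.K, ?j)"
    unfolding specified_covering_subgraph.simps using u.covering_union su by blast
  have trivial: "l {x} = vindex a.K x" if x: "x \<in> verts a.K - core u.U" for x
  proof (cases x)
    case (Inl w)
    then have "w \<in> verts G - core g" using x unfolding u.core_union by auto
    then show ?thesis using l1[of "{w}"] p(7)[of w] Inl by simp
  next
    case (Inr w)
    then have "w \<in> verts H - core h" using x unfolding u.core_union by auto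
    then show ?thesis using l2[of "{w}"] q(7)[of w] Inr by simp
  qed
  let ?G = "contract G g i'" and ?H = "contract H h j'"
  have "pair_union G v H b g h" by (rule u.pair_union_axioms)
  note cu = contract_union_iso[OF this, of l i' j', OF l1 l2']
  interpret r: connected_insertion ?G "{v}" ?H b
  proof
    show "wf_graph ?G" "wf_graph ?H" "connected_graph ?G" by (fact p(8,9) q(8))+
    show "{v} \<in> verts ?H" using u.pi0_h(1) by (simp add: contract_def)
    have "gluings ?G {v} ?H = gluings G v H"
      using cu(1,2) by (intro gluings_cong) (simp_all add: contract_def)
    then show "b \<in> gluings ?G {v} ?H" using b by simp
  qed
  have cr: "connected_graph r.K" by (rule r.connected_insert[OF q(9)])
  have "specified_graph T (r.K, \<lambda>C. j (\<Union> (r.proj ` C)))"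
    using r.specified_insert[OF p(10) q(10)] .
  then have spec: "connected_specified_graph T (r.K, \<lambda>C. j (\<Union> (r.proj ` C)))"
    using cr by (simp add: connected_specified_graph_def)
  have "sgraph_iso (case_sum (image Inl) (image Inr)) id (r.K, \<lambda>C. j (\<Union> (r.proj ` C)))
      (contract a.K u.U l, \<lambda>D. ?j (\<Union> D))"
  proof -
    interpret g: graph_isomorphism "case_sum (image Inl) (image Inr)" id r.K "contract a.K u.U l"
      by unfold_locales (rule r.wf_insert, rule cu(3))
    have "r.proj ` verts r.K = pi0 h" unfolding r.proj_onto by (simp add: contract_def)
    moreover have "case_sum (image Inl) (image Inr) ` verts r.K = pi0 u.U"
      unfolding g.images(1) by (simp add: contract_def)
    moreover have "\<Union> (pi0 h) = verts H" "\<Union> (pi0 u.U) = verts a.K"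
      unfolding Union_pi0 using c(2) by simp_all
    ultimately show ?thesis
      using g.iso a.proj_onto unfolding sgraph_iso.simps pi0_connected[OF cr] by simp
  qed
  with spec have "connected_specified_graph T (contract_specified (a.K, ?j) (u.U, l))"
    unfolding contract_specified.simps by (rule connected_specified_graph_iso)
  then show ?thesis
    using ambient sub trivial by (simp add: l_def[abs_def] union_graph_def)
qed


section \<open>The operations on generators respect isomorphisms\<close>

lemma gluings_iff:
  "b \<in> gluings G v H \<longleftrightarrow> b \<in> extensional (external G) \<and> bij_betw b (external G) (star H v) \<and>
     (\<forall>e\<in>external G. htype H (b e) = htype G e)"
  by (auto simp: gluings_def PiE_iff dest: bij_betw_apply)

text \<open>
  Sums over gluings are compared along bijections of the external edges on the one side and of the
  star on the other. This covers isomorphisms as well as the exchange of two insertions.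
\<close>

lemma sum_gluings_reindex:
  assumes psi: "bij_betw \<psi> (external G) (external G')"
    and phi: "bij_betw \<phi> (star H v) (star H' v')"
    and psi_type: "\<And>e. e \<in> external G \<Longrightarrow> htype G' (\<psi> e) = htype G e"
    and phi_type: "\<And>d. d \<in> star H v \<Longrightarrow> htype H' (\<phi> d) = htype H d"
    and F: "\<And>b b'. b \<in> gluings G v H \<Longrightarrow> b' \<in> gluings G' v' H' \<Longrightarrow>
      (\<And>e. e \<in> external G \<Longrightarrow> b' (\<psi> e) = \<phi> (b e)) \<Longrightarrow> F b = F' b'"
  shows "sum F (gluings G v H) = sum F' (gluings G' v' H')"
proof -
  let ?psi = "inv_into (external G) \<psi>" and ?phi = "inv_into (star H v) \<phi>"
  define fwd where "fwd b = (\<lambda>e'\<in>external G'. \<phi> (b (?psi e')))" for b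
  define bwd where "bwd b' = (\<lambda>e\<in>external G. ?phi (b' (\<psi> e)))" for b'
  have psi': "bij_betw ?psi (external G') (external G)"
    and phi': "bij_betw ?phi (star H' v') (star H v)"
    using psi phi by (simp_all add: bij_betw_inv_into)
  have fwd: "fwd b \<in> gluings G' v' H'" if "b \<in> gluings G v H" for b
  proof -
    have b: "bij_betw b (external G) (star H v)" "\<And>e. e \<in> external G \<Longrightarrow> htype H (b e) = htype G e"
      using that by (simp_all add: gluings_def)
    have "bij_betw (fwd b) (external G') (star H' v')"
      using bij_betw_trans[OF bij_betw_trans[OF psi' b(1)] phi]
      by (subst bij_betw_cong[of _ _ "\<phi> \<circ> (b \<circ> ?psi)"]) (simp_all add: fwd_def)
    moreover have "htype H' (fwd b e') = htype G' e'" if e': "e' \<in> external G'" for e'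
    proof -
      have e: "?psi e' \<in> external G" "\<psi> (?psi e') = e'"
        using bij_betw_apply[OF psi' e'] bij_betw_inv_into_right[OF psi e'] .
      have "htype H' (fwd b e') = htype G (?psi e')"
        using e' phi_type[OF bij_betw_apply[OF b(1) e(1)]] b(2)[OF e(1)] by (simp add: fwd_def)
      then show ?thesis using psi_type[OF e(1)] e(2) by simp
    qed
    ultimately show ?thesis
      unfolding gluings_iff by (simp add: fwd_def)
  qed
  have bwd: "bwd b' \<in> gluings G v H" if "b' \<in> gluings G' v' H'" for b'
  proof -
    have b': "bij_betw b' (external G') (star H' v')"
      "\<And>e. e \<in> external G' \<Longrightarrow> htype H' (b' e) = htype G' e"
      using that by (simp_all add: gluings_def)
    have "bij_betw (bwd b') (external G) (star H v)"
      using bij_betw_trans[OF bij_betw_trans[OF psi b'(1)] phi']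
      by (subst bij_betw_cong[of _ _ "?phi \<circ> (b' \<circ> \<psi>)"]) (simp_all add: bwd_def)
    moreover have "htype H (bwd b' e) = htype G e" if e: "e \<in> external G" for e
    proof -
      have e': "\<psi> e \<in> external G'" using bij_betw_apply[OF psi e] .
      note d = bij_betw_apply[OF b'(1) e']
      have "htype H (?phi (b' (\<psi> e))) = htype H' (b' (\<psi> e))"
        using phi_type[OF bij_betw_apply[OF phi' d]] bij_betw_inv_into_right[OF phi d] by simp
      then show ?thesis using b'(2)[OF e'] psi_type[OF e] e by (simp add: bwd_def)
    qed
    ultimately show ?thesis
      unfolding gluings_iff by (simp add: bwd_def)
  qed
  have fwd_eq: "fwd b (\<psi> e) = \<phi> (b e)" if "e \<in> external G" for b e
    using bij_betw_apply[OF psi that] bij_betw_inv_into_left[OF psi that] by (simp add: fwd_def)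
  show ?thesis
  proof (rule sum.reindex_bij_witness[where i = bwd and j = fwd])
    fix b assume b: "b \<in> gluings G v H"
    then have ext: "b \<in> extensional (external G)" and "bij_betw b (external G) (star H v)"
      by (simp_all add: gluings_iff)
    then have "bwd (fwd b) e = b e" if "e \<in> external G" for e
      using that fwd_eq[OF that, of b] bij_betw_inv_into_left[OF phi] bij_betw_apply
      by (fastforce simp: bwd_def)
    then show "bwd (fwd b) = b"
      by (intro extensionalityI[OF _ ext]) (simp_all add: bwd_def)
    show "fwd b \<in> gluings G' v' H'" by (rule fwd[OF b])
    show "F' (fwd b) = F b" using F[OF b fwd[OF b] fwd_eq] by simp
  next
    fix b' assume b': "b' \<in> gluings G' v' H'"
    then have ext: "b' \<in> extensional (external G')" and bij: "bij_betw b' (external G') (star H' v')"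
      by (simp_all add: gluings_iff)
    have "fwd (bwd b') e' = b' e'" if e': "e' \<in> external G'" for e'
    proof -
      have "?psi e' \<in> external G" "\<psi> (?psi e') = e'"
        using bij_betw_apply[OF psi' e'] bij_betw_inv_into_right[OF psi e'] .
      then show ?thesis
        using e' bij_betw_inv_into_right[OF phi bij_betw_apply[OF bij e']]
        by (simp add: fwd_def bwd_def)
    qed
    then show "fwd (bwd b') = b'"
      by (intro extensionalityI[OF _ ext]) (simp_all add: fwd_def)
    show "bwd b' \<in> gluings G v H" by (rule bwd[OF b'])
  qed
qed

lemma bij_betw_map_sum:
  assumes "bij_betw p A A'" "bij_betw q B B'"
  shows "bij_betw (map_sum p q) (Inl ` A \<union> Inr ` B) (Inl ` A' \<union> Inr ` B')"
proof -
  have "map_sum p q ` (Inl ` A \<union> Inr ` B) = Inl ` p ` A \<union> Inr ` q ` B"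
    by (simp add: image_Un image_image)
  also have "\<dots> = Inl ` A' \<union> Inr ` B'" using assms by (simp add: bij_betw_def)
  finally have "map_sum p q ` (Inl ` A \<union> Inr ` B) = Inl ` A' \<union> Inr ` B'" .
  moreover have "inj_on (map_sum p q) (Inl ` A \<union> Inr ` B)"
    using bij_betw_imp_inj_on[OF assms(1)] bij_betw_imp_inj_on[OF assms(2)]
    by (auto intro!: inj_onI dest: inj_onD)
  ultimately show ?thesis by (simp add: bij_betw_def)
qed

lemma graph_iso_invol:
  assumes "graph_iso p q K K'" "\<And>x. x \<in> hedges K \<Longrightarrow> t' (q x) = q (t x)"
  shows "graph_iso p q (K\<lparr>invol := t\<rparr>) (K'\<lparr>invol := t'\<rparr>)"
  using assms by (simp add: graph_iso_def)

lemma graph_iso_insert: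
  assumes "insertion G v H b" "insertion G' (f2 v) H' b'"
    and "graph_iso f1 k1 G G'" "graph_iso f2 k2 H H'"
    and compat: "\<And>e. e \<in> external G \<Longrightarrow> b' (k1 e) = k2 (b e)"
  shows "graph_iso (map_sum f1 f2) (map_sum k1 k2) (insert_graph G v H b) (insert_graph G' (f2 v) H' b')"
proof -
  interpret a: insertion G v H b by (rule assms(1))
  interpret a': insertion G' "f2 v" H' b' by (rule assms(2))
  interpret i1: graph_isomorphism f1 k1 G G' using a.G assms(3) by unfold_locales
  interpret i2: graph_isomorphism f2 k2 H H' using a.H assms(4) by unfold_locales
  have fv: "f2 w = f2 v \<longleftrightarrow> w = v" if "w \<in> verts H" for w
    using inj_on_eq_iff[OF i2.inj(1) that a.v] .
  have "bij_betw f2 (verts H - {v}) (verts H' - {f2 v})"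
    using bij_betw_DiffI[OF i2.bij(1), of "{v}" "{f2 v}"] a.v i2.maps(1) by simp
  then have "bij_betw (map_sum f1 f2) (verts a.K) (verts a'.K)"
    using bij_betw_map_sum[OF i1.bij(1)] by simp
  moreover have "bij_betw k1 (internal G) (internal G')"
    using i1.internal_iso inj_on_subset[OF i1.inj(2), of "internal G"]
    by (auto simp: bij_betw_def internal_def)
  then have "bij_betw (map_sum k1 k2) (hedges a.K) (hedges a'.K)"
    using bij_betw_map_sum[OF _ i2.bij(2)] by simp
  moreover have "vindex a'.K (map_sum f1 f2 x) = vindex a.K x" if "x \<in> verts a.K" for x
    using that i1.vindex_iso i2.vindex_iso by auto
  moreover have "bdry a'.K (map_sum k1 k2 x) = map_sum f1 f2 (bdry a.K x) \<and>
      invol a'.K (map_sum k1 k2 x) = map_sum k1 k2 (invol a.K x) \<and>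
      htype a'.K (map_sum k1 k2 x) = htype a.K x" if x: "x \<in> hedges a.K" for x
  proof (cases x)
    case (Inl e)
    then have "e \<in> hedges G" using x by (auto simp: internal_def)
    then show ?thesis using Inl i1.hedge_iso by simp
  next
    case (Inr d)
    then have d: "d \<in> hedges H" using x by auto
    note eq = i2.hedge_iso[OF d] fv[OF wf_graphD(3)[OF a.H d]]
    show ?thesis
    proof (cases "bdry H d = v")
      case True
      let ?e = "inv_into (external G) b d"
      have e: "?e \<in> external G" "b ?e = d" using a.b_inv[OF d True] .
      have "k1 ?e \<in> external G'" using e(1) i1.external_iso by simp
      then have "inv_into (external G') b' (k2 d) = k1 ?e"
        using a'.b_maps(3)[of "k1 ?e"] compat[OF e(1)] e(2) by simp
      then show ?thesis
        using Inr eq True i1.hedge_iso(1)[of ?e] e(1) by (simp add: external_def)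
    next
      case False then show ?thesis using Inr eq by simp
    qed
  qed
  ultimately show ?thesis unfolding graph_iso_def by blast
qed

text \<open>
  The specifications agree on components only; connectedness of \<open>G\<close> ensures that the projection of
  a component is a component.
\<close>

lemma sgraph_iso_insert:
  assumes "connected_insertion G v H b" "insertion G' (f2 v) H' b'"
    and "graph_iso f1 k1 G G'" "sgraph_iso f2 k2 (H, j) (H', j')"
    and "\<And>e. e \<in> external G \<Longrightarrow> b' (k1 e) = k2 (b e)"
  shows "sgraph_iso (map_sum f1 f2) (map_sum k1 k2)
    (insert_specified (G, i) v (H, j) b) (insert_specified (G', i') (f2 v) (H', j') b')"
proof -
  interpret a: connected_insertion G v H b by (rule assms(1))
  have "j' (case_sum (\<lambda>_. f2 v) (\<lambda>w. w) ` (map_sum f1 f2 ` C)) = j (a.proj ` C)"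
    if C: "C \<in> pi0 a.K" for C
  proof -
    have "case_sum (\<lambda>_. f2 v) (\<lambda>w. w) (map_sum f1 f2 x) = f2 (a.proj x)" for x
      by (cases x) simp_all
    then have "case_sum (\<lambda>_. f2 v) (\<lambda>w. w) ` (map_sum f1 f2 ` C) = f2 ` (a.proj ` C)"
      unfolding image_image by simp
    then show ?thesis using assms(4) a.pi0_insert_proj(1)[OF C] by simp
  qed
  then show ?thesis
    using graph_iso_insert[where ?f2.0 = f2 and v = v, OF a.insertion_axioms assms(2,3)] assms(4,5)
    by simp
qed

lemma Inr_image_not_range: "Inr ` B \<subseteq> range Inl \<longleftrightarrow> B = {}"
  by auto

lemma sgraph_iso_union:
  assumes "pair_union G v H b g h" "insertion G' (f2 v) H' b'"
    and "graph_iso f1 k1 G G'" "graph_iso f2 k2 H H'"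
    and gg: "sgraph_iso f1 k1 (g, l) (g', l')" and hh: "sgraph_iso f2 k2 (h, m) (h', m')"
    and "\<And>e. e \<in> external G \<Longrightarrow> b' (k1 e) = k2 (b e)"
  shows "sgraph_iso (map_sum f1 f2) (map_sum k1 k2)
    (union_specified ((G, i), (g, l)) v ((H, j), (h, m)) b)
    (union_specified ((G', i'), (g', l')) (f2 v) ((H', j'), (h', m')) b')"
proof -
  interpret u: pair_union G v H b g h by (rule assms(1))
  let ?l = "\<lambda>C. if C \<subseteq> range Inl then l (Inl -` C) else m (Inr -` C)"
  let ?l' = "\<lambda>C. if C \<subseteq> range Inl then l' (Inl -` C) else m' (Inr -` C)"
  have "graph_iso (map_sum f1 f2) (map_sum k1 k2)
      (u.K\<lparr>invol := map_sum (invol g) (invol h)\<rparr>)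
      ((insert_graph G' (f2 v) H' b')\<lparr>invol := map_sum (invol g') (invol h')\<rparr>)"
  proof (rule graph_iso_invol[OF graph_iso_insert[where ?f2.0 = f2 and v = v, OF u.insertion_axioms assms(2-4,7)]])
    fix x assume "x \<in> hedges u.K"
    then consider e where "x = Inl e" "e \<in> hedges g" | d where "x = Inr d" "d \<in> hedges h"
      using u.gD(3) u.hD(3) by (auto simp: internal_def)
    then show "map_sum (invol g') (invol h') (map_sum k1 k2 x)
        = map_sum k1 k2 (map_sum (invol g) (invol h) x)"
      using gg hh by cases (simp_all add: graph_iso_def)
  qed
  moreover have "?l' (map_sum f1 f2 ` C) = ?l C" if C: "C \<in> pi0 u.U" for C
  proof -
    consider D where "D \<in> pi0 g" "C = Inl ` D" | D where "D \<in> pi0 h" "C = Inr ` D"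
      using C unfolding u.pi0_union by auto
    then show ?thesis
    proof cases
      case 1
      have "map_sum f1 f2 ` C = Inl ` (f1 ` D)" unfolding 1(2) image_image by simp
      moreover have "l' (f1 ` D) = l D" using gg 1(1) by simp
      ultimately show ?thesis using 1(2) by (simp add: inj_vimage_image_eq image_subset_iff)
    next
      case 2
      have "map_sum f1 f2 ` C = Inr ` (f2 ` D)" unfolding 2(2) image_image by simp
      moreover have "m' (f2 ` D) = m D" using hh 2(1) by simp
      ultimately show ?thesis
        using 2(2) pi0_nonempty[OF 2(1)] by (simp add: inj_vimage_image_eq Inr_image_not_range)
    qed
  qed
  ultimately show ?thesis by (simp add: union_graph_def)
qed

lemma res_type_iso:
  assumes "wf_graph G" "connected_graph G" "sgraph_iso f k (G, i) (H, j)"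
  shows "res_type (H, j) = res_type (G, i)"
proof -
  interpret graph_isomorphism f k G H using assms by unfold_locales simp_all
  have "j (f ` verts G) = i (verts G)" using assms(3) pi0_connected[OF assms(2)] by simp
  then show ?thesis
    using leg_type_iso[of "verts G" j i] images(1) connected_iso assms(2)
      res_type_connected(1)[OF assms(1,2)] res_type_connected(1)[OF wf_iso] by simp
qed

text \<open>
  Everything entering the two operations is transported by an isomorphism: the vertices summed over
  by the vertex map, and the gluings by the maps on half-edges.
\<close>

lemma odot_generators_iso:
  assumes P: "specified_pair T P" and Q: "specified_pair T Q"
    and PP: "gpair_iso f1 k1 P P'" and QQ: "gpair_iso f2 k2 Q Q'"
  shows "odot_generators P Q = odot_generators P' Q'"
proof -
  obtain G i g l where Pe: "P = ((G, i), (g, l))" by (metis surj_pair)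
  obtain H j h m where Qe: "Q = ((H, j), (h, m))" by (metis surj_pair)
  obtain G' i' g' l' where Pe': "P' = ((G', i'), (g', l'))" by (metis surj_pair)
  obtain H' j' h' m' where Qe': "Q' = ((H', j'), (h', m'))" by (metis surj_pair)
  have s: "sgraph_iso f1 k1 (G, i) (G', i')" "sgraph_iso f1 k1 (g, l) (g', l')"
    "sgraph_iso f2 k2 (H, j) (H', j')" "sgraph_iso f2 k2 (h, m) (h', m')"
    using PP QQ by (simp_all add: gpair_iso_def Pe Qe Pe' Qe')
  note p = specified_pairD[OF P[unfolded Pe]] and q = specified_pairD[OF Q[unfolded Qe]]
  interpret i1: graph_isomorphism f1 k1 G G' using p(1) s(1) by unfold_locales simp_all
  interpret i2: graph_isomorphism f2 k2 H H' using q(1) s(3) by unfold_locales simp_all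
  interpret ih: graph_isomorphism f2 k2 h h'
    using covering_subgraphD(1)[OF q(4)] s(4) by unfold_locales simp_all
  let ?R = "\<lambda>v b. (insert_specified (G, i) v (H, j) b, union_specified P v Q b)"
  let ?R' = "\<lambda>v b. (insert_specified (G', i') v (H', j') b, union_specified P' v Q' b)"
  let ?S = "{v \<in> verts H - core h. vtype H v = res_type (G, i)}"
  let ?S' = "{v \<in> verts H' - core h'. vtype H' v = res_type (G', i')}"
  have res: "res_type (G', i') = res_type (G, i)" by (rule res_type_iso[OF p(1,2) s(1)])
  have core: "core h \<subseteq> verts H" using covering_subgraphD(2)[OF q(4)] by (auto simp: core_def)
  have "verts H' - core h' = f2 ` (verts H - core h)"
    using inj_on_image_set_diff[OF i2.inj(1), of "verts H" "core h"] core i2.images(1) ih.core_iso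
    by auto
  then have "?S' = {y \<in> f2 ` (verts H - core h). vtype H' y = res_type (G, i)}"
    unfolding res by simp
  also have "\<dots> = f2 ` ?S"
    unfolding Compr_image_eq using i2.vtype_iso by (intro image_cong Collect_cong conj_cong) auto
  finally have S: "bij_betw f2 ?S ?S'"
    using inj_on_subset[OF i2.inj(1), of ?S] by (auto simp: bij_betw_def)
  have inner: "(\<Sum>b\<in>gluings G v H. Poly_Mapping.single (gpair_class (?R v b)) 1)
    = (\<Sum>b\<in>gluings G' (f2 v) H'. Poly_Mapping.single (gpair_class (?R' (f2 v) b)) 1)"
    if v: "v \<in> ?S" for v
  proof (rule sum_gluings_reindex[where \<psi> = k1 and \<phi> = k2])
    have vH: "v \<in> verts H" using v by simp
    show "bij_betw k1 (external G) (external G')"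
      using i1.external_iso inj_on_subset[OF i1.inj(2), of "external G"]
      by (auto simp: bij_betw_def external_def)
    show "bij_betw k2 (star H v) (star H' (f2 v))" by (rule i2.star_iso[OF vH])
    show "htype G' (k1 e) = htype G e" if "e \<in> external G" for e
      using that i1.hedge_iso(3) by (simp add: external_def)
    show "htype H' (k2 d) = htype H d" if "d \<in> star H v" for d
      using that i2.hedge_iso(3) by (simp add: star_def)
    fix b b' assume b: "b \<in> gluings G v H" and b': "b' \<in> gluings G' (f2 v) H'"
      and compat: "\<And>e. e \<in> external G \<Longrightarrow> b' (k1 e) = k2 (b e)"
    have v': "v \<in> verts H - core h" "vtype H v = res_type (G, i)" using v by simp_all
    interpret a: connected_insertion G v H b
      using p(1,2) q(1) v' b by unfold_locales simp_all
    interpret u: pair_union G v H b g h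
      by unfold_locales (use p(4) q(4) not_core_isolated[OF q(4) v'(1)] in auto)
    have a': "insertion G' (f2 v) H' b'"
      using i1.wf_iso i2.wf_iso i2.maps(1)[OF vH] b' by unfold_locales
    have "gpair_iso (map_sum f1 f2) (map_sum k1 k2) (?R v b) (?R' (f2 v) b')"
      unfolding gpair_iso_def fst_conv snd_conv Pe Qe Pe' Qe'
      using sgraph_iso_insert[where ?f2.0 = f2 and v = v, OF a.connected_insertion_axioms a' i1.iso s(3) compat]
        sgraph_iso_union[where ?f2.0 = f2 and v = v, OF u.pair_union_axioms a' i1.iso i2.iso s(2,4) compat] by blast
    moreover have "covered_pair (?R v b)"
      unfolding Pe Qe
      by (rule specified_pair_covered[OF specified_pair_odot[OF P[unfolded Pe] Q[unfolded Qe] v' b]])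
    ultimately show "Poly_Mapping.single (gpair_class (?R v b)) 1
      = Poly_Mapping.single (gpair_class (?R' (f2 v) b')) 1"
      using gpair_class_eq by metis
  qed
  show ?thesis
    unfolding odot_generators_def Pe Qe Pe' Qe' fst_conv snd_conv
    unfolding sum.reindex_bij_betw[OF S, symmetric]
    by (rule sum.cong[OF refl]) (rule inner[unfolded Pe Qe Pe' Qe'])
qed

lemma ins_generators_iso:
  assumes \<Gamma>: "connected_specified_graph T (G, i)" and Q: "specified_pair T Q"
    and QQ: "gpair_iso f k Q Q'"
  shows "ins_generators (G, i) Q = ins_generators (G, i) Q'"
proof -
  obtain H j h m where Qe: "Q = ((H, j), (h, m))" by (metis surj_pair)
  obtain H' j' h' m' where Qe': "Q' = ((H', j'), (h', m'))" by (metis surj_pair)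
  have s: "sgraph_iso f k (H, j) (H', j')" "sgraph_iso f k (h, m) (h', m')"
    using QQ by (simp_all add: gpair_iso_def Qe Qe')
  have G: "wf_graph G" "connected_graph G" using \<Gamma> by (simp_all add: connected_specified_graph_def)
  have id: "graph_iso id id G G" by (simp add: graph_iso_def)
  note q = specified_pairD[OF Q[unfolded Qe]]
  interpret i: graph_isomorphism f k H H' using q(1) s(1) by unfold_locales simp_all
  interpret ih: graph_isomorphism f k h h'
    using covering_subgraphD(1)[OF q(4)] s(2) by unfold_locales simp_all
  let ?R = "\<lambda>v b. (insert_specified (G, i) v (H, j) b, insert_specified (G, i) v (h, m) b)"
  let ?R' = "\<lambda>v b. (insert_specified (G, i) v (H', j') b, insert_specified (G, i) v (h', m') b)"
  let ?S = "{v \<in> core h. vtype H v = res_type (G, i)}"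
  let ?S' = "{v \<in> core h'. vtype H' v = res_type (G, i)}"
  have core: "core h \<subseteq> verts H" using covering_subgraphD(2)[OF q(4)] by (auto simp: core_def)
  have "?S' = f ` ?S"
    unfolding ih.core_iso Compr_image_eq using i.vtype_iso core
    by (intro image_cong Collect_cong conj_cong) auto
  then have S: "bij_betw f ?S ?S'"
    using inj_on_subset[OF i.inj(1), of ?S] core by (auto simp: bij_betw_def)
  have inner: "(\<Sum>b\<in>gluings G v H. Poly_Mapping.single (gpair_class (?R v b)) 1)
    = (\<Sum>b\<in>gluings G (f v) H'. Poly_Mapping.single (gpair_class (?R' (f v) b)) 1)"
    if v: "v \<in> ?S" for v
  proof (rule sum_gluings_reindex[where \<psi> = id and \<phi> = k])
    have v': "v \<in> core h" and vH: "v \<in> verts H" using v core by auto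
    show "bij_betw k (star H v) (star H' (f v))" by (rule i.star_iso[OF vH])
    show "htype H' (k d) = htype H d" if "d \<in> star H v" for d
      using that i.hedge_iso(3) by (simp add: star_def)
    fix b b' assume b: "b \<in> gluings G v H" and b': "b' \<in> gluings G (f v) H'"
      and compat: "\<And>e. e \<in> external G \<Longrightarrow> b' (id e) = k (b e)"
    have a: "connected_insertion G v H b"
      using G q(1) vH b by unfold_locales simp_all
    have a': "insertion G (f v) H' b'"
      using G(1) i.wf_iso i.maps(1)[OF vH] b' by unfold_locales
    note cov' = covering_subgraph_iso[OF q(1,4) i.iso ih.iso]
    have ah': "insertion G (f v) h' b'"
      by (rule insertion_cong[OF a' covering_subgraphD(1-3)[OF cov']])
         (simp add: covering_subgraphD(5,6)[OF cov'])
    have "gpair_iso (map_sum id f) (map_sum id k) (?R v b) (?R' (f v) b')"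
      unfolding gpair_iso_def fst_conv snd_conv
      using sgraph_iso_insert[where ?f2.0 = f and v = v, OF a a' id s(1) compat]
        sgraph_iso_insert[where ?f2.0 = f and v = v, OF covering_insertion[OF a q(4)] ah' id s(2) compat] by blast
    moreover have "covered_pair (?R v b)"
      by (rule specified_pair_covered[OF specified_pair_ins[OF \<Gamma> Q[unfolded Qe] v' b]])
    ultimately show "Poly_Mapping.single (gpair_class (?R v b)) 1
      = Poly_Mapping.single (gpair_class (?R' (f v) b')) 1"
      using gpair_class_eq by metis
  qed simp_all
  show ?thesis
    unfolding ins_generators_def Qe Qe' fst_conv snd_conv
    unfolding sum.reindex_bij_betw[OF S, symmetric]
    by (rule sum.cong[OF refl]) (rule inner)
qed


section \<open>Iterated insertions\<close>

text \<open>
  Two successive insertions give the same graph in either order; only the bracketing of the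
  underlying disjoint sums differs. If the second insertion takes place inside the first inserted
  graph, the sums are reassociated; if it takes place outside, their summands are permuted.
\<close>

definition sum_assoc :: "'a + ('b + 'c) \<Rightarrow> ('a + 'b) + 'c" where
  "sum_assoc = case_sum (\<lambda>x. Inl (Inl x)) (case_sum (\<lambda>y. Inl (Inr y)) Inr)"

definition sum_swap :: "'a + ('b + 'c) \<Rightarrow> 'b + ('a + 'c)" where
  "sum_swap = case_sum (\<lambda>x. Inr (Inl x)) (case_sum Inl (\<lambda>z. Inr (Inr z)))"

lemma sum_assoc_simps [simp]:
  "sum_assoc (Inl x) = Inl (Inl x)" "sum_assoc (Inr (Inl y)) = Inl (Inr y)"
  "sum_assoc (Inr (Inr z)) = Inr z"
  by (simp_all add: sum_assoc_def)

lemma sum_swap_simps [simp]: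
  "sum_swap (Inl x) = Inr (Inl x)" "sum_swap (Inr (Inl y)) = Inl y"
  "sum_swap (Inr (Inr z)) = Inr (Inr z)"
  by (simp_all add: sum_swap_def)

lemma sum3_cases:
  obtains a where "x = Inl a" | b where "x = Inr (Inl b)" | c where "x = Inr (Inr c)"
  by (cases x; cases "projr x") auto

lemma inj_sum_assoc: "inj sum_assoc"
  by (rule injI) (auto simp: sum_assoc_def split: sum.splits)

lemma inj_sum_swap: "inj sum_swap"
  by (rule injI) (auto simp: sum_swap_def split: sum.splits)

lemma insert_graph_invol:
  "insert_graph A x (K\<lparr>invol := t\<rparr>) c = (insert_graph A x K c)\<lparr>invol := map_sum (invol A) t\<rparr>"
  by (simp add: insert_graph_def cong: if_cong)

lemma graph_iso_sum_assoc:
  assumes "insertion A u G c'" "insertion G v H b"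
    and "insertion A (Inl u) (insert_graph G v H b) c" "insertion (insert_graph A u G c') v H b'"
    and c: "\<And>e. e \<in> external A \<Longrightarrow> c e = glued G b (c' e)"
    and b': "\<And>e. e \<in> external G \<Longrightarrow> b' (Inr e) = b e"
  shows "graph_iso sum_assoc sum_assoc
    (insert_graph A (Inl u) (insert_graph G v H b) c) (insert_graph (insert_graph A u G c') v H b')"
    (is "graph_iso _ _ ?K1 ?K2")
proof -
  interpret AG: insertion A u G c' by (rule assms(1))
  interpret GH: insertion G v H b by (rule assms(2))
  interpret A_GH: insertion A "Inl u" GH.K c by (rule assms(3))
  interpret AG_H: insertion AG.K v H b' by (rule assms(4))
  have inv_c: "inv_into (external A) c (glued G b e) = inv_into (external A) c' e"
    if e: "e \<in> hedges G" "bdry G e = u" for e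
    using A_GH.b_maps(3)[OF AG.b_inv(1)[OF e]] c[OF AG.b_inv(1)[OF e]] AG.b_inv(2)[OF e] by simp
  have inv_b: "inv_into (external AG.K) b' d = Inr (inv_into (external G) b d)"
    if d: "d \<in> hedges H" "bdry H d = v" for d
  proof -
    have "Inr (inv_into (external G) b d) \<in> external AG.K"
      using GH.b_inv(1)[OF d] unfolding AG.external_insert by simp
    then show ?thesis
      using AG_H.b_maps(3) b'[OF GH.b_inv(1)[OF d]] GH.b_inv(2)[OF d] by metis
  qed
  have "verts GH.K - {Inl u} = Inl ` (verts G - {u}) \<union> Inr ` (verts H - {v})" by auto
  then have verts: "sum_assoc ` verts ?K1 = verts ?K2"
    unfolding insert_graph_simps(1)[of A] insert_graph_simps(1)[of AG.K]
    by (simp add: image_Un image_image Un_assoc)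
  have hedges: "sum_assoc ` hedges ?K1 = hedges ?K2"
    unfolding insert_graph_simps(2) GH.internal_insert AG.internal_insert
    by (simp add: image_Un image_image Un_assoc)
  have bdry: "bdry ?K2 (sum_assoc x) = sum_assoc (bdry ?K1 x)" if "x \<in> hedges ?K1" for x
  proof -
    from that consider e where "x = Inl e" | e where "x = Inr (Inl e)" "e \<in> internal G"
      | d where "x = Inr (Inr d)" "d \<in> hedges H" by auto
    then show ?thesis
    proof cases
      case 1 then show ?thesis by simp
    next
      case 2
      then have e: "e \<in> hedges G" "glued G b e = Inl e" by (simp_all add: internal_def glued_def)
      then show ?thesis using 2(1) inv_c[OF e(1)] by simp
    next
      case 3
      show ?thesis
      proof (cases "bdry H d = v")
        case True
        let ?e = "inv_into (external G) b d"
        have "?e \<in> external G" "b ?e = d" using GH.b_inv[OF 3(2) True] .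
        then have e: "?e \<in> hedges G" "glued G b ?e = Inr d"
          by (simp_all add: external_def glued_def)
        show ?thesis using 3(1) True inv_b[OF 3(2) True] inv_c[OF e(1)] e(2) by simp
      next
        case False then show ?thesis using 3(1) by simp
      qed
    qed
  qed
  have maps: "invol ?K2 (sum_assoc x) = sum_assoc (invol ?K1 x)"
    "htype ?K2 (sum_assoc x) = htype ?K1 x" for x
    by (cases x rule: sum3_cases; simp)+
  have index: "vindex ?K2 (sum_assoc x) = vindex ?K1 x" for x
    by (cases x rule: sum3_cases) simp_all
  show ?thesis
    unfolding graph_iso_def bij_betw_def
    by (intro conjI ballI verts hedges bdry maps index inj_on_subset[OF inj_sum_assoc subset_UNIV])
qed

lemma graph_iso_sum_swap:
  assumes "insertion A w H c'" "insertion G v H b" "w \<noteq> v"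
    and "insertion A (Inr w) (insert_graph G v H b) c" "insertion G (Inr v) (insert_graph A w H c') b'"
    and c: "\<And>e. e \<in> external A \<Longrightarrow> c e = Inr (c' e)"
    and b': "\<And>e. e \<in> external G \<Longrightarrow> b' e = Inr (b e)"
  shows "graph_iso sum_swap sum_swap
    (insert_graph A (Inr w) (insert_graph G v H b) c) (insert_graph G (Inr v) (insert_graph A w H c') b')"
    (is "graph_iso _ _ ?K1 ?K2")
proof -
  interpret AH: insertion A w H c' by (rule assms(1))
  interpret GH: insertion G v H b by (rule assms(2))
  interpret A_GH: insertion A "Inr w" GH.K c by (rule assms(4))
  interpret G_AH: insertion G "Inr v" AH.K b' by (rule assms(5))
  have inv_c: "inv_into (external A) c (Inr d) = inv_into (external A) c' d"
    if d: "d \<in> hedges H" "bdry H d = w" for d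
    using A_GH.b_maps(3)[OF AH.b_inv(1)[OF d]] c[OF AH.b_inv(1)[OF d]] AH.b_inv(2)[OF d] by simp
  have inv_b: "inv_into (external G) b' (Inr d) = inv_into (external G) b d"
    if d: "d \<in> hedges H" "bdry H d = v" for d
    using G_AH.b_maps(3)[OF GH.b_inv(1)[OF d]] b'[OF GH.b_inv(1)[OF d]] GH.b_inv(2)[OF d] by simp
  have "verts GH.K - {Inr w} = Inl ` verts G \<union> Inr ` (verts H - {v, w})"
    "verts AH.K - {Inr v} = Inl ` verts A \<union> Inr ` (verts H - {v, w})" by auto
  then have verts: "sum_swap ` verts ?K1 = verts ?K2"
    unfolding insert_graph_simps(1)[of A "Inr w"] insert_graph_simps(1)[of G "Inr v"]
    by (simp add: image_Un image_image Un_left_commute)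
  have hedges: "sum_swap ` hedges ?K1 = hedges ?K2"
    unfolding insert_graph_simps(2) by (simp add: image_Un image_image Un_left_commute)
  have bdry: "bdry ?K2 (sum_swap x) = sum_swap (bdry ?K1 x)" if "x \<in> hedges ?K1" for x
  proof -
    from that consider e where "x = Inl e" | e where "x = Inr (Inl e)"
      | d where "x = Inr (Inr d)" "d \<in> hedges H" by auto
    then show ?thesis
    proof cases
      case 3
      then show ?thesis using assms(3) inv_b[of d] inv_c[of d] by auto
    qed simp_all
  qed
  have maps: "invol ?K2 (sum_swap x) = sum_swap (invol ?K1 x)"
    "htype ?K2 (sum_swap x) = htype ?K1 x" for x
    by (cases x rule: sum3_cases; simp)+
  have index: "vindex ?K2 (sum_swap x) = vindex ?K1 x" for x
    by (cases x rule: sum3_cases) simp_all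
  show ?thesis
    unfolding graph_iso_def bij_betw_def
    by (intro conjI ballI verts hedges bdry maps index inj_on_subset[OF inj_sum_swap subset_UNIV])
qed

lemma gpair_iso_sum_assoc:
  fixes A :: "('a, 'p, 'h) fgraph" and G g :: "('b, 'q, 'h) fgraph" and H h :: "('c, 'r, 'h) fgraph"
  assumes "insertion A u G c'" "insertion G v H b"
    and "insertion A (Inl u) (insert_graph G v H b) c" "insertion (insert_graph A u G c') v H b'"
    and "\<And>e. e \<in> external A \<Longrightarrow> c e = glued G b (c' e)"
    and "\<And>e. e \<in> external G \<Longrightarrow> b' (Inr e) = b e"
  shows "gpair_iso sum_assoc sum_assoc
    (insert_specified (A, a) (Inl u) (insert_specified (G, i) v (H, j) b) c,
     insert_specified (A, a) (Inl u) (union_specified ((G, i), (g, l)) v ((H, j), (h, m)) b) c)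
    (insert_specified (insert_specified (A, a) u (G, i) c') v (H, j) b',
     union_specified (insert_specified (A, a) u (G, i) c', insert_specified (A, a) u (g, l) c')
       v ((H, j), (h, m)) b')"
proof -
  have iso: "graph_iso sum_assoc sum_assoc (insert_graph A (Inl u) (insert_graph G v H b) c)
      (insert_graph (insert_graph A u G c') v H b')"
    by (rule graph_iso_sum_assoc[OF assms(1-4)]) (use assms(5,6) in simp_all)
  let ?p = "case_sum (\<lambda>_. Inl u) (\<lambda>x. x) :: 'a + ('b + 'c) \<Rightarrow> 'b + 'c"
  have pt: "case_sum (\<lambda>_. v) (\<lambda>w. w) (sum_assoc x) = case_sum (\<lambda>_. v) (\<lambda>w. w) (?p x)" for x
    by (cases x rule: sum3_cases) simp_all
  have amb: "case_sum (\<lambda>_. v) (\<lambda>w. w) ` sum_assoc ` C = case_sum (\<lambda>_. v) (\<lambda>w. w) ` ?p ` C" for C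
    unfolding image_image pt ..
  have side: "sum_assoc ` C \<subseteq> range Inl \<longleftrightarrow> ?p ` C \<subseteq> range Inl" for C
  proof -
    have "sum_assoc x \<in> range Inl \<longleftrightarrow> ?p x \<in> range Inl" for x
      by (cases x rule: sum3_cases) auto
    then show ?thesis unfolding image_subset_iff by simp
  qed
  have right: "Inr -` sum_assoc ` C = Inr -` ?p ` C" for C
  proof -
    have "Inr z = sum_assoc x \<longleftrightarrow> Inr z = ?p x" for x z
      by (cases x rule: sum3_cases) auto
    then show ?thesis unfolding vimage_def image_iff by simp
  qed
  have left: "case_sum (\<lambda>_. u) (\<lambda>x. x) ` (Inl -` sum_assoc ` C) = Inl -` ?p ` C" for C
  proof (rule set_eqI)
    fix y
    have "(\<exists>z. Inl z = sum_assoc x \<and> y = case_sum (\<lambda>_. u) (\<lambda>x. x) z) \<longleftrightarrow> Inl y = ?p x" for x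
      by (cases x rule: sum3_cases) auto
    then show "y \<in> case_sum (\<lambda>_. u) (\<lambda>x. x) ` (Inl -` sum_assoc ` C) \<longleftrightarrow> y \<in> Inl -` ?p ` C"
      by (simp add: image_iff Bex_def) metis
  qed
  have invol: "map_sum (map_sum (invol A) (invol g)) (invol h) (sum_assoc x)
      = sum_assoc (map_sum (invol A) (map_sum (invol g) (invol h)) x)" for x
    by (cases x rule: sum3_cases) simp_all
  have sub: "graph_iso sum_assoc sum_assoc
      ((insert_graph A (Inl u) (insert_graph G v H b) c)\<lparr>invol := map_sum (invol A) (map_sum (invol g) (invol h))\<rparr>)
      ((insert_graph (insert_graph A u G c') v H b')\<lparr>invol := map_sum (map_sum (invol A) (invol g)) (invol h)\<rparr>)"
    by (rule graph_iso_invol[OF iso]) (rule invol)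
  show ?thesis
    unfolding gpair_iso_def fst_conv snd_conv
      insert_specified.simps union_specified.simps sgraph_iso.simps insert_graph_invol
    using iso sub by (simp add: amb side right left del: insert_graph_simps(1-4,6,7))
qed

lemma gpair_iso_sum_swap:
  fixes A :: "('a, 'p, 'h) fgraph" and G g :: "('b, 'q, 'h) fgraph" and H h :: "('c, 'r, 'h) fgraph"
  assumes "insertion A w H c'" "insertion G v H b" "w \<noteq> v"
    and "insertion A (Inr w) (insert_graph G v H b) c" "insertion G (Inr v) (insert_graph A w H c') b'"
    and "\<And>e. e \<in> external A \<Longrightarrow> c e = Inr (c' e)"
    and "\<And>e. e \<in> external G \<Longrightarrow> b' e = Inr (b e)"
  shows "gpair_iso sum_swap sum_swap
    (insert_specified (A, a) (Inr w) (insert_specified (G, i) v (H, j) b) c,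
     insert_specified (A, a) (Inr w) (union_specified ((G, i), (g, l)) v ((H, j), (h, m)) b) c)
    (insert_specified (G, i) (Inr v) (insert_specified (A, a) w (H, j) c') b',
     union_specified ((G, i), (g, l)) (Inr v)
       (insert_specified (A, a) w (H, j) c', insert_specified (A, a) w (h, m) c') b')"
proof -
  have iso: "graph_iso sum_swap sum_swap (insert_graph A (Inr w) (insert_graph G v H b) c)
      (insert_graph G (Inr v) (insert_graph A w H c') b')"
    by (rule graph_iso_sum_swap[OF assms(1-5)]) (use assms(6,7) in simp_all)
  let ?p = "case_sum (\<lambda>_. Inr w) (\<lambda>x. x) :: 'a + ('b + 'c) \<Rightarrow> 'b + 'c"
  let ?q = "case_sum (\<lambda>_. w) (\<lambda>x. x) :: 'a + 'c \<Rightarrow> 'c"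
  have pt: "?q (case_sum (\<lambda>_. Inr v) (\<lambda>x. x) (sum_swap x)) = case_sum (\<lambda>_. v) (\<lambda>w. w) (?p x)" for x
    by (cases x rule: sum3_cases) simp_all
  have amb: "?q ` case_sum (\<lambda>_. Inr v) (\<lambda>x. x) ` sum_swap ` C = case_sum (\<lambda>_. v) (\<lambda>w. w) ` ?p ` C" for C
    unfolding image_image pt ..
  have side: "sum_swap ` C \<subseteq> range Inl \<longleftrightarrow> ?p ` C \<subseteq> range Inl" for C
  proof -
    have "sum_swap x \<in> range Inl \<longleftrightarrow> ?p x \<in> range Inl" for x
      by (cases x rule: sum3_cases) auto
    then show ?thesis unfolding image_subset_iff by simp
  qed
  have left: "Inl -` sum_swap ` C = Inl -` ?p ` C" for C
  proof -
    have "Inl z = sum_swap x \<longleftrightarrow> Inl z = ?p x" for x z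
      by (cases x rule: sum3_cases) auto
    then show ?thesis unfolding vimage_def image_iff by simp
  qed
  have right: "?q ` (Inr -` sum_swap ` C) = Inr -` ?p ` C" for C
  proof (rule set_eqI)
    fix y
    have "(\<exists>z. Inr z = sum_swap x \<and> y = ?q z) \<longleftrightarrow> Inr y = ?p x" for x
      by (cases x rule: sum3_cases) auto
    then show "y \<in> ?q ` (Inr -` sum_swap ` C) \<longleftrightarrow> y \<in> Inr -` ?p ` C"
      by (simp add: image_iff Bex_def) metis
  qed
  have invol: "map_sum (invol g) (map_sum (invol A) (invol h)) (sum_swap x)
      = sum_swap (map_sum (invol A) (map_sum (invol g) (invol h)) x)" for x
    by (cases x rule: sum3_cases) simp_all
  have sub: "graph_iso sum_swap sum_swap
      ((insert_graph A (Inr w) (insert_graph G v H b) c)\<lparr>invol := map_sum (invol A) (map_sum (invol g) (invol h))\<rparr>)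
      ((insert_graph G (Inr v) (insert_graph A w H c') b')\<lparr>invol := map_sum (invol g) (map_sum (invol A) (invol h))\<rparr>)"
    by (rule graph_iso_invol[OF iso]) (rule invol)
  show ?thesis
    unfolding gpair_iso_def fst_conv snd_conv
      insert_specified.simps union_specified.simps sgraph_iso.simps insert_graph_invol
    using iso sub by (simp add: amb side right left del: insert_graph_simps(1-4,6,7))
qed


section \<open>The derivation property on generators\<close>

lemma sum_exchange_pairs:
  "(\<Sum>v\<in>V. \<Sum>b\<in>B v. \<Sum>u\<in>U. \<Sum>c\<in>C u. f v b u c) = (\<Sum>u\<in>U. \<Sum>c\<in>C u. \<Sum>v\<in>V. \<Sum>b\<in>B v. f v b u c)"
proof -
  have inner: "(\<Sum>b\<in>S. \<Sum>u\<in>U. \<Sum>c\<in>C u. h b u c) = (\<Sum>u\<in>U. \<Sum>c\<in>C u. \<Sum>b\<in>S. h b u c)"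
    for S :: "'s set" and h :: "'s \<Rightarrow> _"
    by (subst sum.swap) (rule sum.cong[OF refl], rule sum.swap)
  show ?thesis unfolding inner ..
qed

lemma gluings_Inr_source:
  assumes "b \<in> gluings G v H" "external G' = Inr ` external G"
    and "\<And>e. e \<in> external G \<Longrightarrow> htype G' (Inr e) = htype G e"
  shows "(\<lambda>x\<in>external G'. b (projr x)) \<in> gluings G' v H"
proof -
  have b: "bij_betw b (external G) (star H v)" "\<And>e. e \<in> external G \<Longrightarrow> htype H (b e) = htype G e"
    using assms(1) by (simp_all add: gluings_iff)
  have "bij_betw projr (external G') (external G)"
    unfolding assms(2) by (rule bij_betw_byWitness[where f' = Inr]) auto
  then have "bij_betw (\<lambda>x\<in>external G'. b (projr x)) (external G') (star H v)"
    using bij_betw_trans[OF _ b(1)] by (subst bij_betw_cong[of _ _ "b \<circ> projr"]) auto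
  then show ?thesis
    using b(2) assms(2,3) by (simp add: gluings_iff)
qed

lemma gluings_Inr_target:
  assumes "b \<in> gluings G v H" "star H' v' = Inr ` star H v"
    and "\<And>d. d \<in> star H v \<Longrightarrow> htype H' (Inr d) = htype H d"
  shows "(\<lambda>e\<in>external G. Inr (b e)) \<in> gluings G v' H'"
proof -
  have b: "bij_betw b (external G) (star H v)" "\<And>e. e \<in> external G \<Longrightarrow> htype H (b e) = htype G e"
    using assms(1) by (simp_all add: gluings_iff)
  have "bij_betw Inr (star H v) (star H' v')" unfolding assms(2) by (simp add: bij_betw_def)
  then have "bij_betw (\<lambda>e\<in>external G. Inr (b e)) (external G) (star H' v')"
    using bij_betw_trans[OF b(1)] by (subst bij_betw_cong[of _ _ "Inr \<circ> b"]) auto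
  then show ?thesis
    using b(2) assms(3) bij_betw_apply[OF b(1)] by (simp add: gluings_iff)
qed

text \<open>
  The graph \<open>\<Gamma>\<close> is inserted at a vertex of the disjoint union of the subgraphs, hence at a vertex of
  one of them: this splits the sum in two. In each part, the two insertions are exchanged.
\<close>

lemma ins_odot_generators:
  fixes T :: "'h qft"
  assumes \<Gamma>: "connected_specified_graph T (A, a)"
    and P: "specified_pair T ((G, i), (g, l))" and Q: "specified_pair T ((H, j), (h, m))"
  defines "V \<equiv> {v \<in> verts H - core h. vtype H v = res_type (G, i)}"
    and "U \<equiv> {u \<in> core g. vtype G u = res_type (A, a)}"
    and "W \<equiv> {w \<in> core h. vtype H w = res_type (A, a)}"
  shows "(\<Sum>v\<in>V. \<Sum>b\<in>gluings G v H. ins_generators (A, a)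
      (insert_specified (G, i) v (H, j) b, union_specified ((G, i), (g, l)) v ((H, j), (h, m)) b)
      :: 'h gpair_class \<Rightarrow>\<^sub>0 'k::field)
    = (\<Sum>u\<in>U. \<Sum>c\<in>gluings A u G. odot_generators
        (insert_specified (A, a) u (G, i) c, insert_specified (A, a) u (g, l) c) ((H, j), (h, m)))
    + (\<Sum>w\<in>W. \<Sum>c\<in>gluings A w H. odot_generators ((G, i), (g, l))
        (insert_specified (A, a) w (H, j) c, insert_specified (A, a) w (h, m) c))"
proof -
  note p = specified_pairD[OF P] and q = specified_pairD[OF Q]
  note pc = covering_subgraphD[OF p(4)] and qc = covering_subgraphD[OF q(4)]
  have A: "wf_graph A" "connected_graph A" using \<Gamma> by (simp_all add: connected_specified_graph_def)
  have cores: "core g \<subseteq> verts G" "core h \<subseteq> verts H" using pc(2) qc(2) by (auto simp: core_def)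
  let ?K = "\<lambda>v b. insert_specified (G, i) v (H, j) b"
  let ?S = "\<lambda>v b. union_specified ((G, i), (g, l)) v ((H, j), (h, m)) b"
  let ?X = "\<lambda>v b x c. Poly_Mapping.single
    (gpair_class (insert_specified (A, a) x (?K v b) c, insert_specified (A, a) x (?S v b) c)) (1 :: 'k)"
  let ?Y = "\<lambda>u c v b. Poly_Mapping.single (gpair_class
    (insert_specified (insert_specified (A, a) u (G, i) c) v (H, j) b,
     union_specified (insert_specified (A, a) u (G, i) c, insert_specified (A, a) u (g, l) c)
       v ((H, j), (h, m)) b)) (1 :: 'k)"
  let ?Z = "\<lambda>w c v b. Poly_Mapping.single (gpair_class
    (insert_specified (G, i) v (insert_specified (A, a) w (H, j) c) b,
     union_specified ((G, i), (g, l)) v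
       (insert_specified (A, a) w (H, j) c, insert_specified (A, a) w (h, m) c) b)) (1 :: 'k)"
  (* The gluing of the first pair, read off the external edges of the graph enlarged by A. *)
  let ?l = "\<lambda>b. \<lambda>x\<in>Inr ` external G. b (projr x)"
  (* The same gluing, seen as a gluing into H enlarged by A. *)
  let ?r = "\<lambda>b. \<lambda>e\<in>external G. Inr (b e)"

  have insGH: "pair_union G v H b g h" "connected_insertion G v H b"
    if "v \<in> V" "b \<in> gluings G v H" for v b
  proof -
    have v: "v \<in> verts H - core h" using that(1) by (simp add: V_def)
    show "pair_union G v H b g h"
      by unfold_locales (use p(1,4) q(1,4) v that(2) not_core_isolated[OF q(4) v] in auto)
    show "connected_insertion G v H b"
      using p(1,2) q(1) v that(2) by unfold_locales simp_all
  qed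
  have insAG: "connected_insertion A u G c" if "u \<in> U" "c \<in> gluings A u G" for u c
    using A p(1) that cores by unfold_locales (auto simp: U_def)
  have insAH: "connected_insertion A w H c" if "w \<in> W" "c \<in> gluings A w H" for w c
    using A q(1) that cores by unfold_locales (auto simp: W_def)
  have covX: "covered_pair (insert_specified (A, a) x (?K v b) c, insert_specified (A, a) x (?S v b) c)"
    if vb: "v \<in> V" "b \<in> gluings G v H" and x: "x \<in> core (union_graph G v H b g h)"
      and c: "c \<in> gluings A x (insert_graph G v H b)" for v b x c
  proof -
    have "specified_pair T (?K v b, ?S v b)"
      using specified_pair_odot[OF P Q _ _ vb(2)] vb(1) by (simp add: V_def)
    then have "specified_pair T ((insert_graph G v H b, snd (?K v b)), (union_graph G v H b g h, snd (?S v b)))"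
      by (simp add: union_graph_def)
    from specified_pair_covered[OF specified_pair_ins[OF \<Gamma> this x c]]
    show ?thesis by (simp add: union_graph_def)
  qed

  have split: "ins_generators (A, a) (?K v b, ?S v b)
      = (\<Sum>u\<in>U. \<Sum>c\<in>gluings A (Inl u) (insert_graph G v H b). ?X v b (Inl u) c)
      + (\<Sum>w\<in>W. \<Sum>c\<in>gluings A (Inr w) (insert_graph G v H b). ?X v b (Inr w) c)"
    if vb: "v \<in> V" "b \<in> gluings G v H" for v b
  proof -
    interpret u: pair_union G v H b g h by (rule insGH[OF vb])
    have v: "v \<notin> core h" using vb(1) by (simp add: V_def)
    have "{x \<in> core u.U. vtype u.K x = res_type (A, a)} = Inl ` U \<union> Inr ` W"
    proof (rule set_eqI)
      fix x
      show "x \<in> {x \<in> core u.U. vtype u.K x = res_type (A, a)} \<longleftrightarrow> x \<in> Inl ` U \<union> Inr ` W"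
      proof (cases x)
        case (Inl y)
        show ?thesis
          using u.vtype_insert_Inl[of y] cores(1) Inl unfolding u.core_union U_def by auto
      next
        case (Inr y)
        have "vtype u.K (Inr y) = vtype H y" if "y \<in> core h"
          using u.vtype_insert_Inr[of y] v that by blast
        then show ?thesis
          using Inr unfolding u.core_union W_def by auto
      qed
    qed
    then have "ins_generators (A, a) (?K v b, ?S v b)
        = (\<Sum>x\<in>Inl ` U \<union> Inr ` W. \<Sum>c\<in>gluings A x u.K. ?X v b x c)"
      unfolding ins_generators_def union_graph_def by simp
    also have "\<dots> = (\<Sum>x\<in>Inl ` U. \<Sum>c\<in>gluings A x u.K. ?X v b x c)
        + (\<Sum>x\<in>Inr ` W. \<Sum>c\<in>gluings A x u.K. ?X v b x c)"
    proof (rule sum.union_disjoint)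
      show "finite (Inl ` U)" "finite (Inr ` W)"
        using finite_subset[OF cores(1) wf_graphD(1)[OF p(1)]]
          finite_subset[OF cores(2) wf_graphD(1)[OF q(1)]] by (simp_all add: U_def W_def)
    qed auto
    finally show ?thesis by (simp only: sum.reindex inj_Inl inj_Inr comp_def)
  qed

  have left: "(\<Sum>c\<in>gluings A (Inl u) (insert_graph G v H b). ?X v b (Inl u) c)
      = (\<Sum>c\<in>gluings A u G. ?Y u c v (?l b))"
    if vb: "v \<in> V" "b \<in> gluings G v H" and u: "u \<in> U" for v b u
  proof -
    interpret GH: pair_union G v H b g h by (rule insGH[OF vb])
    have uG: "u \<in> verts G" and uc: "Inl u \<in> core GH.U"
      using u cores GH.core_union by (auto simp: U_def)
    show ?thesis
    proof (rule sum_gluings_reindex[symmetric, where \<psi> = id and \<phi> = "glued G b"])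
      show "bij_betw (glued G b) (star G u) (star GH.K (Inl u))" by (rule GH.glued_star[OF uG])
      show "htype GH.K (glued G b e) = htype G e" if "e \<in> star G u" for e
        using that by (intro GH.glued_htype) (simp add: star_def)
      fix c' c assume c': "c' \<in> gluings A u G" and c: "c \<in> gluings A (Inl u) GH.K"
        and compat: "\<And>e. e \<in> external A \<Longrightarrow> c (id e) = glued G b (c' e)"
      interpret AG: connected_insertion A u G c' by (rule insAG[OF u c'])
      have A_GH: "insertion A (Inl u) GH.K c"
        using A(1) GH.wf_insert uG c by unfold_locales simp_all
      have b': "?l b \<in> gluings AG.K v H"
        using gluings_Inr_source[OF vb(2) AG.external_insert] by (simp add: AG.external_insert)
      have AG_H: "insertion AG.K v H (?l b)"
        using AG.wf_insert GH.H GH.v b' by unfold_locales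
      note iso = gpair_iso_sum_assoc[OF AG.insertion_axioms GH.insertion_axioms A_GH AG_H,
          where a = a and i = i and j = j and g = g and h = h and l = l and m = m]
      show "?Y u c' v (?l b) = ?X v b (Inl u) c"
        using gpair_class_eq[OF covX[OF vb uc c] iso] compat by simp
    qed simp_all
  qed

  have left': "(\<Sum>b\<in>gluings G v H. ?Y u c v (?l b))
      = (\<Sum>b\<in>gluings (insert_graph A u G c) v H. ?Y u c v b)"
    if u: "u \<in> U" "c \<in> gluings A u G" for u c v
  proof -
    interpret AG: connected_insertion A u G c by (rule insAG[OF u])
    show ?thesis
    proof (rule sum_gluings_reindex[where \<psi> = Inr and \<phi> = id])
      show "bij_betw Inr (external G) (external AG.K)"
        unfolding AG.external_insert by (simp add: bij_betw_def)
      fix b b' assume "b' \<in> gluings AG.K v H"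
        and compat: "\<And>e. e \<in> external G \<Longrightarrow> b' (Inr e) = id (b e)"
      then have "b' \<in> extensional (Inr ` external G)"
        unfolding AG.external_insert[symmetric] by (simp add: gluings_iff)
      then have "b' = ?l b"
        by (rule extensionalityI[OF _ restrict_extensional]) (use compat in auto)
      then show "?Y u c v (?l b) = ?Y u c v b'" by simp
    qed simp_all
  qed

  have right: "(\<Sum>c\<in>gluings A (Inr w) (insert_graph G v H b). ?X v b (Inr w) c)
      = (\<Sum>c\<in>gluings A w H. ?Z w c (Inr v) (?r b))"
    if vb: "v \<in> V" "b \<in> gluings G v H" and w: "w \<in> W" for v b w
  proof -
    interpret GH: pair_union G v H b g h by (rule insGH[OF vb])
    have wH: "w \<in> verts H" "w \<noteq> v" and wc: "Inr w \<in> core GH.U"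
      using w vb(1) cores GH.core_union by (auto simp: W_def V_def)
    show ?thesis
    proof (rule sum_gluings_reindex[symmetric, where \<psi> = id and \<phi> = Inr])
      show "bij_betw Inr (star H w) (star GH.K (Inr w))"
        unfolding GH.star_insert_Inr[OF wH(2)] by (simp add: bij_betw_def)
      fix c' c assume c': "c' \<in> gluings A w H" and c: "c \<in> gluings A (Inr w) GH.K"
        and compat: "\<And>e. e \<in> external A \<Longrightarrow> c (id e) = Inr (c' e)"
      interpret AH: connected_insertion A w H c' by (rule insAH[OF w c'])
      have A_GH: "insertion A (Inr w) GH.K c"
        using A(1) GH.wf_insert wH c by unfold_locales simp_all
      have b': "?r b \<in> gluings G (Inr v) AH.K"
        using wH(2) by (intro gluings_Inr_target[OF vb(2) AH.star_insert_Inr]) auto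
      have G_AH: "insertion G (Inr v) AH.K (?r b)"
        using AH.wf_insert GH.G GH.v b' wH(2) by unfold_locales simp_all
      note iso = gpair_iso_sum_swap[OF AH.insertion_axioms GH.insertion_axioms wH(2) A_GH G_AH,
          where a = a and i = i and j = j and g = g and h = h and l = l and m = m]
      show "?Z w c' (Inr v) (?r b) = ?X v b (Inr w) c"
        using gpair_class_eq[OF covX[OF vb wc c] iso] compat by simp
    qed simp_all
  qed

  have right': "(\<Sum>b\<in>gluings G v H. ?Z w c (Inr v) (?r b))
      = (\<Sum>b\<in>gluings G (Inr v) (insert_graph A w H c). ?Z w c (Inr v) b)"
    if w: "w \<in> W" "c \<in> gluings A w H" and v: "v \<in> V" for w c v
  proof -
    interpret AH: connected_insertion A w H c by (rule insAH[OF w])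
    have wv: "v \<noteq> w" using w v by (auto simp: W_def V_def)
    show ?thesis
    proof (rule sum_gluings_reindex[where \<psi> = id and \<phi> = Inr])
      show "bij_betw Inr (star H v) (star AH.K (Inr v))"
        unfolding AH.star_insert_Inr[OF wv] by (simp add: bij_betw_def)
      fix b b' assume "b' \<in> gluings G (Inr v) AH.K"
        and compat: "\<And>e. e \<in> external G \<Longrightarrow> b' (id e) = Inr (b e)"
      then have "b' \<in> extensional (external G)" by (simp add: gluings_iff)
      then have "b' = ?r b"
        by (rule extensionalityI[OF _ restrict_extensional]) (use compat in auto)
      then show "?Z w c (Inr v) (?r b) = ?Z w c (Inr v) b'" by simp
    qed simp_all
  qed

  have odot_left: "odot_generators
        (insert_specified (A, a) u (G, i) c, insert_specified (A, a) u (g, l) c) ((H, j), (h, m))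
      = (\<Sum>v\<in>V. \<Sum>b\<in>gluings (insert_graph A u G c) v H. ?Y u c v b)"
    if u: "u \<in> U" "c \<in> gluings A u G" for u c
  proof -
    interpret AG: connected_insertion A u G c by (rule insAG[OF u])
    show ?thesis
      using AG.res_type_insert[OF p(2), of i] unfolding odot_generators_def V_def by simp
  qed

  have odot_right: "odot_generators ((G, i), (g, l))
        (insert_specified (A, a) w (H, j) c, insert_specified (A, a) w (h, m) c)
      = (\<Sum>v\<in>V. \<Sum>b\<in>gluings G (Inr v) (insert_graph A w H c). ?Z w c (Inr v) b)"
    if w: "w \<in> W" "c \<in> gluings A w H" for w c
  proof -
    interpret AH: connected_insertion A w H c by (rule insAH[OF w])
    interpret Ah: connected_insertion A w h c
      by (rule covering_insertion[OF AH.connected_insertion_axioms q(4)])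
    have wc: "w \<in> core h" using w by (simp add: W_def)
    have "verts Ah.K = verts AH.K" using qc(2) by simp
    then have core_iff: "x \<in> core Ah.K \<longleftrightarrow> Ah.proj x \<in> core h" if "x \<in> verts AH.K" for x
      using Ah.core_insert[OF wc, of x] that by (simp only:)
    have "{x \<in> verts AH.K - core Ah.K. vtype AH.K x = res_type (G, i)} = Inr ` V"
    proof (rule set_eqI)
      fix x
      show "x \<in> {x \<in> verts AH.K - core Ah.K. vtype AH.K x = res_type (G, i)} \<longleftrightarrow> x \<in> Inr ` V"
      proof (cases x)
        case (Inl y)
        then have "x \<in> verts AH.K \<Longrightarrow> x \<in> core Ah.K"
          using core_iff[of x] wc by simp
        then show ?thesis using Inl by auto
      next
        case (Inr y)
        show ?thesis
        proof (cases "y = w")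
          case True then show ?thesis using Inr wc by (auto simp: V_def)
        next
          case False
          have "x \<in> verts AH.K \<longleftrightarrow> y \<in> verts H" using Inr False by auto
          moreover have "x \<in> core Ah.K \<longleftrightarrow> y \<in> core h" if "x \<in> verts AH.K"
            using core_iff[OF that] Inr by simp
          moreover have "vtype AH.K x = vtype H y" unfolding Inr by (rule AH.vtype_insert_Inr[OF False])
          ultimately show ?thesis using Inr by (auto simp: V_def simp del: insert_graph_simps)
        qed
      qed
    qed
    then show ?thesis
      unfolding odot_generators_def by (simp add: sum.reindex del: insert_graph_simps)
  qed

  have "(\<Sum>v\<in>V. \<Sum>b\<in>gluings G v H. ins_generators (A, a) (?K v b, ?S v b))
      = (\<Sum>v\<in>V. \<Sum>b\<in>gluings G v H.
          (\<Sum>u\<in>U. \<Sum>c\<in>gluings A u G. ?Y u c v (?l b)) +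
          (\<Sum>w\<in>W. \<Sum>c\<in>gluings A w H. ?Z w c (Inr v) (?r b)))"
  proof (rule sum.cong[OF refl], rule sum.cong[OF refl])
    fix v b assume vb: "v \<in> V" "b \<in> gluings G v H"
    have "(\<Sum>u\<in>U. \<Sum>c\<in>gluings A (Inl u) (insert_graph G v H b). ?X v b (Inl u) c)
        = (\<Sum>u\<in>U. \<Sum>c\<in>gluings A u G. ?Y u c v (?l b))"
      by (rule sum.cong[OF refl]) (rule left[OF vb])
    moreover have "(\<Sum>w\<in>W. \<Sum>c\<in>gluings A (Inr w) (insert_graph G v H b). ?X v b (Inr w) c)
        = (\<Sum>w\<in>W. \<Sum>c\<in>gluings A w H. ?Z w c (Inr v) (?r b))"
      by (rule sum.cong[OF refl]) (rule right[OF vb])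
    ultimately show "ins_generators (A, a) (?K v b, ?S v b) =
        (\<Sum>u\<in>U. \<Sum>c\<in>gluings A u G. ?Y u c v (?l b)) +
        (\<Sum>w\<in>W. \<Sum>c\<in>gluings A w H. ?Z w c (Inr v) (?r b))"
      unfolding split[OF vb] by (simp only:)
  qed
  also have "\<dots> = (\<Sum>u\<in>U. \<Sum>c\<in>gluings A u G. \<Sum>v\<in>V. \<Sum>b\<in>gluings G v H. ?Y u c v (?l b))
      + (\<Sum>w\<in>W. \<Sum>c\<in>gluings A w H. \<Sum>v\<in>V. \<Sum>b\<in>gluings G v H. ?Z w c (Inr v) (?r b))"
    unfolding sum.distrib by (rule arg_cong2[where f = "(+)"]; rule sum_exchange_pairs)
  also have "(\<Sum>u\<in>U. \<Sum>c\<in>gluings A u G. \<Sum>v\<in>V. \<Sum>b\<in>gluings G v H. ?Y u c v (?l b))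
      = (\<Sum>u\<in>U. \<Sum>c\<in>gluings A u G. odot_generators
          (insert_specified (A, a) u (G, i) c, insert_specified (A, a) u (g, l) c) ((H, j), (h, m)))"
    by (intro sum.cong refl) (simp only: left' odot_left)
  also have "(\<Sum>w\<in>W. \<Sum>c\<in>gluings A w H. \<Sum>v\<in>V. \<Sum>b\<in>gluings G v H. ?Z w c (Inr v) (?r b))
      = (\<Sum>w\<in>W. \<Sum>c\<in>gluings A w H. odot_generators ((G, i), (g, l))
          (insert_specified (A, a) w (H, j) c, insert_specified (A, a) w (h, m) c))"
    by (intro sum.cong refl) (simp only: right' odot_right cong: sum.cong)
  finally show ?thesis .
qed


section \<open>Bilinear extension\<close>

definition scale :: "'k \<Rightarrow> ('a \<Rightarrow>\<^sub>0 'k) \<Rightarrow> ('a \<Rightarrow>\<^sub>0 'k::field)" where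
  "scale c = Poly_Mapping.map ((*) c)"

lemma lookup_scale [simp]: "Poly_Mapping.lookup (scale c z) k = c * Poly_Mapping.lookup z k"
  by (simp add: scale_def Poly_Mapping.map.rep_eq when_def)

lemma scale_linear:
  "scale c (z + z') = scale c z + scale c z'" "scale (c + d) z = scale c z + scale d z"
  "scale c (scale d z) = scale (c * d) z" "scale 0 z = 0" "scale c 0 = 0" "scale 1 z = z"
  by (rule poly_mapping_eqI, simp add: lookup_add algebra_simps)+

lemma scale_sum: "scale c (sum f S) = (\<Sum>s\<in>S. scale c (f s))"
  by (induction S rule: infinite_finite_induct) (simp_all add: scale_linear)

text \<open>
  A finitely supported function is a linear combination of basis vectors, so a property that is
  stable under linear combinations needs to be checked on basis vectors only.
\<close>

lemma basis_induct [consumes 1, case_names zero add scale basis]: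
  assumes "Poly_Mapping.keys z \<subseteq> S" and zero: "P 0"
    and add: "\<And>z z'. P z \<Longrightarrow> P z' \<Longrightarrow> P (z + z')"
    and scale: "\<And>c z. P z \<Longrightarrow> P (scale c z)"
    and basis: "\<And>X. X \<in> S \<Longrightarrow> P (Poly_Mapping.single X (1 :: 'k::field))"
  shows "P z"
proof -
  have part: "P (\<Sum>X\<in>A. scale (Poly_Mapping.lookup z X) (Poly_Mapping.single X 1))"
    if "A \<subseteq> S" "finite A" for A
    using that(2,1)
    by (induction A rule: finite_induct) (simp_all add: zero add scale basis)
  have "z = (\<Sum>X\<in>Poly_Mapping.keys z. scale (Poly_Mapping.lookup z X) (Poly_Mapping.single X 1))"
    (is "_ = ?s")
  proof (rule poly_mapping_eqI)
    fix Y
    have "Poly_Mapping.lookup ?s Y = (\<Sum>X\<in>Poly_Mapping.keys z. if X = Y then Poly_Mapping.lookup z Y else 0)"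
      unfolding lookup_sum by (rule sum.cong) (auto simp: lookup_single when_def)
    also have "\<dots> = Poly_Mapping.lookup z Y"
      by (simp add: in_keys_iff)
    finally show "Poly_Mapping.lookup z Y = Poly_Mapping.lookup ?s Y" ..
  qed
  then show ?thesis using part[OF assms(1)] by simp
qed

lemma bilinear_extension_superset:
  assumes "finite A" "finite B" "Poly_Mapping.keys x \<subseteq> A" "Poly_Mapping.keys y \<subseteq> B"
  shows "bilinear_extension m x y =
    (\<Sum>X\<in>A. \<Sum>Y\<in>B. scale (Poly_Mapping.lookup x X * Poly_Mapping.lookup y Y) (m (rep X) (rep Y)))"
proof -
  have "(\<Sum>Y\<in>Poly_Mapping.keys y. scale (Poly_Mapping.lookup x X * Poly_Mapping.lookup y Y) (m (rep X) (rep Y)))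
      = (\<Sum>Y\<in>B. scale (Poly_Mapping.lookup x X * Poly_Mapping.lookup y Y) (m (rep X) (rep Y)))" for X
    by (rule sum.mono_neutral_left[OF assms(2,4)]) (simp add: in_keys_iff scale_linear)
  then have "bilinear_extension m x y = (\<Sum>X\<in>Poly_Mapping.keys x. \<Sum>Y\<in>B.
      scale (Poly_Mapping.lookup x X * Poly_Mapping.lookup y Y) (m (rep X) (rep Y)))"
    unfolding bilinear_extension_def scale_def[symmetric] by simp
  also have "\<dots> = (\<Sum>X\<in>A. \<Sum>Y\<in>B.
      scale (Poly_Mapping.lookup x X * Poly_Mapping.lookup y Y) (m (rep X) (rep Y)))"
    by (rule sum.mono_neutral_left[OF assms(1,3)]) (simp add: in_keys_iff scale_linear)
  finally show ?thesis .
qed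

lemma bilinear_extension_add:
  "bilinear_extension m (x + x') y = bilinear_extension m x y + bilinear_extension m x' y"
  "bilinear_extension m x (y + y') = bilinear_extension m x y + bilinear_extension m x y'"
proof -
  let ?A = "Poly_Mapping.keys x \<union> Poly_Mapping.keys x'" and ?B = "Poly_Mapping.keys y \<union> Poly_Mapping.keys y'"
  have fin: "finite ?A" "finite ?B" by simp_all
  have sub: "Poly_Mapping.keys (x + x') \<subseteq> ?A" "Poly_Mapping.keys (y + y') \<subseteq> ?B"
    by (rule Poly_Mapping.keys_add)+
  have sup: "bilinear_extension m s t = (\<Sum>X\<in>?A. \<Sum>Y\<in>?B.
      scale (Poly_Mapping.lookup s X * Poly_Mapping.lookup t Y) (m (rep X) (rep Y)))"
    if "Poly_Mapping.keys s \<subseteq> ?A" "Poly_Mapping.keys t \<subseteq> ?B" for s t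
    using bilinear_extension_superset[OF fin that] .
  show "bilinear_extension m (x + x') y = bilinear_extension m x y + bilinear_extension m x' y"
    using sub by (simp add: sup lookup_add distrib_right scale_linear sum.distrib)
  show "bilinear_extension m x (y + y') = bilinear_extension m x y + bilinear_extension m x y'"
    using sub by (simp add: sup lookup_add distrib_left scale_linear sum.distrib)
qed

lemma keys_scale: "Poly_Mapping.keys (scale c z) \<subseteq> Poly_Mapping.keys z"
  by (auto simp: in_keys_iff)

lemma bilinear_extension_scale:
  "bilinear_extension m (scale c x) y = scale c (bilinear_extension m x y)"
  "bilinear_extension m x (scale c y) = scale c (bilinear_extension m x y)"
proof -
  have sup: "bilinear_extension m s t = (\<Sum>X\<in>Poly_Mapping.keys x. \<Sum>Y\<in>Poly_Mapping.keys y.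
      scale (Poly_Mapping.lookup s X * Poly_Mapping.lookup t Y) (m (rep X) (rep Y)))"
    if "Poly_Mapping.keys s \<subseteq> Poly_Mapping.keys x" "Poly_Mapping.keys t \<subseteq> Poly_Mapping.keys y" for s t
    using bilinear_extension_superset[OF finite_keys finite_keys that] .
  show "bilinear_extension m (scale c x) y = scale c (bilinear_extension m x y)"
    "bilinear_extension m x (scale c y) = scale c (bilinear_extension m x y)"
    by (simp_all add: sup keys_scale scale_sum scale_linear mult_ac)
qed

lemma bilinear_extension_zero:
  "bilinear_extension m 0 y = 0" "bilinear_extension m x 0 = 0"
  by (simp_all add: bilinear_extension_def)

lemma bilinear_extension_sum:
  "bilinear_extension m (sum f S) y = (\<Sum>s\<in>S. bilinear_extension m (f s) y)"
  "bilinear_extension m x (sum f' S) = (\<Sum>s\<in>S. bilinear_extension m x (f' s))"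
  by (induction S rule: infinite_finite_induct)
     (simp_all add: bilinear_extension_add bilinear_extension_zero)

lemma bilinear_extension_basis:
  "bilinear_extension m (Poly_Mapping.single X 1) (Poly_Mapping.single Y 1) = m (rep X) (rep Y)"
  by (simp add: bilinear_extension_def scale_linear flip: scale_def)

lemma F_space_closed:
  "0 \<in> F_space T" "z \<in> F_space T \<Longrightarrow> z' \<in> F_space T \<Longrightarrow> z + z' \<in> F_space T"
  "z \<in> F_space T \<Longrightarrow> scale c z \<in> F_space T"
  using Poly_Mapping.keys_add[of z z'] keys_scale[of c z] by (auto simp: F_space_def)

lemma F_space_sum: "(\<And>s. s \<in> S \<Longrightarrow> f s \<in> F_space T) \<Longrightarrow> sum f S \<in> F_space T"
  by (induction S rule: infinite_finite_induct) (simp_all add: F_space_closed)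


section \<open>The derivation property\<close>

lemma rep_specified_pair:
  assumes "specified_pair T P"
  shows "specified_pair T (rep (gpair_class P))"
    and "gpair_class (rep (gpair_class P)) = gpair_class P"
proof -
  obtain f k where iso: "gpair_iso f k P (rep (gpair_class P))"
    by (rule rep_gpair_class[OF specified_pair_covered[OF assms]])
  show "specified_pair T (rep (gpair_class P))" by (rule specified_pair_iso[OF assms iso])
  show "gpair_class (rep (gpair_class P)) = gpair_class P"
    using gpair_class_eq[OF specified_pair_covered[OF assms] iso] ..
qed

lemma single_specified_pair:
  assumes "specified_pair T P"
  shows "Poly_Mapping.single (gpair_class P) (1 :: 'k::field) \<in> F_space T"
proof -
  have "gpair_class P \<in> gpair_class ` {Q :: (nat, nat, _) gpair. specified_pair T Q}"
    using rep_specified_pair[OF assms] by (intro image_eqI[where x = "rep (gpair_class P)"]) auto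
  then show ?thesis by (simp add: F_space_def)
qed

lemma rep_connected_specified_graph:
  fixes \<Gamma> :: "(nat, nat, 'h) sgraph"
  assumes "connected_specified_graph T \<Gamma>"
  shows "connected_specified_graph T (rep (sgraph_class \<Gamma>))"
proof -
  have "sgraph_iso id id \<Gamma> \<Gamma>" by (cases \<Gamma>) (simp add: graph_iso_def)
  then have "\<Gamma> \<in> sgraph_class \<Gamma>" by (auto simp: sgraph_class_def)
  then have "rep (sgraph_class \<Gamma>) \<in> sgraph_class \<Gamma>" unfolding rep_def by (rule someI)
  then obtain f k where "sgraph_iso f k \<Gamma> (rep (sgraph_class \<Gamma>))" by (auto simp: sgraph_class_def)
  then show ?thesis
    using assms connected_specified_graph_iso by (metis surj_pair)
qed

lemma odot_generators_in_F_space: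
  assumes P: "specified_pair T P" and Q: "specified_pair T Q"
  shows "odot_generators P Q \<in> F_space T"
proof -
  obtain G i g l where Pe: "P = ((G, i), (g, l))" by (metis surj_pair)
  obtain H j h m where Qe: "Q = ((H, j), (h, m))" by (metis surj_pair)
  show ?thesis
    unfolding odot_generators_def Pe Qe fst_conv snd_conv
    by (intro F_space_sum single_specified_pair specified_pair_odot[OF P[unfolded Pe] Q[unfolded Qe]])
       auto
qed

lemma ins_generators_in_F_space:
  assumes \<Gamma>: "connected_specified_graph T \<Gamma>" and Q: "specified_pair T Q"
  shows "ins_generators \<Gamma> Q \<in> F_space T"
proof -
  obtain A a where Ae: "\<Gamma> = (A, a)" by (metis surj_pair)
  obtain H j h m where Qe: "Q = ((H, j), (h, m))" by (metis surj_pair)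
  show ?thesis
    unfolding ins_generators_def Ae Qe fst_conv snd_conv
    by (intro F_space_sum single_specified_pair specified_pair_ins[OF \<Gamma>[unfolded Ae] Q[unfolded Qe]])
       auto
qed

text \<open>
  On basis vectors the identity is the one for generators: the terms of an inner operation are
  classes of pairs, and passing to the representative of a class does not affect the outer one.
\<close>

lemma ins_odot_basis:
  fixes T :: "'h qft"
  assumes \<Gamma>: "connected_specified_graph T (rep X)"
    and P: "specified_pair T (rep Y)" and Q: "specified_pair T (rep Z)"
  defines "s \<equiv> Poly_Mapping.single X (1 :: 'k::field)"
    and "x \<equiv> Poly_Mapping.single Y (1 :: 'k)" and "y \<equiv> Poly_Mapping.single Z (1 :: 'k)"
  shows "s \<leadsto> (x \<odot> y) = (s \<leadsto> x) \<odot> y + x \<odot> (s \<leadsto> y)"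
proof -
  obtain A a where Ae: "rep X = (A, a)" by (metis surj_pair)
  obtain G i g l where Pe: "rep Y = ((G, i), (g, l))" by (metis surj_pair)
  obtain H j h m where Qe: "rep Z = ((H, j), (h, m))" by (metis surj_pair)
  note spec = \<Gamma>[unfolded Ae] P[unfolded Pe] Q[unfolded Qe]
  have id: "gpair_iso id id P P" for P :: "(nat, nat, 'h) gpair"
  proof -
    have "sgraph_iso id id K K" for K :: "(nat, nat, 'h) sgraph"
      by (cases K) (simp add: graph_iso_def)
    then show ?thesis by (simp add: gpair_iso_def)
  qed
  have ins_class: "s \<leadsto> Poly_Mapping.single (gpair_class R) 1 = ins_generators (A, a) R"
    if R: "specified_pair T R" for R :: "('v, 'e, 'h) gpair"
  proof -
    obtain f k where iso: "gpair_iso f k R (rep (gpair_class R))"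
      by (rule rep_gpair_class[OF specified_pair_covered[OF R]])
    show ?thesis
      by (simp add: ins_def s_def bilinear_extension_basis Ae ins_generators_iso[OF spec(1) R iso, symmetric])
  qed
  have odot_class_left: "Poly_Mapping.single (gpair_class R) 1 \<odot> y = odot_generators R ((H, j), (h, m))"
    if R: "specified_pair T R" for R :: "('v, 'e, 'h) gpair"
  proof -
    obtain f k where iso: "gpair_iso f k R (rep (gpair_class R))"
      by (rule rep_gpair_class[OF specified_pair_covered[OF R]])
    show ?thesis
      by (simp add: odot_def y_def bilinear_extension_basis Qe odot_generators_iso[OF R spec(3) iso id, symmetric])
  qed
  have odot_class_right: "x \<odot> Poly_Mapping.single (gpair_class R) 1 = odot_generators ((G, i), (g, l)) R"
    if R: "specified_pair T R" for R :: "('v, 'e, 'h) gpair"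
  proof -
    obtain f k where iso: "gpair_iso f k R (rep (gpair_class R))"
      by (rule rep_gpair_class[OF specified_pair_covered[OF R]])
    show ?thesis
      by (simp add: odot_def x_def bilinear_extension_basis Pe odot_generators_iso[OF spec(2) R id iso, symmetric])
  qed
  let ?PQ = "\<lambda>v b. (insert_specified (G, i) v (H, j) b, union_specified ((G, i), (g, l)) v ((H, j), (h, m)) b)"
  let ?AP = "\<lambda>u c. (insert_specified (A, a) u (G, i) c, insert_specified (A, a) u (g, l) c)"
  let ?AQ = "\<lambda>w c. (insert_specified (A, a) w (H, j) c, insert_specified (A, a) w (h, m) c)"
  let ?V = "{v \<in> verts H - core h. vtype H v = res_type (G, i)}"
  let ?U = "{u \<in> core g. vtype G u = res_type (A, a)}"
  let ?W = "{w \<in> core h. vtype H w = res_type (A, a)}"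
  have "s \<leadsto> (x \<odot> y) = s \<leadsto> odot_generators ((G, i), (g, l)) ((H, j), (h, m))"
    by (simp add: odot_def x_def y_def bilinear_extension_basis Pe Qe)
  also have "\<dots> = (\<Sum>v\<in>?V. \<Sum>b\<in>gluings G v H. s \<leadsto> Poly_Mapping.single (gpair_class (?PQ v b)) 1)"
    unfolding odot_generators_def fst_conv snd_conv ins_def bilinear_extension_sum ..
  also have "\<dots> = (\<Sum>v\<in>?V. \<Sum>b\<in>gluings G v H. ins_generators (A, a) (?PQ v b))"
    by (intro sum.cong refl ins_class specified_pair_odot[OF spec(2,3)]) auto
  also have "\<dots> = (\<Sum>u\<in>?U. \<Sum>c\<in>gluings A u G. odot_generators (?AP u c) ((H, j), (h, m)))
    + (\<Sum>w\<in>?W. \<Sum>c\<in>gluings A w H. odot_generators ((G, i), (g, l)) (?AQ w c))"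
    by (rule ins_odot_generators[OF spec])
  also have "(\<Sum>u\<in>?U. \<Sum>c\<in>gluings A u G. odot_generators (?AP u c) ((H, j), (h, m)))
      = (\<Sum>u\<in>?U. \<Sum>c\<in>gluings A u G. Poly_Mapping.single (gpair_class (?AP u c)) 1 \<odot> y)"
    by (intro sum.cong refl odot_class_left[symmetric] specified_pair_ins[OF spec(1,2)]) auto
  also have "\<dots> = ins_generators (A, a) ((G, i), (g, l)) \<odot> y"
    unfolding ins_generators_def fst_conv snd_conv odot_def bilinear_extension_sum ..
  also have "\<dots> = (s \<leadsto> x) \<odot> y"
    by (simp add: ins_def s_def x_def bilinear_extension_basis Ae Pe)
  also have "(\<Sum>w\<in>?W. \<Sum>c\<in>gluings A w H. odot_generators ((G, i), (g, l)) (?AQ w c))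
      = (\<Sum>w\<in>?W. \<Sum>c\<in>gluings A w H. x \<odot> Poly_Mapping.single (gpair_class (?AQ w c)) 1)"
    by (intro sum.cong refl odot_class_right[symmetric] specified_pair_ins[OF spec(1,3)]) auto
  also have "\<dots> = x \<odot> ins_generators (A, a) ((H, j), (h, m))"
    unfolding ins_generators_def fst_conv snd_conv odot_def bilinear_extension_sum ..
  also have "\<dots> = x \<odot> (s \<leadsto> y)"
    by (simp add: ins_def s_def y_def bilinear_extension_basis Ae Qe)
  finally show ?thesis .
qed

lemma odot_linear:
  "(x + x') \<odot> y = (x \<odot> y) + (x' \<odot> y)" "x \<odot> (y + y') = (x \<odot> y) + (x \<odot> y')"
  "scale c x \<odot> y = scale c (x \<odot> y)" "x \<odot> scale c y = scale c (x \<odot> y)"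
  "0 \<odot> y = 0" "x \<odot> 0 = 0"
  unfolding odot_def by (rule bilinear_extension_add bilinear_extension_scale bilinear_extension_zero)+

lemma ins_linear:
  "(x + x') \<leadsto> y = (x \<leadsto> y) + (x' \<leadsto> y)" "x \<leadsto> (y + y') = (x \<leadsto> y) + (x \<leadsto> y')"
  "scale c x \<leadsto> y = scale c (x \<leadsto> y)" "x \<leadsto> scale c y = scale c (x \<leadsto> y)"
  "0 \<leadsto> y = 0" "x \<leadsto> 0 = 0"
  unfolding ins_def by (rule bilinear_extension_add bilinear_extension_scale bilinear_extension_zero)+

theorem theorem5:
  fixes T :: "'h qft"
    and g :: "'h sgraph_class \<Rightarrow>\<^sub>0 'k::field"
    and x y :: "'h gpair_class \<Rightarrow>\<^sub>0 'k"
  assumes "physical_theory T"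
    and "g \<in> V_space T"
    and "x \<in> F_space T"
    and "y \<in> F_space T"
  shows "x \<odot> y \<in> F_space T \<and> (g \<leadsto> x) \<in> F_space T \<and>
    g \<leadsto> (x \<odot> y) = (g \<leadsto> x) \<odot> y + x \<odot> (g \<leadsto> y)"
proof -
  let ?V = "sgraph_class ` {G :: (nat, nat, 'h) sgraph. connected_specified_graph T G}"
  let ?F = "gpair_class ` {P :: (nat, nat, 'h) gpair. specified_pair T P}"
  have repV: "connected_specified_graph T (rep X)" if X: "X \<in> ?V" for X
  proof -
    obtain \<Gamma> :: "(nat, nat, 'h) sgraph"
      where "connected_specified_graph T \<Gamma>" "X = sgraph_class \<Gamma>" using X by blast
    then show ?thesis by (simp only: rep_connected_specified_graph)
  qed
  have repF: "specified_pair T (rep X)" if X: "X \<in> ?F" for X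
  proof -
    obtain P :: "(nat, nat, 'h) gpair"
      where "specified_pair T P" "X = gpair_class P" using X by blast
    then show ?thesis by (simp only: rep_specified_pair(1))
  qed
  have keys: "Poly_Mapping.keys g \<subseteq> ?V" "Poly_Mapping.keys x \<subseteq> ?F" "Poly_Mapping.keys y \<subseteq> ?F"
    using assms(2-4) by (simp_all add: V_space_def F_space_def)
  have "x \<odot> y \<in> F_space T"
    using keys(2)
  proof (induction rule: basis_induct)
    case (basis X)
    show ?case
      using keys(3)
    proof (induction rule: basis_induct)
      case (basis Y)
      show ?case
        using odot_generators_in_F_space[OF repF repF, OF \<open>X \<in> ?F\<close> basis]
        by (simp add: odot_def bilinear_extension_basis)
    qed (simp_all add: odot_linear F_space_closed)
  qed (simp_all add: odot_linear F_space_closed)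
  moreover have "(g \<leadsto> x) \<in> F_space T"
    using keys(1)
  proof (induction rule: basis_induct)
    case (basis X)
    show ?case
      using keys(2)
    proof (induction rule: basis_induct)
      case (basis Y)
      show ?case
        using ins_generators_in_F_space[OF repV repF, OF \<open>X \<in> ?V\<close> basis]
        by (simp add: ins_def bilinear_extension_basis)
    qed (simp_all add: ins_linear F_space_closed)
  qed (simp_all add: ins_linear F_space_closed)
  moreover have "g \<leadsto> (x \<odot> y) = (g \<leadsto> x) \<odot> y + x \<odot> (g \<leadsto> y)"
    using keys(1)
  proof (induction rule: basis_induct)
    case (basis X)
    show ?case
      using keys(2)
    proof (induction rule: basis_induct)
      case (basis Y)
      show ?case
        using keys(3)
      proof (induction rule: basis_induct)
        case (basis Z)
        show ?case
          by (rule ins_odot_basis[OF repV repF repF]) fact+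
      qed (simp_all add: odot_linear ins_linear scale_linear algebra_simps)
    qed (simp_all add: odot_linear ins_linear scale_linear algebra_simps)
  qed (simp_all add: odot_linear ins_linear scale_linear algebra_simps)
  ultimately show ?thesis by blast
qed

end
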